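(* Let $V$ be an $n_0$-dimensional $\mathbb{F}_p$-vector space, let $G$ be a finite group whose order is divisible by $p$, and let $\rho\colon G\to GL(V)\cong GL_{n_0}(\mathbb{F}_p)$ be a faithful representation. Let $P$ be a Sylow $p$-subgroup of $G$, and let $C\subseteq V^P$ be a subspace. (1) If $x_1,\ldots,x_n$ is a sequence of homogeneous elements of positive degree in $\mathbb{F}[V]^G$ such that the restrictions of $x_1,\ldots,x_n$ form a regular sequence in $H_C^*$, then $x_1,\ldots,x_n$ form a regular sequence in $\mathbb{F}[V]^G$. (2) The depth of $\mathbb{F}[V]^G$ is at least $\dim_{\mathbb{F}_p}(V^P)$.
   Context: $\mathbb{F}[V]$ is the graded algebra of polynomial functions on $V$, i.e. the symmetric algebra over $\mathbb{F}_p$ on the dual $V^*$, with generators placed in degree 2; $G$ acts on it, and $\mathbb{F}[V]^G$ is the ring of invariants. $V^P=\{v\in V\mid g\cdot v=v\ \text{for all}\ g\in P\}$. A subspace $C\subseteq V$ is regarded also as an elementary abelian $p$-group, with $H_C^*=H^*(BC;\mathbb{F}_p)$. The restriction map is the composite $\mathbb{F}[V]^G\to\mathbb{F}[V]\to\mathbb{F}[C]\to H_C^*$, where the last map is the algebra map given on generators $C^*=H^1(BC;\mathbb{F}_p)$ by the Bockstein $H^1(BC;\mathbb{F}_p)\to H^2(BC;\mathbb{F}_p)$; it makes $H_C^*$ an $\mathbb{F}[V]^G$-module. A sequence $y_1,\dots,y_n$ of positive-degree elements of $\mathbb{F}[V]^G$ is regular on a module $M$ if $y_i$ is a non-zero-divisor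 on $M/(y_1,\ldots,y_{i-1})M$ for each $i$; the depth of $\mathbb{F}[V]^G$ is the supremum of lengths of regular sequences of homogeneous positive-degree elements in $\mathbb{F}[V]^G$. *)

theory Defs
  imports
    "HOL-Algebra.QuotRing"
    "HOL-Algebra.Module"
    "HOL-Library.Poly_Mapping"
    "HOL-Library.Extended_Nat"
    "Berlekamp_Zassenhaus.Finite_Field"
begin

text \<open>
  The prime field is \<^typ>\<open>'p mod_ring\<close> with \<open>'p :: prime_card\<close>, so \<open>p = CARD('p)\<close>.
  The vector space \<open>V\<close> is a whole type \<open>'v\<close> with a scalar multiplication \<open>scale\<close>.
  The names \<open>module\<close> and \<open>subspace\<close> of \<^theory>\<open>HOL.Modules\<close> are qualified, because HOL-Algebra
  has a different locale \<open>module\<close>.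
\<close>

section \<open>Linear representations\<close>

definition GL :: "('k::field \<Rightarrow> 'v::ab_group_add \<Rightarrow> 'v) \<Rightarrow> ('v \<Rightarrow> 'v) monoid" where
  "GL scale = \<lparr>carrier = {T. Vector_Spaces.linear scale scale T \<and> bij T},
               monoid.mult = (\<circ>), one = id\<rparr>"

definition fixed_space :: "('g \<Rightarrow> 'v \<Rightarrow> 'v) \<Rightarrow> 'g set \<Rightarrow> 'v set" where
  "fixed_space \<rho> P = {v. \<forall>g\<in>P. \<rho> g v = v}"

definition sylow_subgroup :: "nat \<Rightarrow> 'g set \<Rightarrow> ('g, 'z) monoid_scheme \<Rightarrow> bool" where
  "sylow_subgroup p P G \<longleftrightarrow> subgroup P G \<and> card P = p ^ multiplicity p (Coset.order G)"

definition basis_list :: "('k::field \<Rightarrow> 'v::ab_group_add \<Rightarrow> 'v) \<Rightarrow> 'v set \<Rightarrow> 'v list \<Rightarrow> bool" where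
  "basis_list scale W bs \<longleftrightarrow>
     distinct bs \<and> \<not> Modules.module.dependent scale (set bs)
     \<and> Modules.module.span scale (set bs) = W"

definition coord :: "('k::field \<Rightarrow> 'v::ab_group_add \<Rightarrow> 'v) \<Rightarrow> 'v list \<Rightarrow> nat \<Rightarrow> 'v \<Rightarrow> 'k" where
  "coord scale bs i v = Modules.module.representation scale (set bs) v (bs ! i)"


section \<open>Polynomial functions\<close>

text \<open>
  For a space \<open>W\<close> with basis \<open>bs\<close>, the symmetric algebra on the dual of \<open>W\<close> is the polynomial
  ring in the dual basis: the variable \<open>i < length bs\<close> is the linear form \<open>coord scale bs i\<close>.
  Its elements are formal polynomials, not functions on the finite set \<open>W\<close>.
\<close>

type_synonym 'k poly_alg = "(nat \<Rightarrow>\<^sub>0 nat) \<Rightarrow>\<^sub>0 'k"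

definition poly_const :: "'k::comm_ring_1 \<Rightarrow> 'k poly_alg" where
  "poly_const a = Poly_Mapping.single 0 a"

definition poly_var :: "nat \<Rightarrow> 'k::comm_ring_1 poly_alg" where
  "poly_var i = Poly_Mapping.single (Poly_Mapping.single i 1) 1"

definition poly_carrier :: "nat \<Rightarrow> 'k::comm_ring_1 poly_alg set" where
  "poly_carrier n = {f. \<forall>m\<in>Poly_Mapping.keys f. Poly_Mapping.keys m \<subseteq> {..<n}}"

definition poly_subst :: "(nat \<Rightarrow> 'k::comm_ring_1 poly_alg) \<Rightarrow> 'k poly_alg \<Rightarrow> 'k poly_alg" where
  "poly_subst s f =
     (\<Sum>m\<in>Poly_Mapping.keys f. poly_const (Poly_Mapping.lookup f m) *
        (\<Prod>i\<in>Poly_Mapping.keys m. s i ^ Poly_Mapping.lookup m i))"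

text \<open>Every variable has degree 2.\<close>

definition homogeneous :: "nat \<Rightarrow> 'k::comm_ring_1 poly_alg \<Rightarrow> bool" where
  "homogeneous d f \<longleftrightarrow>
     (\<forall>m\<in>Poly_Mapping.keys f. 2 * (\<Sum>i\<in>Poly_Mapping.keys m. Poly_Mapping.lookup m i) = d)"

definition homogeneous_pos :: "'k::comm_ring_1 poly_alg \<Rightarrow> bool" where
  "homogeneous_pos f \<longleftrightarrow> (\<exists>d>0. homogeneous d f)"

definition linear_form :: "'v list \<Rightarrow> ('v \<Rightarrow> 'k::comm_ring_1) \<Rightarrow> 'k poly_alg" where
  "linear_form bs l = (\<Sum>j<length bs. poly_const (l (bs ! j)) * poly_var j)"

text \<open>
  The pullback \<open>f \<mapsto> f \<circ> T\<close> along a linear map \<open>T\<close> from the space with basis \<open>ds\<close> to the space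
  with basis \<open>bs\<close>.
\<close>

definition pullback ::
  "('k::field \<Rightarrow> 'v::ab_group_add \<Rightarrow> 'v) \<Rightarrow> 'v list \<Rightarrow> 'v list \<Rightarrow> ('v \<Rightarrow> 'v) \<Rightarrow> 'k poly_alg \<Rightarrow> 'k poly_alg"
where
  "pullback scale bs ds T = poly_subst (\<lambda>i. linear_form ds (coord scale bs i \<circ> T))"

text \<open>The action is \<open>(g \<cdot> f)(v) = f (g\<inverse> v)\<close>.\<close>

definition invariant_ring ::
  "('k::field \<Rightarrow> 'v::ab_group_add \<Rightarrow> 'v) \<Rightarrow> 'v list \<Rightarrow> ('g, 'z) monoid_scheme \<Rightarrow> ('g \<Rightarrow> 'v \<Rightarrow> 'v)
    \<Rightarrow> 'k poly_alg ring"
where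
  "invariant_ring scale bs G \<rho> =
     \<lparr>carrier = {f \<in> poly_carrier (length bs).
                  \<forall>g\<in>carrier G. pullback scale bs bs (\<rho> (inv\<^bsub>G\<^esub> g)) f = f},
      monoid.mult = (*), one = 1, zero = 0, add = (+)\<rparr>"


section \<open>Mod p cohomology of BC\<close>

text \<open>
  \<open>BC\<close> is the nerve of the additive group \<open>C\<close>: an \<open>n\<close>-simplex is a list of \<open>n\<close> elements of \<open>C\<close>.
  An element of the direct sum of all cochain groups is one function on lists, whose restriction to
  the lists of length \<open>n\<close> is the component of degree \<open>n\<close>.
\<close>

definition cochains :: "'v set \<Rightarrow> ('v list \<Rightarrow> 'a::comm_ring_1) set" where
  "cochains C = {c. (\<forall>l. c l \<noteq> 0 \<longrightarrow> l \<in> lists C) \<and> (\<exists>N. \<forall>l. c l \<noteq> 0 \<longrightarrow> length l < N)}"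

definition face :: "nat \<Rightarrow> 'v::ab_group_add list \<Rightarrow> 'v list" where
  "face i l =
     (if i = 0 then tl l
      else if i = length l then butlast l
      else take (i - 1) l @ (l ! (i - 1) + l ! i) # drop (i + 1) l)"

definition differential ::
  "'v::ab_group_add set \<Rightarrow> ('v list \<Rightarrow> 'a::comm_ring_1) \<Rightarrow> 'v list \<Rightarrow> 'a"
where
  "differential C c l =
     (if l \<in> lists C \<and> l \<noteq> [] then \<Sum>i\<le>length l. (- 1) ^ i * c (face i l) else 0)"

definition cup :: "('v list \<Rightarrow> 'a::comm_ring_1) \<Rightarrow> ('v list \<Rightarrow> 'a) \<Rightarrow> 'v list \<Rightarrow> 'a" where
  "cup c d l = (\<Sum>i\<le>length l. c (take i l) * d (drop i l))"

definition const_cochain :: "'a::comm_ring_1 \<Rightarrow> 'v list \<Rightarrow> 'a" where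
  "const_cochain a l = (if l = [] then a else 0)"

definition cocycle_ring :: "'v::ab_group_add set \<Rightarrow> ('v list \<Rightarrow> 'a::comm_ring_1) ring" where
  "cocycle_ring C =
     \<lparr>carrier = {c \<in> cochains C. differential C c = (\<lambda>_. 0)},
      monoid.mult = cup, one = const_cochain 1, zero = (\<lambda>_. 0), add = (\<lambda>c d l. c l + d l)\<rparr>"

definition coboundaries :: "'v::ab_group_add set \<Rightarrow> ('v list \<Rightarrow> 'a::comm_ring_1) set" where
  "coboundaries C = differential C ` cochains C"

definition cohomology :: "'v::ab_group_add set \<Rightarrow> ('v list \<Rightarrow> 'a::comm_ring_1) set ring" where
  "cohomology C = cocycle_ring C Quot coboundaries C"

definition cohomology_class ::
  "'v::ab_group_add set \<Rightarrow> ('v list \<Rightarrow> 'a::comm_ring_1) \<Rightarrow> ('v list \<Rightarrow> 'a) set"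
where
  "cohomology_class C c = coboundaries C +>\<^bsub>cocycle_ring C\<^esub> c"

text \<open>
  The Bockstein is the connecting map of \<open>0 \<rightarrow> \<int>/p \<rightarrow> \<int>/p\<^sup>2 \<rightarrow> \<int>/p \<rightarrow> 0\<close>: lift a cocycle to integer
  values, apply the differential, and divide by \<open>p\<close>.
\<close>

definition bockstein_cochain ::
  "'v::ab_group_add set \<Rightarrow> ('v list \<Rightarrow> 'p::prime_card mod_ring) \<Rightarrow> 'v list \<Rightarrow> 'p mod_ring"
where
  "bockstein_cochain C c l =
     of_int (differential C (\<lambda>l. to_int_mod_ring (c l)) l div int CARD('p))"

text \<open>The class in \<open>H\<^sup>1(BC) = Hom(C, \<int>/p)\<close> of a linear form on \<open>C\<close>, as a cocycle.\<close>

definition form_cochain :: "'v set \<Rightarrow> ('v \<Rightarrow> 'a::comm_ring_1) \<Rightarrow> 'v list \<Rightarrow> 'a" where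
  "form_cochain C f l = (case l of [v] \<Rightarrow> if v \<in> C then f v else 0 | _ \<Rightarrow> 0)"

definition bockstein_gen ::
  "('p::prime_card mod_ring \<Rightarrow> 'v::ab_group_add \<Rightarrow> 'v) \<Rightarrow> 'v set \<Rightarrow> 'v list \<Rightarrow> nat
    \<Rightarrow> ('v list \<Rightarrow> 'p mod_ring) set"
where
  "bockstein_gen scale C cs i =
     cohomology_class C (bockstein_cochain C (form_cochain C (coord scale cs i)))"

text \<open>
  The algebra map from the polynomial functions on \<open>C\<close> (in the basis \<open>cs\<close>) that sends the variable
  \<open>i\<close> to the Bockstein of the corresponding linear form. These Bocksteins have even degree and
  hence commute, so the order of the factors does not matter.
\<close>

definition bockstein_map ::
  "('p::prime_card mod_ring \<Rightarrow> 'v::ab_group_add \<Rightarrow> 'v) \<Rightarrow> 'v set \<Rightarrow> 'v list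
    \<Rightarrow> 'p mod_ring poly_alg \<Rightarrow> ('v list \<Rightarrow> 'p mod_ring) set"
where
  "bockstein_map scale C cs f =
     (\<Oplus>\<^bsub>cohomology C\<^esub>m\<in>Poly_Mapping.keys f.
        cohomology_class C (const_cochain (Poly_Mapping.lookup f m)) \<otimes>\<^bsub>cohomology C\<^esub>
        foldr (\<lambda>i h. (bockstein_gen scale C cs i [^]\<^bsub>cohomology C\<^esub> Poly_Mapping.lookup m i)
                       \<otimes>\<^bsub>cohomology C\<^esub> h)
          [0..<length cs] \<one>\<^bsub>cohomology C\<^esub>)"

definition restriction ::
  "('p::prime_card mod_ring \<Rightarrow> 'v::ab_group_add \<Rightarrow> 'v) \<Rightarrow> 'v list \<Rightarrow> 'v set \<Rightarrow> 'v list
    \<Rightarrow> 'p mod_ring poly_alg \<Rightarrow> ('v list \<Rightarrow> 'p mod_ring) set"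
where
  "restriction scale bs C cs f = bockstein_map scale C cs (pullback scale bs cs id f)"


section \<open>Regular sequences and depth\<close>

text \<open>The ring \<open>S\<close> as a module along a map \<open>h\<close> into it.\<close>

definition module_via :: "('r \<Rightarrow> 's) \<Rightarrow> 's ring \<Rightarrow> ('r, 's) module" where
  "module_via h S =
     \<lparr>carrier = carrier S, monoid.mult = monoid.mult S, one = one S, zero = zero S, add = add S,
      Module.module.smult = (\<lambda>r s. h r \<otimes>\<^bsub>S\<^esub> s)\<rparr>"

definition seq_submodule :: "('r, 's, 'z) module_scheme \<Rightarrow> 'r list \<Rightarrow> 's set" where
  "seq_submodule M ys =
     {(\<Oplus>\<^bsub>M\<^esub>j\<in>{..<length ys}. (ys ! j) \<odot>\<^bsub>M\<^esub> u j) | u. u \<in> {..<length ys} \<rightarrow> carrier M}"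

text \<open>
  Each \<open>ys ! i\<close> is a non-zero-divisor on \<open>M / (ys ! 0, \<dots>, ys ! (i - 1)) M\<close>. Nontriviality of
  \<open>M / (ys) M\<close> is not part of the definition.
\<close>

definition regular_sequence :: "('r, 's, 'z) module_scheme \<Rightarrow> 'r list \<Rightarrow> bool" where
  "regular_sequence M ys \<longleftrightarrow>
     (\<forall>i<length ys. \<forall>u\<in>carrier M.
        (ys ! i) \<odot>\<^bsub>M\<^esub> u \<in> seq_submodule M (take i ys) \<longrightarrow> u \<in> seq_submodule M (take i ys))"

definition depth :: "'k::comm_ring_1 poly_alg ring \<Rightarrow> enat" where
  "depth R = Sup {enat (length ys) | ys.
     set ys \<subseteq> carrier R \<and> (\<forall>y\<in>set ys. homogeneous_pos y) \<and> regular_sequence (module_via id R) ys}"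

end

theory Submission
imports Defs
begin

text \<open>
  The proof splits into two independent halves with the polynomial ring \<open>\<bbbF>[C]\<close> in the middle: a
  sequence of invariants whose restrictions are regular on the cohomology of \<open>BC\<close> has restrictions
  that are regular on \<open>\<bbbF>[C]\<close>, and a sequence of homogeneous invariants whose restrictions are regular
  on \<open>\<bbbF>[C]\<close> is regular on the ring of invariants.

  For the first half, the Bockstein map makes \<open>\<bbbF>[C]\<close> a direct summand of the cohomology as a module over
  \<open>\<bbbF>[C]\<close>. The retraction evaluates a cocycle on explicit cycles of the bar construction. For a cyclic
  group generated by \<open>s\<close> these are the sums of all words \<open>[k\<^sub>1 s, s, \<dots>, k\<^sub>n s, s]\<close>, and for \<open>C\<close> they are
  shuffle products of such cycles, one for each basis vector. A Bockstein cocycle reads off the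
  carry of the first two letters, so capping with it lowers one of the exponents by one
  (\<open>pairing_cup\<close>). This says that the retraction is linear over \<open>\<bbbF>[C]\<close>. Regularity passes to a direct
  summand (\<open>regular_on_of_cohomology\<close>).

  For the second half, let \<open>S\<close> be the ring of \<open>P\<close>-invariants. Since \<open>P\<close> fixes \<open>C\<close> pointwise, \<open>f (v + c)\<close> is
  again \<open>P\<close>-invariant in \<open>v\<close>, so translation maps \<open>S\<close> to \<open>S \<otimes> \<bbbF>[C]\<close>. The leading term of a translated
  invariant, with respect to the degree in \<open>v\<close>, is its restriction to \<open>C\<close>. If the restrictions are
  regular on \<open>\<bbbF>[C]\<close>, the translated sequence is therefore regular on \<open>S \<otimes> \<bbbF>[C]\<close> up to arbitrarily high
  degree in \<open>v\<close>. Setting \<open>c = 0\<close> gives regularity on \<open>S\<close> (\<open>regular_on_translation_stable\<close>). The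
  transfer makes the \<open>G\<close>-invariants a direct summand of \<open>S\<close>, because the index of a Sylow subgroup is
  prime to \<open>p\<close> (\<open>regular_on_transfer\<close>).

  For the bound on the depth, the second half is applied with the whole fixed space as \<open>C\<close>. The
  required invariants are Dickson invariants of \<open>V\<close>. They restrict to powers of Dickson
  invariants of \<open>C\<close>, and these are shown to be regular by an induction that divides out one
  linear form at a time (\<open>regular_dickson_seq\<close>, \<open>dickson_invariants\<close>).
\<close>

section \<open>Substitution homomorphisms\<close>

abbreviation "mkeys \<equiv> Poly_Mapping.keys"
abbreviation "mlookup \<equiv> Poly_Mapping.lookup"
abbreviation "msingle \<equiv> Poly_Mapping.single"

lemma comm_ring_homI:
  assumes "h 0 = 0" "h 1 = 1" "\<And>a b. h (a + b) = h a + h b" "\<And>a b. h (a * b) = h a * h b"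
  shows "comm_ring_hom h"
  using assms by unfold_locales auto

definition monom_eval :: "(nat \<Rightarrow> 'b::comm_ring_1) \<Rightarrow> (nat \<Rightarrow>\<^sub>0 nat) \<Rightarrow> 'b" where
  "monom_eval s m = (\<Prod>i\<in>mkeys m. s i ^ mlookup m i)"

text \<open>
  The case \<open>h = poly_const\<close> is \<^const>\<open>poly_subst\<close>. Other targets give the constant term, the coefficientwise
  maps and the translation map, which therefore are ring homomorphisms for the same reason.
\<close>

definition subst_hom :: "('a::comm_ring_1 \<Rightarrow> 'b::comm_ring_1) \<Rightarrow> (nat \<Rightarrow> 'b) \<Rightarrow> 'a poly_alg \<Rightarrow> 'b" where
  "subst_hom h s f = (\<Sum>m\<in>mkeys f. h (mlookup f m) * monom_eval s m)"

lemma poly_subst_eq_subst_hom: "poly_subst s = subst_hom poly_const s"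
  by (rule ext) (simp add: poly_subst_def subst_hom_def monom_eval_def)

lemma monom_eval_superset:
  assumes "finite I" "mkeys m \<subseteq> I"
  shows "monom_eval s m = (\<Prod>i\<in>I. s i ^ mlookup m i)"
  unfolding monom_eval_def
  by (rule prod.mono_neutral_left) (use assms in \<open>auto simp: in_keys_iff\<close>)

lemma monom_eval_add: "monom_eval s (m + m') = monom_eval s m * monom_eval s m'"
proof -
  let ?I = "mkeys m \<union> mkeys m'"
  have "mkeys (m + m') \<subseteq> ?I" by (rule keys_add)
  then show ?thesis
    by (simp add: monom_eval_superset[of ?I] lookup_add power_add prod.distrib)
qed

lemma monom_eval_0 [simp]: "monom_eval s 0 = 1"
  by (simp add: monom_eval_def)

lemma monom_eval_single [simp]: "monom_eval s (msingle i k) = s i ^ k"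
  by (simp add: monom_eval_def)

lemma subst_hom_superset:
  assumes "h 0 = 0" "finite M" "mkeys f \<subseteq> M"
  shows "subst_hom h s f = (\<Sum>m\<in>M. h (mlookup f m) * monom_eval s m)"
  unfolding subst_hom_def
  by (rule sum.mono_neutral_left) (use assms in \<open>auto simp: in_keys_iff\<close>)

lemma poly_alg_sum_singles: "f = (\<Sum>m\<in>mkeys f. msingle m (mlookup f m))"
proof (rule poly_mapping_eqI)
  fix k
  have "(\<Sum>m\<in>mkeys f. mlookup (msingle m (mlookup f m)) k) =
        (\<Sum>m\<in>mkeys f. if m = k then mlookup f m else 0)"
    by (intro sum.cong refl) (auto simp: lookup_single when_def)
  also have "\<dots> = mlookup f k"
    by (simp add: in_keys_iff)
  finally show "mlookup f k = mlookup (\<Sum>m\<in>mkeys f. msingle m (mlookup f m)) k"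
    by (simp add: lookup_sum)
qed

lemma subst_hom_single: "h 0 = 0 \<Longrightarrow> subst_hom h s (msingle m a) = h a * monom_eval s m"
  by (simp add: subst_hom_def)

lemma subst_hom_hom:
  assumes "comm_ring_hom h"
  shows "comm_ring_hom (subst_hom h s)"
proof -
  interpret comm_ring_hom h by fact
  have add: "subst_hom h s (f + g) = subst_hom h s f + subst_hom h s g" for f g
  proof -
    let ?M = "mkeys f \<union> mkeys g"
    have "mkeys (f + g) \<subseteq> ?M" by (rule keys_add)
    then show ?thesis
      by (simp add: subst_hom_superset[of h ?M] lookup_add hom_add distrib_right sum.distrib)
  qed
  have zero: "subst_hom h s 0 = 0" by (simp add: subst_hom_def)
  have sum: "subst_hom h s (sum f A) = (\<Sum>a\<in>A. subst_hom h s (f a))" if "finite A" for f :: "'c \<Rightarrow> _" and A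
    using that by induction (auto simp: zero add)
  have mult: "subst_hom h s (f * g) = subst_hom h s f * subst_hom h s g" for f g
  proof -
    have "f * g = (\<Sum>m\<in>mkeys f. \<Sum>n\<in>mkeys g. msingle (m + n) (mlookup f m * mlookup g n))"
      by (subst (1) poly_alg_sum_singles[of f], subst (1) poly_alg_sum_singles[of g])
        (simp add: sum_product mult_single)
    then have "subst_hom h s (f * g) =
        (\<Sum>m\<in>mkeys f. \<Sum>n\<in>mkeys g. (h (mlookup f m) * monom_eval s m) * (h (mlookup g n) * monom_eval s n))"
      by (simp add: sum subst_hom_single hom_mult monom_eval_add algebra_simps)
    then show ?thesis by (simp add: subst_hom_def sum_product)
  qed
  show ?thesis
    by (rule comm_ring_homI) (simp_all add: zero add mult, simp add: subst_hom_def)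
qed

lemma poly_const_hom: "comm_ring_hom poly_const"
  by (rule comm_ring_homI) (auto simp: poly_const_def single_add mult_single)

lemma comm_ring_hom_comp: "comm_ring_hom f \<Longrightarrow> comm_ring_hom g \<Longrightarrow> comm_ring_hom (\<lambda>x. f (g x))"
proof -
  assume "comm_ring_hom f" "comm_ring_hom g"
  then interpret f: comm_ring_hom f + g: comm_ring_hom g by auto
  show ?thesis by (rule comm_ring_homI) (auto simp: f.hom_add g.hom_add f.hom_mult g.hom_mult)
qed

lemma poly_subst_hom: "comm_ring_hom (poly_subst s)"
  unfolding poly_subst_eq_subst_hom by (rule subst_hom_hom[OF poly_const_hom])

lemma subst_hom_const: "h 0 = 0 \<Longrightarrow> subst_hom h s (poly_const a) = h a"
  by (simp add: poly_const_def subst_hom_single)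

lemma subst_hom_var: "h 0 = 0 \<Longrightarrow> h 1 = 1 \<Longrightarrow> subst_hom h s (poly_var i) = s i"
  by (simp add: poly_var_def subst_hom_single)

lemma poly_subst_const: "poly_subst s (poly_const a) = poly_const a"
  unfolding poly_subst_eq_subst_hom by (rule subst_hom_const) (simp add: poly_const_def)

lemma poly_subst_var: "poly_subst s (poly_var i) = s i"
  unfolding poly_subst_eq_subst_hom
  by (rule subst_hom_var) (simp_all add: poly_const_def)

lemma monom_eval_var: "monom_eval poly_var m = msingle m 1"
proof -
  have *: "poly_var i ^ k = msingle (msingle i k) (1::'a)" for i k
    by (induction k) (auto simp: poly_var_def mult_single simp flip: single_add)
  have "(\<Prod>i\<in>I. msingle (msingle i (f i)) (1::'a)) = msingle (\<Sum>i\<in>I. msingle i (f i)) 1"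
    if "finite I" for I and f :: "nat \<Rightarrow> nat"
    using that by induction (auto simp: mult_single)
  then show ?thesis
    unfolding monom_eval_def * by (simp flip: poly_alg_sum_singles)
qed

lemma single_eq_const_var: "msingle m a = poly_const a * monom_eval poly_var m"
  by (simp add: monom_eval_var poly_const_def mult_single)

lemma poly_alg_expand: "f = (\<Sum>m\<in>mkeys f. poly_const (mlookup f m) * monom_eval poly_var m)"
  using poly_alg_sum_singles[of f] by (simp add: single_eq_const_var)

text \<open>
  The compatibilities between pullback, restriction and translation reduce by this lemma to
  identities between linear forms.
\<close>

lemma comm_ring_hom_eq_on_poly_carrier:
  assumes "comm_ring_hom h" "comm_ring_hom h'"
    and const: "\<And>a. h (poly_const a) = h' (poly_const a)"
    and var: "\<And>i. i < n \<Longrightarrow> h (poly_var i) = h' (poly_var i)"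
    and f: "f \<in> poly_carrier n"
  shows "h f = h' f"
proof -
  interpret h: comm_ring_hom h by fact
  interpret h': comm_ring_hom h' by fact
  have "h (monom_eval poly_var m) = h' (monom_eval poly_var m)" if "m \<in> mkeys f" for m
  proof -
    have "i < n" if "i \<in> mkeys m" for i
      using f that \<open>m \<in> mkeys f\<close> by (auto simp: poly_carrier_def)
    then show ?thesis
      by (simp add: monom_eval_def h.hom_prod h'.hom_prod h.hom_power h'.hom_power var)
  qed
  then have "h (\<Sum>m\<in>mkeys f. poly_const (mlookup f m) * monom_eval poly_var m) =
      h' (\<Sum>m\<in>mkeys f. poly_const (mlookup f m) * monom_eval poly_var m)"
    by (simp add: h.hom_sum h'.hom_sum h.hom_mult h'.hom_mult const)
  then show ?thesis by (simp flip: poly_alg_expand)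
qed

lemma poly_alg_induct [case_names const var add mult]:
  fixes f :: "'k::comm_ring_1 poly_alg"
  assumes const: "\<And>a. Q (poly_const a)" and var: "\<And>i. Q (poly_var i)"
    and add: "\<And>f g. Q f \<Longrightarrow> Q g \<Longrightarrow> Q (f + g)"
    and mult: "\<And>f g. Q f \<Longrightarrow> Q g \<Longrightarrow> Q (f * g)"
  shows "Q f"
proof -
  have Q0: "Q 0" and Q1: "Q 1"
    using const[of 0] const[of 1] by (simp_all add: poly_const_def)
  have sum: "Q (sum g A)" if "\<And>i. i \<in> A \<Longrightarrow> Q (g i)" for g :: "'c \<Rightarrow> _" and A
    using that by (induction A rule: infinite_finite_induct) (auto intro: Q0 add)
  have power: "Q (g ^ k)" if "Q g" for g k
    using that by (induction k) (auto intro: Q1 mult)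
  have prod: "Q (prod g A)" if "\<And>i. i \<in> A \<Longrightarrow> Q (g i)" for g :: "'c \<Rightarrow> _" and A
    using that by (induction A rule: infinite_finite_induct) (auto intro: Q1 mult)
  have monom: "Q (monom_eval poly_var m)" for m
    unfolding monom_eval_def by (intro prod power var)
  show ?thesis
    by (subst poly_alg_expand) (intro sum mult const monom)
qed

lemma comm_ring_hom_eq_poly_alg:
  assumes "comm_ring_hom h" "comm_ring_hom h'"
    and const: "\<And>a. h (poly_const a) = h' (poly_const a)"
    and var: "\<And>i. h (poly_var i) = h' (poly_var i)"
  shows "h f = h' f"
proof -
  have "finite (\<Union>m\<in>mkeys f. mkeys m)" by simp
  then obtain n where "\<forall>i\<in>(\<Union>m\<in>mkeys f. mkeys m). i < n"
    using finite_nat_set_iff_bounded by blast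
  then have "f \<in> poly_carrier n" by (auto simp: poly_carrier_def)
  then show ?thesis
    using comm_ring_hom_eq_on_poly_carrier[OF assms(1,2) const var] by blast
qed

lemma poly_carrier_0 [simp]: "0 \<in> poly_carrier n"
  and poly_carrier_const [simp]: "poly_const a \<in> poly_carrier n"
  and poly_carrier_add: "f \<in> poly_carrier n \<Longrightarrow> g \<in> poly_carrier n \<Longrightarrow> f + g \<in> poly_carrier n"
  and poly_carrier_mult: "f \<in> poly_carrier n \<Longrightarrow> g \<in> poly_carrier n \<Longrightarrow> f * g \<in> poly_carrier n"
  and poly_carrier_var: "i < n \<Longrightarrow> poly_var i \<in> poly_carrier n"
  and poly_carrier_uminus: "f \<in> poly_carrier n \<Longrightarrow> - f \<in> poly_carrier n"
proof -
  show "0 \<in> poly_carrier n" by (simp add: poly_carrier_def)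
  show "poly_const a \<in> poly_carrier n" by (auto simp: poly_carrier_def poly_const_def)
  show "i < n \<Longrightarrow> poly_var i \<in> poly_carrier n"
    by (auto simp: poly_carrier_def poly_var_def split: if_splits)
  show "f \<in> poly_carrier n \<Longrightarrow> g \<in> poly_carrier n \<Longrightarrow> f + g \<in> poly_carrier n"
    unfolding poly_carrier_def using keys_add[of f g] by blast
  show "f \<in> poly_carrier n \<Longrightarrow> - f \<in> poly_carrier n"
    unfolding poly_carrier_def by (auto simp: in_keys_iff)
  assume f: "f \<in> poly_carrier n" and g: "g \<in> poly_carrier n"
  show "f * g \<in> poly_carrier n"
    unfolding poly_carrier_def
  proof safe
    fix m i assume "m \<in> mkeys (f * g)" and i: "i \<in> mkeys m"
    then obtain a b where "m = a + b" "a \<in> mkeys f" "b \<in> mkeys g"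
      using keys_mult[of f g] by blast
    then show "i < n"
      using i f g keys_add[of a b] unfolding poly_carrier_def by blast
  qed
qed

lemma poly_carrier_1 [simp]: "1 \<in> poly_carrier n"
  using poly_carrier_const[of 1 n] by (simp add: poly_const_def)

lemma poly_carrier_sum: "(\<And>i. i \<in> A \<Longrightarrow> f i \<in> poly_carrier n) \<Longrightarrow> sum f A \<in> poly_carrier n"
  by (induction A rule: infinite_finite_induct) (auto intro: poly_carrier_add)

lemma poly_carrier_diff: "f \<in> poly_carrier n \<Longrightarrow> g \<in> poly_carrier n \<Longrightarrow> f - g \<in> poly_carrier n"
  using poly_carrier_add[OF _ poly_carrier_uminus, of f n g] by simp

lemma poly_carrier_prod: "(\<And>i. i \<in> A \<Longrightarrow> f i \<in> poly_carrier n) \<Longrightarrow> prod f A \<in> poly_carrier n"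
  by (induction A rule: infinite_finite_induct) (auto intro: poly_carrier_mult)

lemma poly_carrier_power: "f \<in> poly_carrier n \<Longrightarrow> f ^ k \<in> poly_carrier n"
  by (induction k) (auto intro: poly_carrier_mult)

lemma subst_hom_id_0: "subst_hom (\<lambda>a. a) (\<lambda>_. 0 :: 'a::comm_ring_1) f = mlookup f 0"
proof -
  have "monom_eval (\<lambda>_. 0 :: 'a) m = (if m = 0 then 1 else 0)" for m
  proof (cases "m = 0")
    case False
    then obtain i where "i \<in> mkeys m" by fastforce
    then show ?thesis
      using False unfolding monom_eval_def
      by (simp only: if_False, intro prod_zero bexI[of _ i]) (auto simp: in_keys_iff zero_power)
  qed simp
  then have "subst_hom (\<lambda>a. a) (\<lambda>_. 0) f = (\<Sum>m\<in>mkeys f. if m = 0 then mlookup f m else 0)"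
    unfolding subst_hom_def by (intro sum.cong) auto
  then show ?thesis by (simp add: in_keys_iff)
qed

lemma constant_term_hom: "comm_ring_hom (\<lambda>f :: 'a::comm_ring_1 poly_alg. mlookup f 0)"
proof -
  have "comm_ring_hom (subst_hom (\<lambda>a. a) (\<lambda>_. 0 :: 'a))"
    by (rule subst_hom_hom, rule comm_ring_homI) auto
  then show ?thesis by (simp add: subst_hom_id_0[abs_def])
qed

lemma lookup_map_coeffs: "h 0 = 0 \<Longrightarrow> mlookup (Poly_Mapping.map h F) m = h (mlookup F m)"
  by (simp add: map.rep_eq when_def)

lemma map_coeffs_eq_subst_hom:
  assumes "h 0 = 0"
  shows "Poly_Mapping.map h F = subst_hom (\<lambda>a. poly_const (h a)) poly_var F"
proof (rule poly_mapping_eqI)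
  fix k
  have "mlookup (\<Sum>m\<in>mkeys F. msingle m (h (mlookup F m))) k
      = (\<Sum>m\<in>mkeys F. if m = k then h (mlookup F m) else 0)"
    unfolding lookup_sum by (intro sum.cong refl) (auto simp: lookup_single when_def)
  also have "\<dots> = h (mlookup F k)"
    using assms by (auto simp: in_keys_iff)
  finally show "mlookup (Poly_Mapping.map h F) k = mlookup (subst_hom (\<lambda>a. poly_const (h a)) poly_var F) k"
    by (simp add: subst_hom_def monom_eval_var poly_const_def mult_single lookup_map_coeffs assms)
qed

lemma map_coeffs_hom:
  assumes "comm_ring_hom h"
  shows "comm_ring_hom (Poly_Mapping.map h :: 'a::comm_ring_1 poly_alg \<Rightarrow> 'b::comm_ring_1 poly_alg)"
proof -
  interpret comm_ring_hom h by fact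
  have "(Poly_Mapping.map h :: 'a poly_alg \<Rightarrow> 'b poly_alg) = subst_hom (\<lambda>a. poly_const (h a)) poly_var"
    by (rule ext) (simp add: map_coeffs_eq_subst_hom)
  moreover have "comm_ring_hom (\<lambda>a. poly_const (h a))"
    by (rule comm_ring_hom_comp[OF poly_const_hom assms])
  ultimately show ?thesis by (simp only: subst_hom_hom)
qed

lemma map_coeffs_const: "h 0 = 0 \<Longrightarrow> Poly_Mapping.map h (poly_const a) = poly_const (h a)"
  by (rule poly_mapping_eqI) (auto simp: lookup_map_coeffs poly_const_def lookup_single when_def)

text \<open>
  Makes a filtration of the coefficient ring a filtration of the polynomial ring.
\<close>

lemma lookup_mult_in:
  assumes F: "\<And>m. mlookup F m \<in> X" and G: "\<And>m. mlookup G m \<in> Y"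
    and XY: "\<And>x y. x \<in> X \<Longrightarrow> y \<in> Y \<Longrightarrow> x * y \<in> Z"
    and Z: "0 \<in> Z" "\<And>x y. x \<in> Z \<Longrightarrow> y \<in> Z \<Longrightarrow> x + y \<in> Z"
  shows "mlookup (F * G :: 'a::comm_ring_1 poly_alg) k \<in> Z"
proof -
  have sumZ: "sum f A \<in> Z" if "\<And>i. i \<in> A \<Longrightarrow> f i \<in> Z" for f :: "'c \<Rightarrow> 'a" and A
    using that by (induction A rule: infinite_finite_induct) (auto intro: Z)
  have "F * G = (\<Sum>m\<in>mkeys F. \<Sum>n\<in>mkeys G. msingle (m + n) (mlookup F m * mlookup G n))"
    by (subst (1) poly_alg_sum_singles[of F], subst (1) poly_alg_sum_singles[of G])
      (simp add: sum_product mult_single)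
  then have "mlookup (F * G) k =
      (\<Sum>m\<in>mkeys F. \<Sum>n\<in>mkeys G. if m + n = k then mlookup F m * mlookup G n else 0)"
    by (simp add: lookup_sum lookup_single when_def)
  also have "\<dots> \<in> Z"
    by (intro sumZ) (auto intro: XY F G Z)
  finally show ?thesis .
qed

section \<open>Regular sequences\<close>

text \<open>
  Regularity of a sequence on \<open>A\<close> as a module over itself. The ideals are spelled out as linear
  combinations, so that a hypothesis can be pushed along any map that respects such combinations.
\<close>

definition regular_on :: "'a::comm_ring_1 set \<Rightarrow> 'a list \<Rightarrow> bool" where
  "regular_on A xs \<longleftrightarrow> (\<forall>i<length xs. \<forall>u\<in>A. \<forall>b. (\<forall>j<i. b j \<in> A) \<longrightarrow>
     xs ! i * u = (\<Sum>j<i. xs ! j * b j) \<longrightarrow> (\<exists>a. (\<forall>j<i. a j \<in> A) \<and> u = (\<Sum>j<i. xs ! j * a j)))"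

lemma regular_onD:
  assumes "regular_on A xs" "i < length xs" "u \<in> A" "\<And>j. j < i \<Longrightarrow> b j \<in> A"
    "xs ! i * u = (\<Sum>j<i. xs ! j * b j)"
  obtains a where "\<And>j. j < i \<Longrightarrow> a j \<in> A" "u = (\<Sum>j<i. xs ! j * a j)"
  using assms unfolding regular_on_def by blast

text \<open>
  The retraction turns a linear combination with coefficients in the large ring into one with
  coefficients in \<open>A\<close>.
\<close>

lemma regular_on_retract:
  assumes "comm_ring_hom r" and fix_A: "\<And>a. a \<in> A \<Longrightarrow> r a = a" and r_A: "\<And>b. r b \<in> A"
    and xs: "set xs \<subseteq> A" and reg: "regular_on UNIV xs"
  shows "regular_on A xs"
  unfolding regular_on_def
proof (intro allI ballI impI)
  interpret comm_ring_hom r by fact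
  fix i u b assume i: "i < length xs" and u: "u \<in> A"
    and eq: "xs ! i * u = (\<Sum>j<i. xs ! j * b j)"
  obtain a where a: "u = (\<Sum>j<i. xs ! j * a j)"
    using regular_onD[OF reg i _ _ eq] by auto
  have "r (xs ! j) = xs ! j" if "j < i" for j
    using that i xs by (auto intro!: fix_A)
  then have "u = (\<Sum>j<i. xs ! j * r (a j))"
    using fix_A[OF u] a by (simp add: hom_sum hom_mult)
  then show "\<exists>a. (\<forall>j<i. a j \<in> A) \<and> u = (\<Sum>j<i. xs ! j * a j)"
    using r_A by (intro exI[of _ "\<lambda>j. r (a j)"]) auto
qed

definition adjoin :: "'a::comm_ring_1 set \<Rightarrow> 'a \<Rightarrow> 'a set" where
  "adjoin N x = {n + x * v | n v. n \<in> N}"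

text \<open>
  Regularity on the quotient by \<open>N\<close>, where \<open>N\<close> absorbs the entries that have been passed. This form
  lends itself to inductions that change the module, such as those along exact sequences.
\<close>

primrec regular_mod :: "'a::comm_ring_1 set \<Rightarrow> 'a list \<Rightarrow> bool" where
  "regular_mod N [] = True"
| "regular_mod N (x # xs) = ((\<forall>u. x * u \<in> N \<longrightarrow> u \<in> N) \<and> regular_mod (adjoin N x) xs)"

definition is_ideal :: "'a::comm_ring_1 set \<Rightarrow> bool" where
  "is_ideal N \<longleftrightarrow> 0 \<in> N \<and> (\<forall>a\<in>N. \<forall>b\<in>N. a + b \<in> N) \<and> (\<forall>a\<in>N. \<forall>r. r * a \<in> N)"

lemma is_idealD:
  assumes "is_ideal N"
  shows "0 \<in> N" "a \<in> N \<Longrightarrow> b \<in> N \<Longrightarrow> a + b \<in> N" "a \<in> N \<Longrightarrow> r * a \<in> N" "a \<in> N \<Longrightarrow> a * r \<in> N"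
    "a \<in> N \<Longrightarrow> b \<in> N \<Longrightarrow> a - b \<in> N"
proof -
  show *: "0 \<in> N" "a \<in> N \<Longrightarrow> b \<in> N \<Longrightarrow> a + b \<in> N" "a \<in> N \<Longrightarrow> r * a \<in> N" for a b r
    using assms by (auto simp: is_ideal_def)
  show "a \<in> N \<Longrightarrow> a * r \<in> N" using *(3)[of a r] by (simp add: mult.commute)
  show "a \<in> N \<Longrightarrow> b \<in> N \<Longrightarrow> a - b \<in> N" using *(2)[OF _ *(3)[of b "-1"], of a] by simp
qed

lemma is_ideal_zero: "is_ideal {0}"
  by (simp add: is_ideal_def)

lemma adjoinI: "n \<in> N \<Longrightarrow> n + x * v \<in> adjoin N x"
  by (auto simp: adjoin_def)

lemma adjoinE: "u \<in> adjoin N x \<Longrightarrow> (\<And>n v. n \<in> N \<Longrightarrow> u = n + x * v \<Longrightarrow> P) \<Longrightarrow> P"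
  by (auto simp: adjoin_def)

lemma subset_adjoin: "n \<in> N \<Longrightarrow> n \<in> adjoin N x"
  using adjoinI[of n N x 0] by simp

lemma is_ideal_adjoin:
  assumes "is_ideal N" shows "is_ideal (adjoin N x)"
  unfolding is_ideal_def
proof (intro conjI ballI allI)
  note I = is_idealD[OF assms]
  show "0 \<in> adjoin N x" using subset_adjoin I(1) by auto
next
  note I = is_idealD[OF assms]
  fix a b assume "a \<in> adjoin N x" "b \<in> adjoin N x"
  then obtain n v n' v' where "n \<in> N" "n' \<in> N" "a = n + x * v" "b = n' + x * v'"
    by (auto elim!: adjoinE)
  then show "a + b \<in> adjoin N x"
    using adjoinI[OF I(2), of n n' x "v + v'"] by (simp add: algebra_simps)
next
  note I = is_idealD[OF assms]
  fix a r assume "a \<in> adjoin N x"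
  then obtain n v where "n \<in> N" "a = n + x * v"
    by (auto elim!: adjoinE)
  then show "r * a \<in> adjoin N x"
    using adjoinI[OF I(3), of n r x "r * v"] by (simp add: algebra_simps)
qed

lemma adjoin_commute: "adjoin (adjoin N x) y = adjoin (adjoin N y) x"
proof -
  have "adjoin (adjoin N x) y \<subseteq> adjoin (adjoin N y) x" for x y
  proof
    fix u assume "u \<in> adjoin (adjoin N x) y"
    then obtain n v w where n: "n \<in> N" "u = (n + x * v) + y * w" by (auto elim!: adjoinE)
    then have "u = (n + y * w) + x * v" by (simp add: algebra_simps)
    then show "u \<in> adjoin (adjoin N y) x" using adjoinI[OF adjoinI[OF n(1)], of y w x v] by simp
  qed
  then show ?thesis by blast
qed

lemma regular_mod_UNIV: "regular_mod UNIV xs"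
proof (induction xs)
  case (Cons x xs)
  have "adjoin UNIV x = UNIV" using subset_adjoin by blast
  then show ?case using Cons by simp
qed simp

text \<open>
  Regularity is inherited by the middle term of the exact sequence
  \<open>0 \<rightarrow> A/J \<rightarrow> A/K \<rightarrow> A/L \<rightarrow> 0\<close>, whose first map is multiplication by \<open>a\<close>: by the
  snake lemma for multiplication by the first entry \<open>x\<close>, the sequence stays exact modulo \<open>x\<close>.
\<close>

lemma regular_mod_extension:
  assumes "is_ideal K" and J: "\<And>u. a * u \<in> K \<longleftrightarrow> u \<in> J" and L: "L = adjoin K a"
    and "regular_mod J xs" "regular_mod L xs"
  shows "regular_mod K xs"
  using assms
proof (induction xs arbitrary: J K L)
  case (Cons x xs)
  note K = is_idealD[OF Cons.prems(1)]
  note J = Cons.prems(2)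
  note L = Cons.prems(3)
  have xJ: "x * u \<in> J \<Longrightarrow> u \<in> J" and xL: "x * u \<in> L \<Longrightarrow> u \<in> L" for u
    using Cons.prems by auto
  have "u \<in> K" if u: "x * u \<in> K" for u
  proof -
    have "x * u \<in> L" using u by (simp add: L subset_adjoin)
    then have "u \<in> L" by (rule xL)
    then obtain k w where k: "k \<in> K" "u = k + a * w" by (auto simp: L elim: adjoinE)
    have "x * u - k * x = a * (x * w)" using k by (simp add: algebra_simps)
    then have "a * (x * w) \<in> K" using K(5)[OF u K(4)[OF k(1), of x]] by simp
    then have "w \<in> J" using J xJ by blast
    then show "u \<in> K" using J k K by auto
  qed
  moreover have "regular_mod (adjoin K x) xs"
  proof (rule Cons.IH)
    show "is_ideal (adjoin K x)" using Cons.prems(1) by (rule is_ideal_adjoin)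
    show "adjoin L x = adjoin (adjoin K x) a" by (simp add: L adjoin_commute)
    show "regular_mod (adjoin J x) xs" "regular_mod (adjoin L x) xs" using Cons.prems by auto
    fix u
    show "a * u \<in> adjoin K x \<longleftrightarrow> u \<in> adjoin J x"
    proof
      assume "a * u \<in> adjoin K x"
      then obtain k v where k: "k \<in> K" "a * u = k + x * v" by (auto elim: adjoinE)
      have "x * v = (- k) + a * u" using k by simp
      moreover have "- k \<in> K" using K(3)[OF k(1), of "-1"] by simp
      ultimately have "x * v \<in> L" unfolding L using adjoinI by metis
      then have "v \<in> L" by (rule xL)
      then obtain k' w where k': "k' \<in> K" "v = k' + a * w" by (auto simp: L elim: adjoinE)
      have "a * (u - x * w) = k + x * k'" using k k' by (simp add: algebra_simps)
      then have "a * (u - x * w) \<in> K" using K(2)[OF k(1) K(3)[OF k'(1)]] by simp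
      then have "u - x * w \<in> J" using J by blast
      then show "u \<in> adjoin J x" using adjoinI[of "u - x * w" J x w] by simp
    next
      assume "u \<in> adjoin J x"
      then obtain j v where j: "j \<in> J" "u = j + x * v" by (auto elim: adjoinE)
      then have "a * u = a * j + x * (a * v)" by (simp add: algebra_simps)
      then show "a * u \<in> adjoin K x" using j J adjoinI[of "a * j" K x "a * v"] by simp
    qed
  qed
  ultimately show ?case by simp
qed simp

text \<open>
  The extension lemma for \<open>K = N + (a b)\<close>, \<open>L = N + (a)\<close> and \<open>J = N + (b)\<close>.
\<close>

lemma regular_mod_mult:
  assumes N: "is_ideal N" and a: "regular_mod N (a # xs)" and b: "regular_mod N (b # xs)"
  shows "regular_mod N (a * b # xs)"
proof -
  note I = is_idealD[OF N]
  have "regular_mod (adjoin N (a * b)) xs"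
  proof (rule regular_mod_extension)
    show "is_ideal (adjoin N (a * b))" using N by (rule is_ideal_adjoin)
    show "regular_mod (adjoin N b) xs" "regular_mod (adjoin N a) xs" using a b by auto
    show "adjoin N a = adjoin (adjoin N (a * b)) a"
    proof (intro equalityI subsetI)
      fix u assume "u \<in> adjoin N a"
      then show "u \<in> adjoin (adjoin N (a * b)) a"
        by (elim adjoinE) (simp add: adjoinI[OF subset_adjoin])
    next
      fix u assume "u \<in> adjoin (adjoin N (a * b)) a"
      then obtain n v w where "n \<in> N" "u = (n + a * b * v) + a * w"
        by (auto elim!: adjoinE)
      then show "u \<in> adjoin N a" using adjoinI[of n N a "b * v + w"] by (simp add: algebra_simps)
    qed
    fix u
    show "a * u \<in> adjoin N (a * b) \<longleftrightarrow> u \<in> adjoin N b"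
    proof
      assume "a * u \<in> adjoin N (a * b)"
      then obtain n v where n: "n \<in> N" "a * u = n + a * b * v" by (auto elim: adjoinE)
      then have "a * (u - b * v) = n" by (simp add: algebra_simps)
      then have "u - b * v \<in> N" using n a by auto
      then show "u \<in> adjoin N b" using adjoinI[of "u - b * v" N b v] by simp
    next
      assume "u \<in> adjoin N b"
      then obtain n v where n: "n \<in> N" "u = n + b * v" by (auto elim: adjoinE)
      then show "a * u \<in> adjoin N (a * b)"
        using adjoinI[OF I(3), of n a "a * b" v] by (simp add: algebra_simps)
    qed
  qed
  moreover have "u \<in> N" if "a * b * u \<in> N" for u
  proof -
    have "a * (b * u) \<in> N" using that by (simp add: mult.assoc)
    then have "b * u \<in> N" using a unfolding regular_mod.simps by blast
    then show ?thesis using b unfolding regular_mod.simps by blast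
  qed
  ultimately show ?thesis by simp
qed

lemma regular_mod_one:
  assumes "is_ideal N" shows "regular_mod N (1 # xs)"
proof -
  have "x \<in> adjoin N 1" for x
    using adjoinI[OF is_idealD(1)[OF assms], of 1 x] by simp
  then have "adjoin N 1 = UNIV" by blast
  then show ?thesis by (simp add: regular_mod_UNIV)
qed

lemma regular_mod_power:
  "is_ideal N \<Longrightarrow> regular_mod N (a # xs) \<Longrightarrow> regular_mod N (a ^ k # xs)"
  by (induction k)
    (simp_all del: regular_mod.simps add: regular_mod_one regular_mod_mult)

lemma regular_mod_prod:
  assumes N: "is_ideal N" and "finite S" "\<And>l. l \<in> S \<Longrightarrow> regular_mod N (f l # xs)"
  shows "regular_mod N (prod f S # xs)"
  using assms(2,3)
  by (induction S)
    (simp_all del: regular_mod.simps add: regular_mod_one[OF N] regular_mod_mult[OF N])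

text \<open>
  The map \<open>s\<close> identifies the quotient by the preimage of \<open>M\<close> with a quotient of its image. For an
  idempotent \<open>s\<close> both live in the same ring, which spares a change of rings.
\<close>

lemma regular_mod_preimage:
  assumes "comm_ring_hom s" and idem: "\<And>u. s (s u) = s u"
    and "is_ideal M" and "\<And>m. m \<in> M \<Longrightarrow> s m \<in> M" and "regular_mod M (map s xs)"
  shows "regular_mod {u. s u \<in> M} xs"
  using assms(3-)
proof (induction xs arbitrary: M)
  case (Cons x xs)
  interpret comm_ring_hom s by fact
  note M = is_idealD[OF Cons.prems(1)]
  have "adjoin {u. s u \<in> M} x = {u. s u \<in> adjoin M (s x)}"
  proof (intro equalityI subsetI)
    fix u assume "u \<in> adjoin {u. s u \<in> M} x"
    then show "u \<in> {u. s u \<in> adjoin M (s x)}"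
      by (auto elim!: adjoinE simp: hom_add hom_mult intro: adjoinI)
  next
    fix u assume "u \<in> {u. s u \<in> adjoin M (s x)}"
    then obtain m v where m: "m \<in> M" "s u = m + s x * v" by (auto elim: adjoinE)
    then have "s (s u) = s m + s x * s v" by (simp add: hom_add hom_mult idem)
    then have "s (u - x * s v) = s m" by (simp add: hom_minus hom_mult idem)
    then have "s (u - x * s v) \<in> M" using Cons.prems(2)[OF m(1)] by simp
    then show "u \<in> adjoin {u. s u \<in> M} x"
      using adjoinI[of "u - x * s v" "{u. s u \<in> M}" x "s v"] by simp
  qed
  moreover have "regular_mod {u. s u \<in> adjoin M (s x)} xs"
  proof (rule Cons.IH)
    show "is_ideal (adjoin M (s x))" using Cons.prems(1) by (rule is_ideal_adjoin)
    show "regular_mod (adjoin M (s x)) (map s xs)" using Cons.prems by simp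
    show "s m \<in> adjoin M (s x)" if "m \<in> adjoin M (s x)" for m
      using that by (elim adjoinE) (simp add: hom_add hom_mult idem adjoinI[OF Cons.prems(2)])
  qed
  moreover have "s u \<in> M" if "s x * s u \<in> M" for u
    using that Cons.prems(3) by auto
  ultimately show ?case by (simp add: hom_mult)
qed simp

lemma regular_on_UNIV:
  fixes xs :: "'a::comm_ring_1 list"
  assumes "regular_mod {0} xs"
  shows "regular_on UNIV xs"
proof -
  define lin :: "'a list \<Rightarrow> 'a set" where "lin ys = range (\<lambda>b. \<Sum>j<length ys. ys ! j * b j)" for ys
  have lin_snoc: "lin (ys @ [x]) = adjoin (lin ys) x" for ys x
  proof (intro equalityI subsetI)
    fix u assume "u \<in> lin (ys @ [x])"
    then show "u \<in> adjoin (lin ys) x"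
      by (auto simp: lin_def nth_append intro!: adjoinI)
  next
    fix u assume "u \<in> adjoin (lin ys) x"
    then obtain b v where u: "u = (\<Sum>j<length ys. ys ! j * b j) + x * v"
      by (auto simp: lin_def elim: adjoinE)
    have "u = (\<Sum>j<length (ys @ [x]). (ys @ [x]) ! j * (b(length ys := v)) j)"
      by (simp add: u nth_append)
    then show "u \<in> lin (ys @ [x])" unfolding lin_def by blast
  qed
  have "xs ! i * u \<in> lin (ys @ take i xs) \<longrightarrow> u \<in> lin (ys @ take i xs)"
    if "regular_mod (lin ys) xs" "i < length xs" for ys i u
    using that
  proof (induction xs arbitrary: ys i)
    case (Cons x xs)
    show ?case
    proof (cases i)
      case 0
      then show ?thesis using Cons.prems by simp
    next
      case (Suc j)
      have "regular_mod (lin (ys @ [x])) xs" using Cons.prems by (simp add: lin_snoc)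
      from Cons.IH[OF this, of j] show ?thesis using Suc Cons.prems by simp
    qed
  qed simp
  from this[of "[]"] assms have *: "xs ! i * u \<in> lin (take i xs) \<longrightarrow> u \<in> lin (take i xs)"
    if "i < length xs" for i u
    using that by (simp add: lin_def)
  have lin_take: "lin (take i xs) = range (\<lambda>b. \<Sum>j<i. xs ! j * b j)" if "i < length xs" for i
    using that by (simp add: lin_def min_def)
  show ?thesis
    unfolding regular_on_def
  proof (intro allI ballI impI)
    fix i u b assume i: "i < length xs" and "xs ! i * u = (\<Sum>j<i. xs ! j * b j)"
    then have "xs ! i * u \<in> lin (take i xs)" by (auto simp: lin_take)
    then have "u \<in> lin (take i xs)" using * i by blast
    then show "\<exists>a. (\<forall>j<i. a j \<in> UNIV) \<and> u = (\<Sum>j<i. xs ! j * a j)"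
      using i by (auto simp: lin_take)
  qed
qed

section \<open>Dickson invariants\<close>

text \<open>
  The fibres are cosets of the kernel, so they all have the same size.
\<close>

lemma prod_over_fibres:
  fixes s :: "'a::ab_group_add \<Rightarrow> 'b::ab_group_add" and g :: "'b \<Rightarrow> 'c::comm_monoid_mult"
  assumes fin: "finite L" and L: "\<And>x y. x \<in> L \<Longrightarrow> y \<in> L \<Longrightarrow> x + y \<in> L" "\<And>x y. x \<in> L \<Longrightarrow> y \<in> L \<Longrightarrow> x - y \<in> L"
    and s: "\<And>x y. s (x + y) = s x + s y"
  shows "(\<Prod>x\<in>L. g (s x)) = (\<Prod>y\<in>s ` L. g y ^ card {x \<in> L. s x = 0})"
    and "card L = card (s ` L) * card {x \<in> L. s x = 0}"
proof -
  have s_diff: "s (x - y) = s x - s y" for x y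
    using s[of "x - y" y] by (simp add: algebra_simps)
  have fibre: "card {x \<in> L. s x = y} = card {x \<in> L. s x = 0}" if "y \<in> s ` L" for y
  proof -
    obtain z where z: "z \<in> L" "s z = y" using \<open>y \<in> s ` L\<close> by blast
    have "bij_betw (\<lambda>x. x + z) {x \<in> L. s x = 0} {x \<in> L. s x = y}"
      by (rule bij_betwI[where g = "\<lambda>x. x - z"]) (use z L in \<open>auto simp: s s_diff\<close>)
    then show ?thesis by (simp add: bij_betw_same_card)
  qed
  have "(\<Prod>x\<in>L. g (s x)) = (\<Prod>y\<in>s ` L. \<Prod>x\<in>{x \<in> L. s x = y}. g (s x))"
    by (rule prod.image_gen[OF fin])
  also have "\<dots> = (\<Prod>y\<in>s ` L. g y ^ card {x \<in> L. s x = 0})"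
    by (intro prod.cong refl) (simp add: fibre)
  finally show "(\<Prod>x\<in>L. g (s x)) = (\<Prod>y\<in>s ` L. g y ^ card {x \<in> L. s x = 0})" .
  have "card L = (\<Sum>y\<in>s ` L. \<Sum>x\<in>{x \<in> L. s x = y}. 1)"
    using sum.image_gen[OF fin, of "\<lambda>_. 1 :: nat" s] by simp
  also have "\<dots> = (\<Sum>y\<in>s ` L. card {x \<in> L. s x = 0})"
    by (intro sum.cong refl) (simp add: fibre)
  finally show "card L = card (s ` L) * card {x \<in> L. s x = 0}" by simp
qed

definition lin_form :: "nat set \<Rightarrow> (nat \<Rightarrow> 'k::comm_ring_1) \<Rightarrow> 'k poly_alg" where
  "lin_form I a = (\<Sum>i\<in>I. poly_const (a i) * poly_var i)"

definition lin_forms :: "nat set \<Rightarrow> 'k::comm_ring_1 poly_alg set" where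
  "lin_forms I = range (lin_form I)"

lemma poly_const_simps:
  "poly_const 0 = 0" "poly_const 1 = 1" "poly_const (a + b) = poly_const a + poly_const b"
  "poly_const (a * b) = poly_const a * poly_const b" "poly_const (- a) = - poly_const a"
  "poly_const (a - b) = poly_const a - poly_const b" "poly_const (sum f A) = (\<Sum>i\<in>A. poly_const (f i))"
proof -
  interpret comm_ring_hom poly_const by (rule poly_const_hom)
  show "poly_const 0 = 0" "poly_const 1 = 1" "poly_const (a + b) = poly_const a + poly_const b"
  "poly_const (a * b) = poly_const a * poly_const b" "poly_const (- a) = - poly_const a"
  "poly_const (a - b) = poly_const a - poly_const b" "poly_const (sum f A) = (\<Sum>i\<in>A. poly_const (f i))"
    by (simp_all add: hom_distribs)
qed

lemma lin_form_add: "lin_form I (\<lambda>i. a i + b i) = lin_form I a + lin_form I b"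
  and lin_form_diff: "lin_form I (\<lambda>i. a i - b i) = lin_form I a - lin_form I b"
  and lin_form_scale: "lin_form I (\<lambda>i. c * a i) = poly_const c * lin_form I a"
  by (simp_all add: lin_form_def poly_const_simps algebra_simps sum.distrib sum_subtractf sum_distrib_left)

lemma lin_forms_add: "x \<in> lin_forms I \<Longrightarrow> y \<in> lin_forms I \<Longrightarrow> x + y \<in> lin_forms I"
  and lin_forms_diff: "x \<in> lin_forms I \<Longrightarrow> y \<in> lin_forms I \<Longrightarrow> x - y \<in> lin_forms I"
  and lin_forms_scale: "x \<in> lin_forms I \<Longrightarrow> poly_const c * x \<in> lin_forms I"
  unfolding lin_forms_def
  by (auto simp flip: lin_form_add lin_form_diff lin_form_scale)

lemma zero_in_lin_forms: "0 \<in> lin_forms I"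
  unfolding lin_forms_def by (rule range_eqI[of _ _ "\<lambda>_. 0"]) (simp add: lin_form_def poly_const_simps)

lemma finite_lin_forms:
  assumes "finite I"
  shows "finite (lin_forms I :: 'k::{finite, comm_ring_1} poly_alg set)"
  using assms
proof induction
  case empty
  show ?case by (simp add: lin_forms_def lin_form_def[abs_def])
next
  case (insert j I)
  have "lin_forms (insert j I) \<subseteq> (\<lambda>(c, l). poly_const c * poly_var j + l) ` (UNIV \<times> (lin_forms I :: 'k poly_alg set))"
    using insert by (auto simp: lin_forms_def lin_form_def)
  then show ?case by (rule finite_subset) (use insert in auto)
qed

text \<open>
  If \<open>L\<close> is the space of all linear forms and \<open>q = 1\<close>, the nonzero coefficients below the top one are, up to sign,
  the Dickson invariants. The exponent \<open>q\<close> makes the construction stable under restriction to a subspace, where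
  every linear form is the restriction of equally many forms.
\<close>

definition dickson_poly :: "'k::comm_ring_1 poly_alg set \<Rightarrow> nat \<Rightarrow> 'k poly_alg poly" where
  "dickson_poly L q = (\<Prod>l\<in>L. [:- l, 1:] ^ q)"

text \<open>
  These are the coefficients of \<open>X\<close> to the powers \<open>q p\<^sup>i\<close> with \<open>i\<close> below the number of variables.
\<close>

definition dickson_seq :: "'k::{finite, comm_ring_1} itself \<Rightarrow> nat set \<Rightarrow> nat \<Rightarrow> 'k poly_alg list" where
  "dickson_seq _ I q = map (\<lambda>i. coeff (dickson_poly (lin_forms I) q) (q * CARD('k) ^ i)) [0..<card I]"

lemma coeff_dickson_poly_image:
  assumes "comm_ring_hom s" "finite L"
    and L: "\<And>x y. x \<in> L \<Longrightarrow> y \<in> L \<Longrightarrow> x + y \<in> L" "\<And>x y. x \<in> L \<Longrightarrow> y \<in> L \<Longrightarrow> x - y \<in> L"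
  shows "s (coeff (dickson_poly L q) e) = coeff (dickson_poly (s ` L) (card {x \<in> L. s x = 0} * q)) e"
proof -
  interpret s: comm_ring_hom s by fact
  interpret map_poly_comm_ring_hom s ..
  have "s (coeff (dickson_poly L q) e) = coeff (map_poly s (dickson_poly L q)) e"
    by simp
  also have "map_poly s (dickson_poly L q) = (\<Prod>l\<in>L. (\<lambda>y. [:- y, 1:] ^ q) (s l))"
    unfolding dickson_poly_def by (simp add: hom_prod hom_power s.hom_uminus)
  also have "\<dots> = dickson_poly (s ` L) (card {x \<in> L. s x = 0} * q)"
    by (subst prod_over_fibres(1)[OF assms(2) L s.hom_add])
      (simp_all add: dickson_poly_def power_mult mult.commute)
  finally show ?thesis .
qed

text \<open>
  If \<open>c \<noteq> 0\<close> is the coefficient of the variable \<open>j\<close> in the linear form \<open>l\<close>, this solves \<open>l = 0\<close> for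
  that variable. It is the projection onto the polynomials in the other variables with kernel \<open>(l)\<close>.
\<close>

definition eliminate :: "'k::field poly_alg \<Rightarrow> 'k \<Rightarrow> nat \<Rightarrow> 'k poly_alg \<Rightarrow> 'k poly_alg" where
  "eliminate l c j = poly_subst (\<lambda>i. if i = j then poly_var j - poly_const (1 / c) * l else poly_var i)"

context
  fixes I :: "nat set" and a :: "nat \<Rightarrow> 'k::field" and j :: nat and l
  assumes I: "finite I" "j \<in> I" and aj: "a j \<noteq> 0" and l: "l = lin_form I a"
begin

lemma eliminate_hom: "comm_ring_hom (eliminate l (a j) j)"
  unfolding eliminate_def by (rule poly_subst_hom)

interpretation comm_ring_hom "eliminate l (a j) j" by (rule eliminate_hom)

lemma eliminate_var: "eliminate l (a j) j (poly_var i) = (if i = j then poly_var j - poly_const (1 / a j) * l else poly_var i)"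
  and eliminate_const: "eliminate l (a j) j (poly_const c) = poly_const c"
  by (simp_all add: eliminate_def poly_subst_var poly_subst_const)

lemma eliminate_lin_form:
  "eliminate l (a j) j (lin_form I b) = lin_form I b - poly_const (b j / a j) * l"
proof -
  have "eliminate l (a j) j (lin_form I b) =
      (\<Sum>i\<in>I. poly_const (b i) * poly_var i - (if i = j then poly_const (b j / a j) * l else 0))"
    unfolding lin_form_def hom_sum hom_mult eliminate_var eliminate_const
    by (intro sum.cong refl) (auto simp: algebra_simps simp flip: poly_const_simps)
  also have "\<dots> = lin_form I b - poly_const (b j / a j) * l"
    using I by (simp add: sum_subtractf lin_form_def)
  finally show ?thesis .
qed

lemma eliminate_form: "eliminate l (a j) j l = 0"
  using eliminate_lin_form[of a] aj by (simp add: l poly_const_simps)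

lemma eliminate_idem: "eliminate l (a j) j (eliminate l (a j) j f) = eliminate l (a j) j f"
proof (induction f rule: poly_alg_induct)
  case (var i)
  show ?case
    by (simp add: eliminate_var hom_minus hom_mult eliminate_const eliminate_form)
qed (simp_all add: eliminate_const hom_add hom_mult)

lemma dvd_minus_eliminate: "l dvd f - eliminate l (a j) j f"
proof (induction f rule: poly_alg_induct)
  case (mult f g)
  let ?e = "eliminate l (a j) j"
  have "f * g - ?e (f * g) = (f - ?e f) * g + ?e f * (g - ?e g)"
    by (simp add: hom_mult algebra_simps)
  then show ?case using mult by (metis dvd_add dvd_mult dvd_mult2)
next
  case (add f g)
  then show ?case using dvd_add[OF add] by (simp add: hom_add algebra_simps)
qed (auto simp: eliminate_const eliminate_var)

lemma eliminate_kernel: "{f. eliminate l (a j) j f \<in> {0}} = adjoin {0} l"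
proof (intro equalityI subsetI)
  fix f assume "f \<in> {f. eliminate l (a j) j f \<in> {0}}"
  then have "l dvd f" using dvd_minus_eliminate[of f] by simp
  then show "f \<in> adjoin {0} l" by (auto simp: adjoin_def dvd_def)
next
  fix f assume "f \<in> adjoin {0} l"
  then show "f \<in> {f. eliminate l (a j) j f \<in> {0}}"
    by (auto simp: adjoin_def hom_mult eliminate_form)
qed

lemma eliminate_image: "eliminate l (a j) j ` lin_forms I = lin_forms (I - {j})"
proof (intro equalityI subsetI)
  fix x assume "x \<in> eliminate l (a j) j ` lin_forms I"
  then obtain b where b: "x = lin_form I b - poly_const (b j / a j) * l"
    by (auto simp: lin_forms_def eliminate_lin_form)
  then have "x = lin_form I (\<lambda>i. b i - b j / a j * a i)"
    unfolding lin_form_diff lin_form_scale l .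
  also have "\<dots> = lin_form (I - {j}) (\<lambda>i. b i - b j / a j * a i)"
    unfolding lin_form_def by (subst sum.remove[OF I]) (simp add: aj poly_const_simps)
  finally show "x \<in> lin_forms (I - {j})" by (simp add: lin_forms_def)
next
  fix x :: "'k poly_alg" assume "x \<in> lin_forms (I - {j})"
  then obtain b where b: "x = lin_form (I - {j}) b" by (auto simp: lin_forms_def)
  have "x = lin_form I (b(j := 0))"
    unfolding b lin_form_def by (subst sum.remove[OF I]) (simp add: poly_const_simps)
  also have "\<dots> = eliminate l (a j) j (lin_form I (b(j := 0)))"
    by (simp add: eliminate_lin_form poly_const_simps)
  finally show "x \<in> eliminate l (a j) j ` lin_forms I" by (auto simp: lin_forms_def)
qed

lemma card_eliminate_kernel: "l \<noteq> 0 \<Longrightarrow> card {x \<in> lin_forms I. eliminate l (a j) j x = 0} = CARD('k)"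
proof -
  assume "l \<noteq> 0"
  have "{x \<in> lin_forms I. eliminate l (a j) j x = 0} = range (\<lambda>c. poly_const c * l)"
  proof (intro equalityI subsetI)
    fix x assume "x \<in> {x \<in> lin_forms I. eliminate l (a j) j x = 0}"
    then show "x \<in> range (\<lambda>c. poly_const c * l)"
      by (auto simp: lin_forms_def eliminate_lin_form)
  next
    fix x assume "x \<in> range (\<lambda>c. poly_const c * l)"
    moreover have "l \<in> lin_forms I" by (simp add: l lin_forms_def)
    ultimately show "x \<in> {x \<in> lin_forms I. eliminate l (a j) j x = 0}"
      by (auto simp: hom_mult eliminate_form intro: lin_forms_scale)
  qed
  moreover have "inj (\<lambda>c. poly_const c * l)"
    by (rule injI) (use \<open>l \<noteq> 0\<close> in \<open>auto simp: poly_const_def dest: injD[OF inj_single]\<close>)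
  ultimately show ?thesis by (simp add: card_image)
qed

end

lemma lin_form_nonzero_coeff: "lin_form I a \<noteq> 0 \<Longrightarrow> \<exists>j\<in>I. a j \<noteq> 0"
  unfolding lin_form_def by (metis (lifting) poly_const_simps(1) mult_zero_left sum.neutral)

text \<open>
  The zero form contributes the factor \<open>X\<^sup>q\<close>, and the coefficient is the constant term of the rest.
\<close>

lemma coeff_dickson_poly_bottom:
  assumes L: "finite L" "0 \<in> L"
  shows "coeff (dickson_poly L q) q = (\<Prod>l\<in>L - {0}. (- l) ^ q)"
proof -
  have "dickson_poly L q = monom 1 q * (\<Prod>l\<in>L - {0}. [:- l, 1:] ^ q)"
    unfolding dickson_poly_def using L by (simp add: prod.remove[of L 0] monom_altdef)
  then have "coeff (dickson_poly L q) q = coeff (\<Prod>l\<in>L - {0}. [:- l, 1:] ^ q) 0"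
    by (simp add: coeff_monom_mult)
  also have "\<dots> = (\<Prod>l\<in>L - {0}. (- l) ^ q)"
    by (simp add: poly_prod flip: poly_0_coeff_0)
  finally show ?thesis .
qed

text \<open>
  The first entry is a product of nonzero linear forms, so it suffices that each nonzero linear
  form \<open>l\<close>, followed by the other entries, is regular. Modulo \<open>l\<close> one variable disappears, and each
  linear form in the remaining variables is the image of \<open>p\<close> forms. Hence the coefficient of
  \<open>X\<close> to the power \<open>q p\<^sup>i\<^sup>+\<^sup>1\<close> becomes entry \<open>i\<close> of the sequence in one variable less with exponent \<open>p q\<close>,
  and induction applies.
\<close>

lemma regular_dickson_seq:
  fixes I :: "nat set"
  assumes "finite I"
  shows "regular_mod {0} (dickson_seq TYPE('k::{finite, field}) I q)"
  using assms
proof (induction "card I" arbitrary: I q)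
  case 0
  then show ?case by (simp add: dickson_seq_def)
next
  case (Suc r)
  let ?D = "\<lambda>i. coeff (dickson_poly (lin_forms I :: 'k poly_alg set) q) (q * CARD('k) ^ i)"
  let ?rest = "map (\<lambda>i. ?D (Suc i)) [0..<r]"
  have seq: "dickson_seq TYPE('k) I q = ?D 0 # ?rest"
    unfolding dickson_seq_def using Suc.hyps(2)[symmetric]
    by (simp add: upt_rec[of 0 "Suc r"] map_Suc_upt[symmetric] o_def del: upt_Suc)
  note fin = finite_lin_forms[OF Suc.prems, where 'k = 'k]
  have factor: "regular_mod {0} (- l # ?rest)" if l: "l \<in> lin_forms I - {0}" for l :: "'k poly_alg"
  proof -
    have "- l \<in> lin_forms I" "- l \<noteq> 0" using l lin_forms_diff[OF zero_in_lin_forms, of l] by auto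
    then obtain a where a: "- l = lin_form I a" and nz: "lin_form I a \<noteq> 0"
      unfolding lin_forms_def by force
    obtain j where j: "j \<in> I" "a j \<noteq> 0" using lin_form_nonzero_coeff[OF nz] by blast
    note e = Suc.prems j a
    let ?e = "eliminate (- l) (a j) j"
    have "?e (coeff (dickson_poly (lin_forms I) q) d) =
        coeff (dickson_poly (lin_forms (I - {j})) (CARD('k) * q)) d" for d
      using coeff_dickson_poly_image[OF eliminate_hom[OF e] fin lin_forms_add lin_forms_diff, of q d]
      unfolding eliminate_image[OF e] card_eliminate_kernel[OF e \<open>- l \<noteq> 0\<close>] .
    moreover have "card (I - {j}) = r" using j Suc.hyps(2) Suc.prems by simp
    ultimately have map_rest: "map ?e ?rest = dickson_seq TYPE('k) (I - {j}) (CARD('k) * q)"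
      by (simp add: dickson_seq_def mult_ac)
    have "regular_mod {0} (map ?e ?rest)"
      unfolding map_rest by (rule Suc.hyps(1)) (use j Suc in auto)
    moreover have "?e 0 = 0" by (simp add: eliminate_def poly_subst_def)
    ultimately have "regular_mod {f. ?e f \<in> {0}} ?rest"
      by (intro regular_mod_preimage[OF eliminate_hom[OF e] eliminate_idem[OF e] is_ideal_zero]) simp_all
    then show ?thesis
      unfolding eliminate_kernel[OF e] using \<open>- l \<noteq> 0\<close> by simp
  qed
  have "regular_mod {0} ((\<Prod>l\<in>lin_forms I - {0 :: 'k poly_alg}. (- l) ^ q) # ?rest)"
    by (intro regular_mod_prod regular_mod_power is_ideal_zero factor finite_Diff fin)
  then show ?case
    unfolding seq by (simp add: coeff_dickson_poly_bottom[OF fin zero_in_lin_forms] del: regular_mod.simps)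
qed

lemma card_lin_forms:
  assumes "finite I"
  shows "card (lin_forms I :: 'k::{finite, field} poly_alg set) = CARD('k) ^ card I"
  using assms
proof induction
  case empty
  show ?case by (simp add: lin_forms_def lin_form_def[abs_def])
next
  case (insert j I)
  let ?a = "\<lambda>i. if i = j then 1 else 0 :: 'k"
  have v: "lin_form (insert j I) ?a = poly_var j"
    using insert by (auto simp: lin_form_def poly_const_simps intro!: sum.neutral)
  have "mlookup (poly_var j :: 'k poly_alg) (msingle j 1) \<noteq> mlookup 0 (msingle j 1)"
    by (simp add: poly_var_def)
  then have nz: "poly_var j \<noteq> (0 :: 'k poly_alg)" by metis
  have e: "finite (insert j I)" "j \<in> insert j I" "?a j \<noteq> 0" "poly_var j = lin_form (insert j I) ?a"
    using insert v by auto
  interpret comm_ring_hom "eliminate (poly_var j) (?a j) j" by (rule eliminate_hom[OF e])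
  show ?case
    using prod_over_fibres(2)[OF finite_lin_forms[OF e(1)] lin_forms_add lin_forms_diff hom_add]
    unfolding eliminate_image[OF e] card_eliminate_kernel[OF e nz] using insert by simp
qed

abbreviation mdeg :: "(nat \<Rightarrow>\<^sub>0 nat) \<Rightarrow> nat" where
  "mdeg m \<equiv> \<Sum>i\<in>mkeys m. mlookup m i"

lemma mdeg_add: "mdeg (m + m') = mdeg m + mdeg m'"
proof -
  let ?I = "mkeys m \<union> mkeys m'"
  have *: "mdeg k = (\<Sum>i\<in>?I. mlookup k i)" if "mkeys k \<subseteq> ?I" for k :: "nat \<Rightarrow>\<^sub>0 nat"
    by (rule sum.mono_neutral_left) (use that in \<open>auto simp: in_keys_iff\<close>)
  show ?thesis
    unfolding *[OF keys_add] *[of m, OF Un_upper1] *[of m', OF Un_upper2]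
    by (simp add: lookup_add sum.distrib)
qed

lemma homogeneous_0 [simp]: "homogeneous d 0"
  and homogeneous_add: "homogeneous d f \<Longrightarrow> homogeneous d g \<Longrightarrow> homogeneous d (f + g)"
  and homogeneous_uminus: "homogeneous d f \<Longrightarrow> homogeneous d (- f)"
  and homogeneous_mult: "homogeneous d f \<Longrightarrow> homogeneous d' g \<Longrightarrow> homogeneous (d + d') (f * g)"
  and homogeneous_const: "homogeneous 0 (poly_const a)"
  and homogeneous_var: "homogeneous 2 (poly_var i)"
proof -
  show "homogeneous d 0" by (simp add: homogeneous_def)
  show "homogeneous d f \<Longrightarrow> homogeneous d g \<Longrightarrow> homogeneous d (f + g)"
    unfolding homogeneous_def using keys_add[of f g] by blast
  show "homogeneous d f \<Longrightarrow> homogeneous d (- f)"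
    unfolding homogeneous_def by (auto simp: in_keys_iff)
  show "homogeneous 0 (poly_const a)" by (auto simp: homogeneous_def poly_const_def)
  show "homogeneous 2 (poly_var i)" by (auto simp: homogeneous_def poly_var_def)
  assume f: "homogeneous d f" and g: "homogeneous d' g"
  show "homogeneous (d + d') (f * g)"
    unfolding homogeneous_def
  proof
    fix m assume "m \<in> mkeys (f * g)"
    then obtain a b where "m = a + b" "a \<in> mkeys f" "b \<in> mkeys g"
      using keys_mult[of f g] by blast
    then show "2 * (\<Sum>i\<in>mkeys m. mlookup m i) = d + d'"
      using f g by (simp add: homogeneous_def mdeg_add)
  qed
qed

lemma homogeneous_sum: "(\<And>i. i \<in> A \<Longrightarrow> homogeneous d (f i)) \<Longrightarrow> homogeneous d (sum f A)"
  by (induction A rule: infinite_finite_induct) (auto intro: homogeneous_add)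

lemma homogeneous_lin_form: "homogeneous 2 (lin_form I a)"
  unfolding lin_form_def
  using homogeneous_mult[OF homogeneous_const homogeneous_var] by (intro homogeneous_sum) (simp only: add_0)

text \<open>
  If \<open>X\<close> is given degree 2 as well, the product is homogeneous of degree \<open>2 |L|\<close>.
\<close>

lemma homogeneous_coeff_dickson_poly:
  assumes "finite L" "\<And>l. l \<in> L \<Longrightarrow> homogeneous 2 l"
  shows "homogeneous (2 * (card L - e)) (coeff (dickson_poly L 1) e) \<and>
    (e > card L \<longrightarrow> coeff (dickson_poly L 1) e = 0)"
  using assms
proof (induction L arbitrary: e)
  case empty
  then show ?case
    using homogeneous_const[of 1] by (cases "e = 0") (simp_all add: dickson_poly_def poly_const_simps)
next
  case (insert l L)
  have IH: "homogeneous (2 * (card L - e)) (coeff (dickson_poly L 1) e)"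
    "e > card L \<Longrightarrow> coeff (dickson_poly L 1) e = 0" for e
    using insert.IH[of e] insert.prems by auto
  have D: "dickson_poly (insert l L) 1 = [:- l, 1:] * dickson_poly L 1"
    using insert by (simp add: dickson_poly_def)
  show ?case
  proof (cases e)
    case 0
    have "homogeneous (2 + 2 * (card L - 0)) (- l * coeff (dickson_poly L 1) 0)"
      by (intro homogeneous_mult homogeneous_uminus IH) (use insert in auto)
    then show ?thesis using 0 insert D by simp
  next
    case (Suc e')
    have c: "coeff (dickson_poly (insert l L) 1) e = - l * coeff (dickson_poly L 1) (Suc e') + coeff (dickson_poly L 1) e'"
      unfolding D Suc by simp
    show ?thesis
    proof (cases "e' < card L")
      case True
      have "homogeneous (2 + 2 * (card L - Suc e')) (- l * coeff (dickson_poly L 1) (Suc e'))"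
        by (intro homogeneous_mult homogeneous_uminus IH) (use insert in auto)
      moreover have "2 + 2 * (card L - Suc e') = 2 * (card L - e')" using True by simp
      ultimately have "homogeneous (2 * (card L - e')) (coeff (dickson_poly (insert l L) 1) e)"
        unfolding c by (intro homogeneous_add[OF _ IH(1)]) simp
      then show ?thesis using True Suc insert.hyps by simp
    next
      case False
      then have "coeff (dickson_poly (insert l L) 1) e = coeff (dickson_poly L 1) e'"
        unfolding c using IH(2)[of "Suc e'"] by simp
      then show ?thesis
        using IH[of e'] False Suc insert by auto
    qed
  qed
qed

section \<open>Lifting regularity through a filtration\<close>

text \<open>
  The assumption \<open>graded\<close> says that the initial forms of the \<open>y i\<close> are a regular sequence on the
  associated graded module, with congruences in place of that module.
\<close>

locale filtered_sequence =
  fixes Fil :: "nat \<Rightarrow> 'a::comm_ring_1 set" and y :: "nat \<Rightarrow> 'a" and n :: nat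
  assumes zero: "0 \<in> Fil k"
    and add: "u \<in> Fil k \<Longrightarrow> v \<in> Fil k \<Longrightarrow> u + v \<in> Fil k"
    and uminus: "u \<in> Fil k \<Longrightarrow> - u \<in> Fil k"
    and mult: "j < n \<Longrightarrow> u \<in> Fil k \<Longrightarrow> y j * u \<in> Fil k"
    and mono: "u \<in> Fil (Suc k) \<Longrightarrow> u \<in> Fil k"
    and graded: "i < n \<Longrightarrow> u \<in> Fil k \<Longrightarrow> (\<And>j. j < i \<Longrightarrow> b j \<in> Fil k) \<Longrightarrow>
      y i * u - (\<Sum>j<i. y j * b j) \<in> Fil (Suc k) \<Longrightarrow>
      \<exists>a. (\<forall>j<i. a j \<in> Fil k) \<and> u - (\<Sum>j<i. y j * a j) \<in> Fil (Suc k)"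
begin

lemma diff: "u \<in> Fil k \<Longrightarrow> v \<in> Fil k \<Longrightarrow> u - v \<in> Fil k"
  using add[OF _ uminus] by fastforce

lemma sum: "(\<And>i. i \<in> A \<Longrightarrow> f i \<in> Fil k) \<Longrightarrow> sum f A \<in> Fil k"
  by (induction A rule: infinite_finite_induct) (auto intro: zero add)

lemma mono_le: "k \<le> l \<Longrightarrow> u \<in> Fil l \<Longrightarrow> u \<in> Fil k"
  by (induction l rule: dec_induct) (auto intro: mono)

text \<open>
  If the coefficients of a combination of the \<open>y j\<close> have lower order than the combination itself, their
  initial forms are a relation between the initial forms of the \<open>y j\<close>. Such a relation is generated by
  Koszul relations, and these can be subtracted without changing the combination.
\<close>

lemma strict_step:
  assumes "i \<le> n" "\<And>j. j < i \<Longrightarrow> b j \<in> Fil m" "(\<Sum>j<i. y j * b j) \<in> Fil (Suc m)"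
  shows "\<exists>b'. (\<forall>j<i. b' j \<in> Fil (Suc m)) \<and> (\<Sum>j<i. y j * b' j) = (\<Sum>j<i. y j * b j)"
  using assms
proof (induction i arbitrary: b)
  case (Suc i)
  have "y i * b i - (\<Sum>j<i. y j * - b j) \<in> Fil (Suc m)"
    using Suc.prems(3) by (simp add: sum_negf algebra_simps)
  then obtain a where a: "\<And>j. j < i \<Longrightarrow> a j \<in> Fil m" "b i - (\<Sum>j<i. y j * a j) \<in> Fil (Suc m)"
    using graded[of i "b i" m "\<lambda>j. - b j"] Suc.prems(1,2) uminus by (auto simp: Suc_le_eq)
  \<comment> \<open>The Koszul relations \<open>y j * y i = y i * y j\<close>, weighted by \<open>a j\<close>, are used to replace \<open>b i\<close> by \<open>c\<close>.\<close>
  define c where "c = b i - (\<Sum>j<i. y j * a j)"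
  have c: "c \<in> Fil (Suc m)" using a by (simp add: c_def)
  have eq: "(\<Sum>j<Suc i. y j * b j) = (\<Sum>j<i. y j * (b j + y i * a j)) + y i * c"
    by (simp add: c_def sum.distrib sum_distrib_left algebra_simps)
  have yi: "y i * c \<in> Fil (Suc m)" using mult Suc.prems(1) c by auto
  have "(\<Sum>j<i. y j * (b j + y i * a j)) = (\<Sum>j<Suc i. y j * b j) - y i * c"
    unfolding eq by simp
  then have "(\<Sum>j<i. y j * (b j + y i * a j)) \<in> Fil (Suc m)"
    using diff[OF Suc.prems(3) yi] by simp
  moreover have "b j + y i * a j \<in> Fil m" if "j < i" for j
    using that Suc.prems a by (auto intro!: add mult)
  ultimately obtain b' where b': "\<forall>j<i. b' j \<in> Fil (Suc m)"
    "(\<Sum>j<i. y j * b' j) = (\<Sum>j<i. y j * (b j + y i * a j))"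
    using Suc.IH[of "\<lambda>j. b j + y i * a j"] Suc.prems(1) by auto
  show ?case
  proof (intro exI conjI allI impI)
    show "(\<Sum>j<Suc i. y j * (b'(i := c)) j) = (\<Sum>j<Suc i. y j * b j)"
      unfolding eq b'(2)[symmetric] by simp
    show "(b'(i := c)) j \<in> Fil (Suc m)" if "j < Suc i" for j
      using that b' c by (auto simp: less_Suc_eq)
  qed
qed simp

lemma strict:
  assumes "m \<le> k" "i \<le> n" "\<And>j. j < i \<Longrightarrow> b j \<in> Fil m" "(\<Sum>j<i. y j * b j) \<in> Fil k"
  shows "\<exists>b'. (\<forall>j<i. b' j \<in> Fil k) \<and> (\<Sum>j<i. y j * b' j) = (\<Sum>j<i. y j * b j)"
  using assms(1,4)
proof (induction k rule: dec_induct)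
  case base
  then show ?case using assms(3) by blast
next
  case (step k)
  then obtain b' where b': "\<forall>j<i. b' j \<in> Fil k" "(\<Sum>j<i. y j * b' j) = (\<Sum>j<i. y j * b j)"
    using mono by blast
  show ?case
    using strict_step[of i b' k] b' assms(2) step.prems by auto
qed

text \<open>
  The conclusion holds for every \<open>k\<close>, so it amounts to regularity as soon as the filtration can be
  cut off at a finite stage.
\<close>

lemma regular_modulo_filtration:
  assumes i: "i < n" and u: "u \<in> Fil 0" and b: "\<And>j. j < i \<Longrightarrow> b j \<in> Fil 0"
    and eq: "y i * u = (\<Sum>j<i. y j * b j)"
  shows "\<exists>a. (\<forall>j<i. a j \<in> Fil 0) \<and> u - (\<Sum>j<i. y j * a j) \<in> Fil k"
proof (induction k)
  case 0
  show ?case using u zero by (intro exI[of _ "\<lambda>_. 0"]) auto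
next
  case (Suc k)
  then obtain a where a: "\<forall>j<i. a j \<in> Fil 0" "u - (\<Sum>j<i. y j * a j) \<in> Fil k" by blast
  define u' where "u' = u - (\<Sum>j<i. y j * a j)"
  have u': "u' \<in> Fil k" using a by (simp add: u'_def)
  have "y i * u' = y i * u - (\<Sum>j<i. y j * (y i * a j))"
    by (simp add: u'_def right_diff_distrib sum_distrib_left mult_ac)
  then have yu': "y i * u' = (\<Sum>j<i. y j * (b j - y i * a j))"
    unfolding eq by (simp add: right_diff_distrib sum_subtractf)
  have "\<And>j. j < i \<Longrightarrow> b j - y i * a j \<in> Fil 0" "(\<Sum>j<i. y j * (b j - y i * a j)) \<in> Fil k"
    using a b i mult[OF i u'] by (auto intro!: diff mult simp: yu')
  then obtain b' where b': "\<forall>j<i. b' j \<in> Fil k" "(\<Sum>j<i. y j * b' j) = y i * u'"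
    using strict[of 0 k i "\<lambda>j. b j - y i * a j"] i unfolding yu' by auto
  then obtain a' where a': "\<forall>j<i. a' j \<in> Fil k" "u' - (\<Sum>j<i. y j * a' j) \<in> Fil (Suc k)"
    using graded[OF i u', of b'] zero by auto
  have "u - (\<Sum>j<i. y j * (a j + a' j)) = u' - (\<Sum>j<i. y j * a' j)"
    by (simp add: u'_def sum.distrib algebra_simps)
  then show ?case
    using a a' mono_le[of 0 k] by (intro exI[of _ "\<lambda>j. a j + a' j"]) (auto intro!: add)
qed

end

section \<open>Bases adapted to a pair of subspaces\<close>

text \<open>
  The set \<open>B\<close> represents a basis of \<open>U0 / U1\<close>, and \<open>\<phi> b\<close> is the coordinate at \<open>b\<close>. It arises from a basis
  of \<open>U1\<close> that is extended to \<open>U0\<close>. The further extension to the whole space is there to have the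
  functionals defined everywhere.
\<close>

lemma (in vector_space) adapted_functionals:
  assumes U: "subspace U1" "subspace U0" "U1 \<subseteq> U0"
  obtains B and \<phi> :: "'b \<Rightarrow> 'b \<Rightarrow> 'a" where
    "B \<subseteq> U0" "\<And>b. Vector_Spaces.linear scale (*) (\<phi> b)" "\<And>b u. b \<in> B \<Longrightarrow> u \<in> U1 \<Longrightarrow> \<phi> b u = 0"
    "\<And>u. finite {b \<in> B. \<phi> b u \<noteq> 0}"
    "\<And>u. u \<in> U0 \<Longrightarrow> u - (\<Sum>b\<in>{b \<in> B. \<phi> b u \<noteq> 0}. scale (\<phi> b u) b) \<in> U1"
proof -
  obtain B1 where B1: "B1 \<subseteq> U1" "independent B1" "U1 \<subseteq> span B1"
    by (rule maximal_independent_subset)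
  have "B1 \<subseteq> U0" using B1(1) U(3) by (rule subset_trans)
  then obtain B0 where B0: "B1 \<subseteq> B0" "B0 \<subseteq> U0" "independent B0" "U0 \<subseteq> span B0"
    by (rule maximal_independent_subset_extend[OF _ B1(2)])
  obtain E where "B0 \<subseteq> E" "E \<subseteq> UNIV" "independent E" "UNIV \<subseteq> span E"
    by (rule maximal_independent_subset_extend[OF subset_UNIV B0(3)])
  then have E: "B0 \<subseteq> E" "independent E" "span E = UNIV" by auto
  define \<phi> where "\<phi> b u = representation E u b" for b u
  have rep1: "representation E u = representation B1 u" if "u \<in> U1" for u
    using representation_extend[OF E(2)] B1 B0 E that by blast
  have rep0: "representation E u = representation B0 u" if "u \<in> U0" for u
    using representation_extend[OF E(2)] B0 E that by blast
  have fin: "finite {b. \<phi> b u \<noteq> 0}" for u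
    using finite_representation[of E u] by (simp add: \<phi>_def)
  show ?thesis
  proof (rule that[of "B0 - B1" \<phi>])
    show "B0 - B1 \<subseteq> U0" using B0 by blast
    show "Vector_Spaces.linear scale (*) (\<phi> b)" for b
      unfolding \<phi>_def using linear_representation[OF E(2,3)] .
    show "\<phi> b u = 0" if "b \<in> B0 - B1" "u \<in> U1" for b u
      using representation_ne_zero[of B1 u b] that by (auto simp: \<phi>_def rep1)
    show "finite {b \<in> B0 - B1. \<phi> b u \<noteq> 0}" for u
      by (rule finite_subset[OF _ fin[of u]]) auto
    fix u assume u: "u \<in> U0"
    have "b \<in> B0" if "\<phi> b u \<noteq> 0" for b
      using that representation_ne_zero[of B0 u b] by (simp add: \<phi>_def rep0[OF u])
    then have split: "{b. \<phi> b u \<noteq> 0} = {b \<in> B1. \<phi> b u \<noteq> 0} \<union> {b \<in> B0 - B1. \<phi> b u \<noteq> 0}"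
      by blast
    have "u = (\<Sum>b\<in>{b. \<phi> b u \<noteq> 0}. scale (\<phi> b u) b)"
      using sum_nonzero_representation_eq[OF E(2), of u] E by (simp add: \<phi>_def)
    also have "\<dots> = (\<Sum>b\<in>{b \<in> B1. \<phi> b u \<noteq> 0}. scale (\<phi> b u) b) + (\<Sum>b\<in>{b \<in> B0 - B1. \<phi> b u \<noteq> 0}. scale (\<phi> b u) b)"
      unfolding split by (rule sum.union_disjoint) (auto intro: finite_subset[OF _ fin[of u]])
    finally have "u - (\<Sum>b\<in>{b \<in> B0 - B1. \<phi> b u \<noteq> 0}. scale (\<phi> b u) b)
        = (\<Sum>b\<in>{b \<in> B1. \<phi> b u \<noteq> 0}. scale (\<phi> b u) b)"
      by (simp add: algebra_simps)
    also have "\<dots> \<in> U1"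
      using B1 U by (auto intro!: subspace_sum subspace_scale)
    finally show "u - (\<Sum>b\<in>{b \<in> B0 - B1. \<phi> b u \<noteq> 0}. scale (\<phi> b u) b) \<in> U1" .
  qed
qed

section \<open>Truncation by degree\<close>

text \<open>
  The part of degree less than \<open>2 d\<close>, if variables have degree 2.
\<close>

definition trunc :: "nat \<Rightarrow> 'k::comm_ring_1 poly_alg \<Rightarrow> 'k poly_alg" where
  "trunc d f = (\<Sum>m\<in>{m \<in> mkeys f. mdeg m < d}. msingle m (mlookup f m))"

lemma lookup_trunc: "mlookup (trunc d f) m = (if mdeg m < d then mlookup f m else 0)"
proof -
  have "mlookup (trunc d f) m = (\<Sum>m'\<in>{m \<in> mkeys f. mdeg m < d}. if m' = m then mlookup f m' else 0)"
    unfolding trunc_def lookup_sum by (intro sum.cong refl) (auto simp: lookup_single when_def)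
  also have "\<dots> = (if mdeg m < d then mlookup f m else 0)"
    by (auto simp: in_keys_iff)
  finally show ?thesis .
qed

lemma trunc_eq_self: "(\<And>m. m \<in> mkeys f \<Longrightarrow> mdeg m < d) \<Longrightarrow> trunc d f = f"
  by (rule poly_mapping_eqI) (auto simp: lookup_trunc in_keys_iff)

lemma trunc_eq_0: "(\<And>m. m \<in> mkeys f \<Longrightarrow> d \<le> mdeg m) \<Longrightarrow> trunc d f = 0"
  by (rule poly_mapping_eqI) (force simp: lookup_trunc in_keys_iff)

lemma trunc_add: "trunc d (f + g) = trunc d f + trunc d g"
  by (rule poly_mapping_eqI) (simp add: lookup_trunc lookup_add)

lemma trunc_minus: "trunc d (f - g) = trunc d f - trunc d g"
  by (rule poly_mapping_eqI) (simp add: lookup_trunc lookup_minus)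

lemma trunc_0: "trunc d 0 = 0"
  by (rule poly_mapping_eqI) (simp add: lookup_trunc)

lemma trunc_sum: "trunc d (sum f A) = (\<Sum>a\<in>A. trunc d (f a))"
  by (induction A rule: infinite_finite_induct) (simp_all add: trunc_add trunc_0)

lemma keys_trunc: "m \<in> mkeys (trunc d f) \<Longrightarrow> m \<in> mkeys f \<and> mdeg m < d"
  by (auto simp: in_keys_iff lookup_trunc split: if_splits)

lemma keys_minus_trunc: "m \<in> mkeys (f - trunc d f) \<Longrightarrow> m \<in> mkeys f \<and> d \<le> mdeg m"
  by (auto simp: in_keys_iff lookup_trunc lookup_minus split: if_splits)

text \<open>
  For maps \<open>h\<close> that shift degrees by a constant.
\<close>

lemma trunc_hom:
  assumes "h (trunc d f) + h (f - trunc d f) = h f"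
    and "\<And>m. m \<in> mkeys (h (trunc d f)) \<Longrightarrow> mdeg m < d'"
    and "\<And>m. m \<in> mkeys (h (f - trunc d f)) \<Longrightarrow> d' \<le> mdeg m"
  shows "trunc d' (h f) = h (trunc d f)"
proof -
  have "trunc d' (h f) = trunc d' (h (trunc d f)) + trunc d' (h (f - trunc d f))"
    by (simp add: assms(1) flip: trunc_add)
  then show ?thesis using assms by (simp add: trunc_eq_self trunc_eq_0)
qed

lemma trunc_homogeneous_mult:
  assumes "homogeneous (2 * e) x"
  shows "trunc d (x * f) = x * trunc (d - e) f"
proof (rule trunc_hom[where h = "(*) x"])
  show "x * trunc (d - e) f + x * (f - trunc (d - e) f) = x * f"
    by (simp flip: distrib_left)
  have x: "mdeg m = e" if "m \<in> mkeys x" for m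
    using assms that by (simp add: homogeneous_def)
  show "mdeg m < d" if "m \<in> mkeys (x * trunc (d - e) f)" for m
  proof -
    obtain a b where "m = a + b" "a \<in> mkeys x" "b \<in> mkeys (trunc (d - e) f)"
      using \<open>m \<in> _\<close> keys_mult by blast
    then show ?thesis using x keys_trunc by (fastforce simp: mdeg_add)
  qed
  show "d \<le> mdeg m" if "m \<in> mkeys (x * (f - trunc (d - e) f))" for m
  proof -
    obtain a b where "m = a + b" "a \<in> mkeys x" "b \<in> mkeys (f - trunc (d - e) f)"
      using \<open>m \<in> _\<close> keys_mult by blast
    then show ?thesis using x keys_minus_trunc by (fastforce simp: mdeg_add)
  qed
qed

lemma homogeneous_power: "homogeneous d f \<Longrightarrow> homogeneous (k * d) (f ^ k)"
proof (induction k)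
  case 0
  then show ?case using homogeneous_const[of 1] by (simp add: poly_const_simps)
next
  case (Suc k)
  then show ?case using homogeneous_mult[of d f "k * d" "f ^ k"] by simp
qed

lemma homogeneous_prod:
  "(\<And>i. i \<in> A \<Longrightarrow> homogeneous (d i) (f i)) \<Longrightarrow> homogeneous (sum d A) (prod f A)"
proof (induction A rule: infinite_finite_induct)
  case (insert i A)
  then show ?case using homogeneous_mult[of "d i" "f i" "sum d A" "prod f A"] by simp
qed (use homogeneous_const[of 1] in \<open>simp_all add: poly_const_simps\<close>)

lemma homogeneous_poly_subst_term:
  assumes "\<And>i. homogeneous 2 (s i)"
  shows "homogeneous (2 * mdeg m) (poly_const a * (\<Prod>i\<in>mkeys m. s i ^ mlookup m i))"
proof -
  have "homogeneous (0 + (\<Sum>i\<in>mkeys m. mlookup m i * 2)) (poly_const a * (\<Prod>i\<in>mkeys m. s i ^ mlookup m i))"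
    by (intro homogeneous_mult homogeneous_const homogeneous_prod homogeneous_power assms)
  then show ?thesis by (simp add: sum_distrib_left mult.commute)
qed

lemma keys_poly_subst_linear:
  assumes "\<And>i. homogeneous 2 (s i)" and m: "m \<in> mkeys (poly_subst s f)"
  obtains m' where "m' \<in> mkeys f" "mdeg m = mdeg m'"
proof -
  define t where "t m' = poly_const (mlookup f m') * (\<Prod>i\<in>mkeys m'. s i ^ mlookup m' i)" for m'
  have "mlookup (\<Sum>m'\<in>mkeys f. t m') m \<noteq> 0"
    using m by (simp add: poly_subst_def t_def in_keys_iff)
  then obtain m' where m': "m' \<in> mkeys f" "mlookup (t m') m \<noteq> 0"
    by (metis (mono_tags, lifting) lookup_sum sum.neutral)
  have "homogeneous (2 * mdeg m') (t m')"
    unfolding t_def by (rule homogeneous_poly_subst_term) (rule assms)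
  then have "mdeg m = mdeg m'" using m'(2) by (auto simp: homogeneous_def in_keys_iff)
  then show ?thesis using that m' by blast
qed

lemma trunc_poly_subst:
  assumes s: "\<And>i. homogeneous 2 (s i)"
  shows "trunc d (poly_subst s f) = poly_subst s (trunc d f)"
proof (rule trunc_hom)
  interpret comm_ring_hom "poly_subst s" by (rule poly_subst_hom)
  show "poly_subst s (trunc d f) + poly_subst s (f - trunc d f) = poly_subst s f"
    by (simp flip: hom_add)
  show "mdeg m < d" if "m \<in> mkeys (poly_subst s (trunc d f))" for m
    using keys_poly_subst_linear[OF s that] keys_trunc by metis
  show "d \<le> mdeg m" if "m \<in> mkeys (poly_subst s (f - trunc d f))" for m
    using keys_poly_subst_linear[OF s that] keys_minus_trunc by metis
qed

section \<open>Regularity on a subring that is stable under translation\<close>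

text \<open>
  The polynomial \<open>f (v + c)\<close>, as a polynomial in \<open>c \<in> C\<close> whose coefficients are polynomials in \<open>v \<in> V\<close>.
  The linear form \<open>L i\<close> is the restriction to \<open>C\<close> of the coordinate \<open>i\<close> on \<open>V\<close>.
\<close>

definition translate :: "(nat \<Rightarrow> 'k::comm_ring_1 poly_alg) \<Rightarrow> 'k poly_alg \<Rightarrow> 'k poly_alg poly_alg" where
  "translate L = subst_hom (\<lambda>a. poly_const (poly_const a))
     (\<lambda>i. poly_const (poly_var i) + Poly_Mapping.map poly_const (L i))"

lemma translate_hom: "comm_ring_hom (translate L)"
  unfolding translate_def
  by (rule subst_hom_hom[OF comm_ring_hom_comp[OF poly_const_hom poly_const_hom]])

lemma translate_const: "translate L (poly_const a) = poly_const (poly_const a)"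
  and translate_var: "translate L (poly_var i) = poly_const (poly_var i) + Poly_Mapping.map poly_const (L i)"
  by (simp_all add: translate_def subst_hom_const subst_hom_var poly_const_simps)

lemma carrier_map_coeffs: "h 0 = 0 \<Longrightarrow> f \<in> poly_carrier r \<Longrightarrow> Poly_Mapping.map h f \<in> poly_carrier r"
  by (auto simp: poly_carrier_def in_keys_iff lookup_map_coeffs)

lemma lookup_poly_const: "mlookup (poly_const a) m = (if m = 0 then a else 0)"
  by (auto simp: poly_const_def lookup_single when_def)

lemma lookup_poly_const_mult: "mlookup (poly_const a * f) m = a * mlookup f m"
proof -
  have "poly_const a * f = Poly_Mapping.map ((*) a) f"
    by (simp add: poly_const_def mult_map_scale_conv_mult)
  then show ?thesis by (simp add: lookup_map_coeffs)
qed

lemma constant_term_var: "mlookup (poly_var i :: 'k::comm_ring_1 poly_alg) 0 = 0"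
proof -
  have "mlookup (msingle i (1 :: nat)) i \<noteq> mlookup 0 i" by simp
  then have "msingle i 1 \<noteq> (0 :: nat \<Rightarrow>\<^sub>0 nat)" by metis
  then show ?thesis by (simp add: poly_var_def lookup_single when_def)
qed

lemma translate_carrier:
  assumes "\<And>i. L i \<in> poly_carrier r"
  shows "translate L f \<in> poly_carrier r"
proof (induction f rule: poly_alg_induct)
  interpret comm_ring_hom "translate L" by (rule translate_hom)
  case (add f g) then show ?case by (simp add: hom_add poly_carrier_add)
next
  interpret comm_ring_hom "translate L" by (rule translate_hom)
  case (mult f g) then show ?case by (simp add: hom_mult poly_carrier_mult)
qed (auto simp: translate_const translate_var poly_const_simps
    intro!: poly_carrier_add carrier_map_coeffs assms)

text \<open>
  The case \<open>c = 0\<close> of \<open>f (v + c)\<close>.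
\<close>

lemma translate_constant_term:
  assumes "\<And>i. mlookup (L i) 0 = 0"
  shows "mlookup (translate L f) 0 = f"
proof (rule comm_ring_hom_eq_poly_alg[where h' = "\<lambda>f. f"])
  show "comm_ring_hom (\<lambda>f. mlookup (translate L f) 0)"
    by (rule comm_ring_hom_comp[OF constant_term_hom translate_hom])
  show "comm_ring_hom (\<lambda>f :: 'a poly_alg. f)" by (rule comm_ring_homI) auto
qed (simp_all add: translate_const translate_var lookup_add lookup_poly_const
    lookup_map_coeffs poly_const_simps assms)

text \<open>
  The case \<open>v = 0\<close> of \<open>f (v + c)\<close>, which is the restriction to \<open>C\<close>.
\<close>

lemma translate_at_0: "Poly_Mapping.map (\<lambda>f. mlookup f 0) (translate L f) = poly_subst L f"
proof (rule comm_ring_hom_eq_poly_alg[where h' = "poly_subst L"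
      and h = "\<lambda>f. Poly_Mapping.map (\<lambda>f. mlookup f 0) (translate L f)"])
  interpret comm_ring_hom "Poly_Mapping.map (\<lambda>f. mlookup f 0) :: 'a poly_alg poly_alg \<Rightarrow> 'a poly_alg"
    by (rule map_coeffs_hom[OF constant_term_hom])
  show "comm_ring_hom (\<lambda>f. Poly_Mapping.map (\<lambda>f. mlookup f 0) (translate L f))"
    by (rule comm_ring_hom_comp[OF map_coeffs_hom[OF constant_term_hom] translate_hom])
  show "comm_ring_hom (poly_subst L)" by (rule poly_subst_hom)
  show "Poly_Mapping.map (\<lambda>f. mlookup f 0) (translate L (poly_const a)) = poly_subst L (poly_const a)" for a
    by (simp add: translate_const poly_subst_const map_coeffs_const lookup_poly_const)
  show "Poly_Mapping.map (\<lambda>f. mlookup f 0) (translate L (poly_var i)) = poly_subst L (poly_var i)" for i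
    by (intro poly_mapping_eqI)
      (simp add: translate_var poly_subst_var hom_add lookup_add lookup_map_coeffs
        poly_const_simps lookup_poly_const constant_term_var)
qed

text \<open>
  A linear functional on the polynomials in \<open>v\<close>, applied to the coefficients, is linear over the
  polynomials in \<open>c\<close>.
\<close>

lemma map_linear_mult_const:
  fixes \<phi> :: "'k::field poly_alg \<Rightarrow> 'k" and z :: "'k poly_alg" and F G :: "'k poly_alg poly_alg"
  assumes add: "\<And>f g. \<phi> (f + g) = \<phi> f + \<phi> g" and scale: "\<And>a f. \<phi> (poly_const a * f) = a * \<phi> f"
  shows "Poly_Mapping.map \<phi> (Poly_Mapping.map poly_const z * F) = z * Poly_Mapping.map \<phi> F"
    and "Poly_Mapping.map \<phi> (F + G) = Poly_Mapping.map \<phi> F + Poly_Mapping.map \<phi> G"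
proof -
  have 0: "\<phi> 0 = 0" using scale[of 0 0] by (simp add: poly_const_simps)
  have map_add: "Poly_Mapping.map \<phi> (F + G) = Poly_Mapping.map \<phi> F + Poly_Mapping.map \<phi> G" for F G :: "'k poly_alg poly_alg"
    by (rule poly_mapping_eqI) (simp add: lookup_map_coeffs 0 lookup_add add)
  then show "Poly_Mapping.map \<phi> (F + G) = Poly_Mapping.map \<phi> F + Poly_Mapping.map \<phi> G" .
  have map_sum: "Poly_Mapping.map \<phi> (sum f A) = (\<Sum>a\<in>A. Poly_Mapping.map \<phi> (f a))" for f :: "'x \<Rightarrow> 'k poly_alg poly_alg" and A
    by (induction A rule: infinite_finite_induct) (auto simp: map_add 0 map_eq_zero_iff)
  have single: "Poly_Mapping.map h (msingle m f) = msingle m (h f)" if "h 0 = 0"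
    for h :: "'x::zero \<Rightarrow> 'y::zero" and m :: "nat \<Rightarrow>\<^sub>0 nat" and f
    by (rule poly_mapping_eqI) (use that in \<open>auto simp: lookup_map_coeffs lookup_single when_def\<close>)
  have "Poly_Mapping.map poly_const z = (\<Sum>m\<in>mkeys z. msingle m (poly_const (mlookup z m)))"
  proof -
    interpret M: comm_ring_hom "Poly_Mapping.map poly_const :: 'k poly_alg \<Rightarrow> 'k poly_alg poly_alg"
      by (rule map_coeffs_hom[OF poly_const_hom])
    have "Poly_Mapping.map poly_const (\<Sum>m\<in>mkeys z. msingle m (mlookup z m)) =
        (\<Sum>m\<in>mkeys z. Poly_Mapping.map poly_const (msingle m (mlookup z m)))"
      by (rule M.hom_sum)
    also have "\<dots> = (\<Sum>m\<in>mkeys z. msingle m (poly_const (mlookup z m)))"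
      by (intro sum.cong refl single) (simp add: poly_const_simps)
    finally show ?thesis by (simp flip: poly_alg_sum_singles)
  qed
  then have "Poly_Mapping.map poly_const z * F =
      (\<Sum>m\<in>mkeys z. \<Sum>k\<in>mkeys F. msingle (m + k) (poly_const (mlookup z m) * mlookup F k))"
    by (subst (1) poly_alg_sum_singles[of F]) (simp add: sum_product mult_single)
  then have "Poly_Mapping.map \<phi> (Poly_Mapping.map poly_const z * F) =
      (\<Sum>m\<in>mkeys z. \<Sum>k\<in>mkeys F. msingle m (mlookup z m) * msingle k (\<phi> (mlookup F k)))"
    by (simp add: map_sum single 0 scale mult_single)
  also have "\<dots> = (\<Sum>m\<in>mkeys z. msingle m (mlookup z m)) * (\<Sum>k\<in>mkeys F. Poly_Mapping.map \<phi> (msingle k (mlookup F k)))"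
    by (simp add: sum_product single 0)
  also have "\<dots> = z * Poly_Mapping.map \<phi> F"
    by (simp flip: map_sum poly_alg_sum_singles)
  finally show "Poly_Mapping.map \<phi> (Poly_Mapping.map poly_const z * F) = z * Poly_Mapping.map \<phi> F" .
qed

lemma poly_alg_vector_space: "vector_space (\<lambda>a f. poly_const a * f :: 'k::field poly_alg)"
  by unfold_locales (simp_all add: poly_const_simps algebra_simps)

lemma poly_mapping_bounded_mdeg: "\<exists>d. \<forall>m\<in>mkeys (f :: 'k::comm_ring_1 poly_alg). mdeg m < d"
proof -
  have "finite (mdeg ` mkeys f)" by simp
  then obtain d where "\<forall>n\<in>mdeg ` mkeys f. n < d" using finite_nat_set_iff_bounded by blast
  then show ?thesis by blast
qed

text \<open>
  By hypothesis \<open>f \<mapsto> f (v + c)\<close> is a ring homomorphism from \<open>S\<close> to \<open>S[c]\<close>, with left inverse \<open>c = 0\<close>.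
  Filter \<open>S[c]\<close> by the order in \<open>v\<close> of the coefficients. The part of \<open>x (v + c)\<close> of order 0 is its value at
  \<open>v = 0\<close>, the restriction of \<open>x\<close> to \<open>C\<close>. The restrictions are regular on \<open>\<bbbF>[c]\<close>, hence on the associated
  graded module, which is free over \<open>\<bbbF>[c]\<close> because it is obtained from vector spaces by extension of
  scalars. So the elements \<open>x (v + c)\<close> are regular on \<open>S[c]\<close> modulo every step of the filtration, and
  setting \<open>c = 0\<close> carries this over to \<open>S\<close>. Since the \<open>x\<close> are homogeneous, truncation by degree removes
  the error term.
\<close>

lemma regular_on_translation_stable:
  fixes L :: "nat \<Rightarrow> 'k::field poly_alg" and S :: "'k poly_alg set"
  assumes L: "\<And>i. L i \<in> poly_carrier r" "\<And>i. mlookup (L i) 0 = 0"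
    and S: "\<And>a. poly_const a \<in> S" "\<And>f g. f \<in> S \<Longrightarrow> g \<in> S \<Longrightarrow> f + g \<in> S"
      "\<And>f g. f \<in> S \<Longrightarrow> g \<in> S \<Longrightarrow> f * g \<in> S"
    and S_trunc: "\<And>f d. f \<in> S \<Longrightarrow> trunc d f \<in> S"
    and S_translate: "\<And>f m. f \<in> S \<Longrightarrow> mlookup (translate L f) m \<in> S"
    and xs: "set xs \<subseteq> S" "\<And>x. x \<in> set xs \<Longrightarrow> homogeneous_pos x"
    and reg: "regular_on (poly_carrier r) (map (poly_subst L) xs)"
  shows "regular_on S xs"
proof -
  let ?\<iota> = "Poly_Mapping.map poly_const :: 'k poly_alg \<Rightarrow> 'k poly_alg poly_alg"
  interpret V: vector_space "\<lambda>a f. poly_const a * f :: 'k poly_alg" by (rule poly_alg_vector_space)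
  interpret T: comm_ring_hom "translate L" by (rule translate_hom)
  interpret Sb: comm_ring_hom "poly_subst L" by (rule poly_subst_hom)
  interpret I: comm_ring_hom ?\<iota> by (rule map_coeffs_hom[OF poly_const_hom])
  have S_uminus: "- f \<in> S" if "f \<in> S" for f
    using S(3)[OF S(1)[of "-1"] that] by (simp add: poly_const_simps)
  have S_0: "0 \<in> S" using S(1)[of 0] by (simp add: poly_const_simps)
  \<comment> \<open>\<open>U k\<close> is the filtration of \<open>S\<close> by order, and \<open>Fil k\<close> is the induced filtration of \<open>S[c]\<close>.\<close>
  define U where "U k = {f \<in> S. \<forall>m\<in>mkeys f. k \<le> mdeg m}" for k
  have U0: "U 0 = S" by (simp add: U_def)
  have U_zero: "0 \<in> U k" for k by (simp add: U_def S_0)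
  have U_add: "f + g \<in> U k" if "f \<in> U k" "g \<in> U k" for f g k
    using that S(2) keys_add[of f g] unfolding U_def by blast
  have U_mult: "f * g \<in> U (j + k)" if "f \<in> U j" "g \<in> U k" for f g j k
    unfolding U_def
  proof (intro CollectI conjI ballI)
    show "f * g \<in> S" using that S(3) by (auto simp: U_def)
    fix m assume "m \<in> mkeys (f * g)"
    then obtain a b where "m = a + b" "a \<in> mkeys f" "b \<in> mkeys g" using keys_mult by blast
    then show "j + k \<le> mdeg m" using that by (simp add: U_def mdeg_add add_mono)
  qed
  have U_uminus: "- f \<in> U k" if "f \<in> U k" for f k
    using that S_uminus by (auto simp: U_def in_keys_iff)
  have U_scale: "poly_const a * f \<in> U k" if "f \<in> U k" for a f k
    using U_mult[of "poly_const a" 0 f k] that S(1) by (simp add: U0)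
  have U_mono: "U (Suc k) \<subseteq> U k" for k by (auto simp: U_def)
  have U_subspace: "V.subspace (U k)" for k
    by (rule V.subspaceI) (auto intro: U_zero U_add U_scale)
  define Fil where "Fil k = {F \<in> poly_carrier r. \<forall>m. mlookup F m \<in> U k}" for k
  have Fil_mult: "F * G \<in> Fil (j + k)" if "F \<in> Fil j" "G \<in> Fil k" for F G j k
    using that lookup_mult_in[of F "U j" G "U k" "U (j + k)"] U_mult U_zero U_add
    by (auto simp: Fil_def intro: poly_carrier_mult)
  have Fil_add: "F + G \<in> Fil k" if "F \<in> Fil k" "G \<in> Fil k" for F G k
    using that U_add by (auto simp: Fil_def lookup_add intro: poly_carrier_add)
  have Fil_uminus: "- F \<in> Fil k" if "F \<in> Fil k" for F k
    using that U_uminus by (auto simp: Fil_def intro: poly_carrier_uminus)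
  have Fil_diff: "F - G \<in> Fil k" if "F \<in> Fil k" "G \<in> Fil k" for F G k
    using Fil_add[OF that(1) Fil_uminus[OF that(2)]] by simp
  have Fil_zero: "0 \<in> Fil k" for k by (simp add: Fil_def U_zero)
  have Fil_sum: "sum F A \<in> Fil k" if "\<And>i. i \<in> A \<Longrightarrow> F i \<in> Fil k" for F :: "'x \<Rightarrow> _" and A k
    using that by (induction A rule: infinite_finite_induct) (auto intro: Fil_zero Fil_add)
  have Fil_const: "poly_const f \<in> Fil k" if "f \<in> U k" for f k
    using that by (auto simp: Fil_def lookup_poly_const U_zero)
  have Fil_\<iota>: "?\<iota> z \<in> Fil 0" if "z \<in> poly_carrier r" for z
    using that S(1) by (auto simp: Fil_def U0 lookup_map_coeffs poly_const_simps intro: carrier_map_coeffs)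
  define y z where "y j = translate L (xs ! j)" and "z j = poly_subst L (xs ! j)" for j
  have xS: "xs ! j \<in> S" if "j < length xs" for j using that xs(1) by auto
  have z_carrier: "z j \<in> poly_carrier r" for j
  proof -
    have "poly_subst L f \<in> poly_carrier r" for f
      by (induction f rule: poly_alg_induct)
        (simp_all add: poly_subst_const poly_subst_var Sb.hom_add Sb.hom_mult L poly_carrier_add poly_carrier_mult)
    then show ?thesis by (simp add: z_def)
  qed
  have y_Fil: "y j \<in> Fil 0" if "j < length xs" for j
    using S_translate[OF xS[OF that]] translate_carrier[OF L(1)] by (auto simp: Fil_def U0 y_def)
  have y_z: "y j - ?\<iota> (z j) \<in> Fil 1" if "j < length xs" for j
  proof -
    have diff: "y j - ?\<iota> (z j) \<in> Fil 0"
      by (intro Fil_diff y_Fil Fil_\<iota> z_carrier that)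
    have "mlookup (mlookup (y j - ?\<iota> (z j)) m) 0 = 0" for m
    proof -
      have "mlookup (mlookup (y j) m) 0 = mlookup (Poly_Mapping.map (\<lambda>f. mlookup f 0) (y j)) m"
        by (simp add: lookup_map_coeffs)
      also have "\<dots> = mlookup (z j) m" by (simp add: y_def z_def translate_at_0)
      finally show ?thesis by (simp add: lookup_minus lookup_map_coeffs poly_const_simps lookup_poly_const)
    qed
    then have "1 \<le> mdeg k" if "k \<in> mkeys (mlookup (y j - ?\<iota> (z j)) m)" for k m
    proof -
      have "k \<noteq> 0" using that \<open>\<And>m. mlookup (mlookup (y j - ?\<iota> (z j)) m) 0 = 0\<close> by (auto simp: in_keys_iff)
      then obtain i where "i \<in> mkeys k" by fastforce
      then have "0 < mlookup k i" "mlookup k i \<le> mdeg k"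
        by (auto simp: in_keys_iff intro!: member_le_sum)
      then show ?thesis by simp
    qed
    then show ?thesis using diff by (auto simp: Fil_def U_def)
  qed
  have filtered: "filtered_sequence Fil y (length xs)"
  proof
    show "0 \<in> Fil k" for k by (rule Fil_zero)
    show "u + v \<in> Fil k" if "u \<in> Fil k" "v \<in> Fil k" for u v k using that by (rule Fil_add)
    show "- u \<in> Fil k" if "u \<in> Fil k" for u k using that by (rule Fil_uminus)
    show "y j * u \<in> Fil k" if "j < length xs" "u \<in> Fil k" for j u k
      using Fil_mult[OF y_Fil that(2)] that(1) by simp
    show "u \<in> Fil k" if "u \<in> Fil (Suc k)" for u k using that U_mono by (auto simp: Fil_def)
    fix i u k b
    assume i: "i < length xs" and u: "u \<in> Fil k" and b: "\<And>j. j < i \<Longrightarrow> b j \<in> Fil k"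
      and yu: "y i * u - (\<Sum>j<i. y j * b j) \<in> Fil (Suc k)"
    have yz_mult: "(y j - ?\<iota> (z j)) * f \<in> Fil (Suc k)" if "j < length xs" "f \<in> Fil k" for j f
      using Fil_mult[OF y_z that(2)] that(1) by simp
    define w where "w = ?\<iota> (z i) * u - (\<Sum>j<i. ?\<iota> (z j) * b j)"
    have "w = (y i * u - (\<Sum>j<i. y j * b j)) - (y i - ?\<iota> (z i)) * u + (\<Sum>j<i. (y j - ?\<iota> (z j)) * b j)"
      by (simp add: w_def left_diff_distrib sum_subtractf)
    then have w: "w \<in> Fil (Suc k)"
      using yu yz_mult[OF i u] i b by (auto intro!: Fil_add Fil_diff Fil_sum yz_mult)
    obtain B and \<phi> :: "'k poly_alg \<Rightarrow> 'k poly_alg \<Rightarrow> 'k" where B: "B \<subseteq> U k"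
      and lin: "\<And>e. Vector_Spaces.linear (\<lambda>a f. poly_const a * f) (*) (\<phi> e)"
      and vanish: "\<And>e f. e \<in> B \<Longrightarrow> f \<in> U (Suc k) \<Longrightarrow> \<phi> e f = 0"
      and fin: "\<And>f. finite {e \<in> B. \<phi> e f \<noteq> 0}"
      and expand: "\<And>f. f \<in> U k \<Longrightarrow> f - (\<Sum>e\<in>{e \<in> B. \<phi> e f \<noteq> 0}. poly_const (\<phi> e f) * e) \<in> U (Suc k)"
      by (rule V.adapted_functionals[OF U_subspace U_subspace U_mono]) blast
    have \<phi>_add: "\<phi> e (f + g) = \<phi> e f + \<phi> e g" and \<phi>_scale: "\<phi> e (poly_const a * f) = a * \<phi> e f" for e f g a
      using Vector_Spaces.linear.axioms(3)[OF lin[of e]] by (auto simp: module_hom_def module_hom_axioms_def)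
    have \<phi>_0: "\<phi> e 0 = 0" for e using \<phi>_scale[of e 0 0] by (simp add: poly_const_simps)
    \<comment> \<open>The coordinate of \<open>F\<close> at the basis element \<open>e\<close> of \<open>U k / U (k + 1)\<close>, a polynomial in \<open>c\<close>.\<close>
    define slice where "slice e F = Poly_Mapping.map (\<phi> e) F" for e and F :: "'k poly_alg poly_alg"
    note slice_mult = map_linear_mult_const(1)[of "\<phi> e" for e, OF \<phi>_add \<phi>_scale, folded slice_def]
    note slice_add = map_linear_mult_const(2)[of "\<phi> e" for e, OF \<phi>_add \<phi>_scale, folded slice_def]
    have slice_0: "slice e 0 = 0" for e by (simp add: slice_def \<phi>_0 map_eq_zero_iff)
    have slice_sum: "slice e (sum f A) = (\<Sum>a\<in>A. slice e (f a))" for e and f :: "nat \<Rightarrow> _" and A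
      by (induction A rule: infinite_finite_induct) (simp_all add: slice_add slice_0)
    have slice_carrier: "slice e F \<in> poly_carrier r" if "F \<in> poly_carrier r" for e F
      unfolding slice_def by (rule carrier_map_coeffs) (rule \<phi>_0, rule that)
    have "\<exists>q. (\<forall>j<i. q j \<in> poly_carrier r) \<and> slice e u = (\<Sum>j<i. z j * q j)" if e: "e \<in> B" for e
    proof -
      have "slice e w = 0"
        using w vanish[OF e] by (intro poly_mapping_eqI) (simp add: slice_def lookup_map_coeffs \<phi>_0 Fil_def)
      moreover have "slice e (?\<iota> (z i) * u) = slice e w + slice e (\<Sum>j<i. ?\<iota> (z j) * b j)"
        by (simp add: w_def flip: slice_add)
      ultimately have "z i * slice e u = (\<Sum>j<i. z j * slice e (b j))"
        by (simp add: slice_sum slice_mult)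
      then have "map (poly_subst L) xs ! i * slice e u = (\<Sum>j<i. map (poly_subst L) xs ! j * slice e (b j))"
        using i by (simp add: z_def)
      then obtain q where "\<And>j. j < i \<Longrightarrow> q j \<in> poly_carrier r" "slice e u = (\<Sum>j<i. map (poly_subst L) xs ! j * q j)"
        using regular_onD[OF reg, of i "slice e u" "\<lambda>j. slice e (b j)"] i u b slice_carrier
        by (auto simp: Fil_def)
      then show ?thesis using i by (auto simp: z_def)
    qed
    then obtain q where q: "\<And>e j. e \<in> B \<Longrightarrow> j < i \<Longrightarrow> q e j \<in> poly_carrier r"
      "\<And>e. e \<in> B \<Longrightarrow> slice e u = (\<Sum>j<i. z j * q e j)"
      by metis
    \<comment> \<open>The basis elements that occur in \<open>u\<close>, a finite set.\<close>
    define B' where "B' = (\<Union>m\<in>mkeys u. {e \<in> B. \<phi> e (mlookup u m) \<noteq> 0})"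
    have B': "finite B'" "B' \<subseteq> B" using fin by (auto simp: B'_def)
    define a where "a j = (\<Sum>e\<in>B'. poly_const e * ?\<iota> (q e j))" for j
    have a: "a j \<in> Fil k" if "j < i" for j
      unfolding a_def
    proof (rule Fil_sum)
      fix e assume "e \<in> B'"
      then have "e \<in> U k" "q e j \<in> poly_carrier r" using B B' q(1) that by auto
      then show "poly_const e * ?\<iota> (q e j) \<in> Fil k"
        using Fil_mult[OF Fil_const Fil_\<iota>, of e k "q e j"] by simp
    qed
    have "(\<Sum>j<i. ?\<iota> (z j) * a j) = (\<Sum>e\<in>B'. \<Sum>j<i. poly_const e * (?\<iota> (z j) * ?\<iota> (q e j)))"
      unfolding a_def sum_distrib_left by (subst sum.swap) (simp add: mult_ac)
    also have "\<dots> = (\<Sum>e\<in>B'. poly_const e * ?\<iota> (slice e u))"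
      using B' q(2) by (intro sum.cong refl) (auto simp: I.hom_sum I.hom_mult sum_distrib_left)
    finally have za: "(\<Sum>j<i. ?\<iota> (z j) * a j) = (\<Sum>e\<in>B'. poly_const e * ?\<iota> (slice e u))" .
    have uz: "u - (\<Sum>j<i. ?\<iota> (z j) * a j) \<in> Fil (Suc k)"
      unfolding Fil_def
    proof (intro CollectI conjI allI)
      show "u - (\<Sum>j<i. ?\<iota> (z j) * a j) \<in> poly_carrier r"
        using u a z_carrier Fil_\<iota> by (auto simp: Fil_def intro!: poly_carrier_diff poly_carrier_sum poly_carrier_mult)
      fix m
      have "mlookup (\<Sum>j<i. ?\<iota> (z j) * a j) m = (\<Sum>e\<in>B'. poly_const (\<phi> e (mlookup u m)) * e)"
        unfolding za lookup_sum
        by (intro sum.cong refl)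
          (simp add: lookup_poly_const_mult lookup_map_coeffs poly_const_simps slice_def \<phi>_0 mult.commute)
      also have "\<dots> = (\<Sum>e\<in>{e \<in> B. \<phi> e (mlookup u m) \<noteq> 0}. poly_const (\<phi> e (mlookup u m)) * e)"
      proof (rule sum.mono_neutral_right[OF B'(1)])
        show "{e \<in> B. \<phi> e (mlookup u m) \<noteq> 0} \<subseteq> B'"
          by (cases "m \<in> mkeys u") (auto simp: B'_def in_keys_iff \<phi>_0)
        show "\<forall>e\<in>B' - {e \<in> B. \<phi> e (mlookup u m) \<noteq> 0}. poly_const (\<phi> e (mlookup u m)) * e = 0"
          using B'(2) by (auto simp: poly_const_simps)
      qed
      finally show "mlookup (u - (\<Sum>j<i. ?\<iota> (z j) * a j)) m \<in> U (Suc k)"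
        using expand[of "mlookup u m"] u by (simp add: lookup_minus Fil_def)
    qed
    have uy: "u - (\<Sum>j<i. y j * a j) = (u - (\<Sum>j<i. ?\<iota> (z j) * a j)) - (\<Sum>j<i. (y j - ?\<iota> (z j)) * a j)"
      by (simp add: left_diff_distrib sum_subtractf)
    have "u - (\<Sum>j<i. y j * a j) \<in> Fil (Suc k)"
      unfolding uy by (rule Fil_diff[OF uz]) (use i a in \<open>auto intro!: Fil_sum yz_mult\<close>)
    then show "\<exists>a. (\<forall>j<i. a j \<in> Fil k) \<and> u - (\<Sum>j<i. y j * a j) \<in> Fil (Suc k)"
      using a by blast
  qed
  interpret C: comm_ring_hom "\<lambda>F :: 'k poly_alg poly_alg. mlookup F 0" by (rule constant_term_hom)
  show ?thesis
    unfolding regular_on_def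
  proof (intro allI ballI impI)
    fix i u b
    assume i: "i < length xs" and u: "u \<in> S" and b: "\<forall>j<i. b j \<in> S"
      and eq: "xs ! i * u = (\<Sum>j<i. xs ! j * b j)"
    have TFil: "translate L f \<in> Fil 0" if "f \<in> S" for f
      using S_translate[OF that] translate_carrier[OF L(1)] by (auto simp: Fil_def U0)
    have "translate L (xs ! i * u) = translate L (\<Sum>j<i. xs ! j * b j)" by (simp add: eq)
    then have eq': "y i * translate L u = (\<Sum>j<i. y j * translate L (b j))"
      by (simp add: y_def T.hom_mult T.hom_sum)
    obtain d where d: "\<forall>m\<in>mkeys u. mdeg m < d" using poly_mapping_bounded_mdeg by blast
    obtain a where a: "\<forall>j<i. a j \<in> Fil 0" "translate L u - (\<Sum>j<i. y j * a j) \<in> Fil d"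
      using filtered_sequence.regular_modulo_filtration[OF filtered i TFil[OF u] _ eq'] TFil b by blast
    \<comment> \<open>Setting \<open>c = 0\<close> is taking the constant term.\<close>
    define c where "c j = mlookup (a j) 0" for j
    have c: "c j \<in> S" if "j < i" for j using a that by (auto simp: c_def Fil_def U0)
    have c0: "mlookup (translate L u - (\<Sum>j<i. y j * a j)) 0 = u - (\<Sum>j<i. xs ! j * c j)"
      by (simp add: C.hom_minus C.hom_sum C.hom_mult y_def c_def translate_constant_term[OF L(2)])
    have "mlookup (translate L u - (\<Sum>j<i. y j * a j)) 0 \<in> U d"
      using a(2) unfolding Fil_def by blast
    then have "u - (\<Sum>j<i. xs ! j * c j) \<in> U d" unfolding c0 .
    then have "trunc d (u - (\<Sum>j<i. xs ! j * c j)) = 0"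
      by (intro trunc_eq_0) (auto simp: U_def)
    then have u_eq: "u = (\<Sum>j<i. trunc d (xs ! j * c j))"
      using trunc_eq_self[of u d] d by (simp add: trunc_minus trunc_sum)
    have "\<exists>e. homogeneous (2 * e) (xs ! j)" if "j < i" for j
    proof -
      have "xs ! j \<in> set xs" using that i by simp
      then obtain d where d: "homogeneous d (xs ! j)"
        using xs(2) by (auto simp: homogeneous_pos_def)
      show ?thesis
      proof (cases "xs ! j = 0")
        case False
        then obtain m where "m \<in> mkeys (xs ! j)" by fastforce
        then have "d = 2 * mdeg m" using d by (auto simp: homogeneous_def)
        then show ?thesis using d by blast
      qed auto
    qed
    then obtain e where e: "\<And>j. j < i \<Longrightarrow> homogeneous (2 * e j) (xs ! j)" by metis
    have "trunc d (xs ! j * c j) = xs ! j * trunc (d - e j) (c j)" if "j < i" for j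
      using e[OF that] by (rule trunc_homogeneous_mult)
    then have "u = (\<Sum>j<i. xs ! j * trunc (d - e j) (c j))"
      using u_eq by simp
    then show "\<exists>a. (\<forall>j<i. a j \<in> S) \<and> u = (\<Sum>j<i. xs ! j * a j)"
      by (intro exI[of _ "\<lambda>j. trunc (d - e j) (c j)"] conjI allI impI S_trunc c)
  qed
qed

section \<open>Pullbacks of polynomial functions\<close>

lemma linear_form_eq_lin_form: "linear_form bs l = lin_form {..<length bs} (\<lambda>j. l (bs ! j))"
  by (simp add: linear_form_def lin_form_def)

lemma lin_form_carrier: "I \<subseteq> {..<n} \<Longrightarrow> lin_form I a \<in> poly_carrier n"
  unfolding lin_form_def
  by (intro poly_carrier_sum poly_carrier_mult poly_carrier_const poly_carrier_var) auto

lemma poly_subst_carrier_all: "(\<And>i. s i \<in> poly_carrier n) \<Longrightarrow> poly_subst s f \<in> poly_carrier n"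
  unfolding poly_subst_def
  by (intro poly_carrier_sum poly_carrier_mult poly_carrier_const poly_carrier_prod poly_carrier_power)

definition restrict_vars :: "nat \<Rightarrow> 'k::comm_ring_1 poly_alg \<Rightarrow> 'k poly_alg" where
  "restrict_vars n = poly_subst (\<lambda>i. if i < n then poly_var i else 0)"

lemma restrict_vars_hom: "comm_ring_hom (restrict_vars n)"
  unfolding restrict_vars_def by (rule poly_subst_hom)

lemma restrict_vars_carrier: "restrict_vars n f \<in> poly_carrier n"
  unfolding restrict_vars_def by (rule poly_subst_carrier_all) (auto intro: poly_carrier_var)

lemma restrict_vars_id: "f \<in> poly_carrier n \<Longrightarrow> restrict_vars n f = f"
  by (rule comm_ring_hom_eq_on_poly_carrier[where h' = "\<lambda>f. f" and n = n])
    (auto simp: restrict_vars_def poly_subst_const poly_subst_var intro: poly_subst_hom comm_ring_homI)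

lemma pullback_hom: "comm_ring_hom (pullback scale bs ds T)"
  and pullback_const: "pullback scale bs ds T (poly_const a) = poly_const a"
  and pullback_var: "pullback scale bs ds T (poly_var i) = linear_form ds (coord scale bs i \<circ> T)"
  and pullback_carrier: "pullback scale bs ds T f \<in> poly_carrier (length ds)"
  and trunc_pullback: "trunc d (pullback scale bs ds T f) = pullback scale bs ds T (trunc d f)"
  unfolding pullback_def
  by (simp_all add: poly_subst_hom poly_subst_const poly_subst_var poly_subst_carrier_all
      linear_form_eq_lin_form lin_form_carrier trunc_poly_subst homogeneous_lin_form)

lemma pullback_add: "pullback scale bs ds T (f + g) = pullback scale bs ds T f + pullback scale bs ds T g"
  and pullback_mult: "pullback scale bs ds T (f * g) = pullback scale bs ds T f * pullback scale bs ds T g"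
  and pullback_sum: "pullback scale bs ds T (sum h A) = (\<Sum>a\<in>A. pullback scale bs ds T (h a))"
proof -
  interpret comm_ring_hom "pullback scale bs ds T" by (rule pullback_hom)
  show "pullback scale bs ds T (f + g) = pullback scale bs ds T f + pullback scale bs ds T g"
    "pullback scale bs ds T (f * g) = pullback scale bs ds T f * pullback scale bs ds T g"
    "pullback scale bs ds T (sum h A) = (\<Sum>a\<in>A. pullback scale bs ds T (h a))"
    by (simp_all add: hom_add hom_mult hom_sum)
qed

text \<open>
  The formula \<open>l (v + c) = l v + l c\<close>.
\<close>

lemma translate_lin_form:
  "translate L (lin_form I a) = poly_const (lin_form I a) + Poly_Mapping.map poly_const (poly_subst L (lin_form I a))"
proof -
  interpret T: comm_ring_hom "translate L" by (rule translate_hom)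
  interpret S: comm_ring_hom "poly_subst L" by (rule poly_subst_hom)
  interpret M: comm_ring_hom "Poly_Mapping.map poly_const :: 'a poly_alg \<Rightarrow> 'a poly_alg poly_alg"
    by (rule map_coeffs_hom[OF poly_const_hom])
  have "Poly_Mapping.map poly_const (poly_const c) = (poly_const (poly_const c) :: 'a poly_alg poly_alg)" for c
    by (rule map_coeffs_const) (simp add: poly_const_simps)
  then show ?thesis
    by (simp add: lin_form_def T.hom_sum T.hom_mult S.hom_sum S.hom_mult M.hom_sum M.hom_mult
        translate_const translate_var poly_subst_const poly_subst_var poly_const_simps
        distrib_left sum.distrib)
qed

definition linear_functional :: "('k::field \<Rightarrow> 'v::ab_group_add \<Rightarrow> 'v) \<Rightarrow> ('v \<Rightarrow> 'k) \<Rightarrow> bool" where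
  "linear_functional scale l \<longleftrightarrow> (\<forall>v w. l (v + w) = l v + l w) \<and> (\<forall>a v. l (scale a v) = a * l v)"

context vector_space
begin

lemma coord_add:
  "basis_list scale W bs \<Longrightarrow> v \<in> W \<Longrightarrow> w \<in> W \<Longrightarrow> coord scale bs i (v + w) = coord scale bs i v + coord scale bs i w"
  and coord_scale:
  "basis_list scale W bs \<Longrightarrow> v \<in> W \<Longrightarrow> coord scale bs i (scale a v) = a * coord scale bs i v"
  by (auto simp: basis_list_def coord_def representation_add representation_scale)

lemma coord_basis:
  "basis_list scale W bs \<Longrightarrow> i < length bs \<Longrightarrow> j < length bs \<Longrightarrow> coord scale bs i (bs ! j) = (if i = j then 1 else 0)"
  by (auto simp: basis_list_def coord_def representation_basis nth_eq_iff_index_eq)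

lemma coord_expand:
  assumes bs: "basis_list scale W bs" and v: "v \<in> W"
  shows "v = (\<Sum>j<length bs. scale (coord scale bs j v) (bs ! j))"
proof -
  have "v = (\<Sum>b\<in>set bs. scale (representation (set bs) v b) b)"
    using sum_representation_eq[of "set bs" v "set bs"] assms by (auto simp: basis_list_def)
  also have "\<dots> = (\<Sum>j<length bs. scale (coord scale bs j v) (bs ! j))"
    using bs by (simp add: basis_list_def coord_def sum.distinct_set_conv_list sum_list_sum_nth atLeast0LessThan)
  finally show ?thesis .
qed

lemma linear_functional_sum:
  assumes "linear_functional scale l"
  shows "l (\<Sum>i\<in>A. f i) = (\<Sum>i\<in>A. l (f i))"
proof -
  have "l 0 = 0" using assms unfolding linear_functional_def by (metis mult_zero_left scale_zero_left)
  then show ?thesis using assms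
    by (induction A rule: infinite_finite_induct) (auto simp: linear_functional_def)
qed

lemma linear_functional_expand:
  assumes "basis_list scale W bs" "linear_functional scale l" "v \<in> W"
  shows "l v = (\<Sum>j<length bs. l (bs ! j) * coord scale bs j v)"
  by (subst (1) coord_expand[OF assms(1,3)])
    (use assms(2) in \<open>simp add: linear_functional_sum linear_functional_def mult.commute\<close>)

lemma linear_functional_coord:
  "basis_list scale UNIV bs \<Longrightarrow> linear_functional scale (coord scale bs i)"
  by (simp add: linear_functional_def coord_add coord_scale)

lemma linear_functional_compose:
  "linear_functional scale l \<Longrightarrow> Vector_Spaces.linear scale scale T \<Longrightarrow> linear_functional scale (l \<circ> T)"
  by (auto simp: linear_functional_def Vector_Spaces.linear_def module_hom_def module_hom_axioms_def)

lemma lin_form_functional: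
  assumes bs: "basis_list scale UNIV bs"
  obtains l where "linear_functional scale l" "lin_form {..<length bs} a = linear_form bs l"
proof
  define l where "l v = (\<Sum>i<length bs. a i * coord scale bs i v)" for v
  show "linear_functional scale l"
    using linear_functional_coord[OF bs]
    by (auto simp: linear_functional_def l_def distrib_left sum.distrib sum_distrib_left mult_ac)
  have "l (bs ! j) = a j" if "j < length bs" for j
    using that by (simp add: l_def coord_basis[OF bs] if_distrib[of "(*) _"] cong: if_cong)
  then show "lin_form {..<length bs} a = linear_form bs l"
    by (simp add: linear_form_eq_lin_form lin_form_def)
qed

lemma pullback_linear_form:
  assumes bs: "basis_list scale UNIV bs" and l: "linear_functional scale l"
  shows "pullback scale bs ds T (linear_form bs l) = linear_form ds (l \<circ> T)"
proof -
  interpret comm_ring_hom "pullback scale bs ds T" by (rule pullback_hom)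
  have "pullback scale bs ds T (linear_form bs l)
      = (\<Sum>k<length ds. poly_const (\<Sum>j<length bs. l (bs ! j) * coord scale bs j (T (ds ! k))) * poly_var k)"
    unfolding linear_form_def[of bs] linear_form_def[of ds] hom_sum hom_mult pullback_const pullback_var sum_distrib_left
    by (subst sum.swap) (simp add: poly_const_simps sum_distrib_left sum_distrib_right mult_ac)
  then show ?thesis
    by (simp add: linear_form_def flip: linear_functional_expand[OF bs l])
qed

lemma pullback_compose:
  assumes bs: "basis_list scale UNIV bs" and T: "Vector_Spaces.linear scale scale T"
  shows "pullback scale bs ds S (pullback scale bs bs T f) = pullback scale bs ds (T \<circ> S) f"
proof (rule comm_ring_hom_eq_poly_alg[where h' = "pullback scale bs ds (T \<circ> S)"
      and h = "\<lambda>f. pullback scale bs ds S (pullback scale bs bs T f)"])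
  show "comm_ring_hom (\<lambda>f. pullback scale bs ds S (pullback scale bs bs T f))"
    by (rule comm_ring_hom_comp[OF pullback_hom pullback_hom])
  show "pullback scale bs ds S (pullback scale bs bs T (poly_var i)) = pullback scale bs ds (T \<circ> S) (poly_var i)" for i
    by (simp add: pullback_var pullback_linear_form[OF bs]
        linear_functional_compose[OF linear_functional_coord[OF bs] T] comp_assoc)
qed (simp_all add: pullback_hom pullback_const)

text \<open>
  The formula \<open>T (v + c) = T v + c\<close> for \<open>c \<in> C\<close>, seen through polynomial functions.
\<close>

lemma translate_pullback:
  assumes bs: "basis_list scale UNIV bs" and T: "Vector_Spaces.linear scale scale T"
    and fixed: "\<And>c. c \<in> set cs \<Longrightarrow> T c = c"
  defines "L \<equiv> \<lambda>i. linear_form cs (coord scale bs i)"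
  shows "translate L (pullback scale bs bs T f) = Poly_Mapping.map (pullback scale bs bs T) (translate L f)"
proof (rule comm_ring_hom_eq_poly_alg[where h = "\<lambda>f. translate L (pullback scale bs bs T f)"
      and h' = "\<lambda>f. Poly_Mapping.map (pullback scale bs bs T) (translate L f)"])
  interpret P: comm_ring_hom "pullback scale bs bs T" by (rule pullback_hom)
  interpret M: comm_ring_hom "Poly_Mapping.map (pullback scale bs bs T) :: 'a poly_alg poly_alg \<Rightarrow> 'a poly_alg poly_alg"
    by (rule map_coeffs_hom[OF pullback_hom])
  show "comm_ring_hom (\<lambda>f. translate L (pullback scale bs bs T f))"
    by (rule comm_ring_hom_comp[OF translate_hom pullback_hom])
  show "comm_ring_hom (\<lambda>f. Poly_Mapping.map (pullback scale bs bs T) (translate L f))"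
    by (rule comm_ring_hom_comp[OF map_coeffs_hom[OF pullback_hom] translate_hom])
  show "translate L (pullback scale bs bs T (poly_const a)) =
      Poly_Mapping.map (pullback scale bs bs T) (translate L (poly_const a))" for a
    by (simp add: pullback_const translate_const map_coeffs_const)
  fix i
  have res: "poly_subst L = pullback scale bs cs id" by (simp add: pullback_def L_def)
  have "translate L (pullback scale bs bs T (poly_var i)) =
      poly_const (linear_form bs (coord scale bs i \<circ> T)) +
      Poly_Mapping.map poly_const (pullback scale bs cs id (linear_form bs (coord scale bs i \<circ> T)))"
    unfolding pullback_var by (simp add: linear_form_eq_lin_form[of bs] translate_lin_form res)
  also have "pullback scale bs cs id (linear_form bs (coord scale bs i \<circ> T)) = L i"
    by (simp add: pullback_linear_form[OF bs] linear_functional_compose[OF linear_functional_coord[OF bs] T])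
      (simp add: L_def linear_form_def fixed)
  also have "poly_const (linear_form bs (coord scale bs i \<circ> T)) + Poly_Mapping.map poly_const (L i) =
      Poly_Mapping.map (pullback scale bs bs T) (translate L (poly_var i))"
  proof -
    have "Poly_Mapping.map (pullback scale bs bs T) (Poly_Mapping.map poly_const (L i)) = Poly_Mapping.map poly_const (L i)"
      by (intro poly_mapping_eqI) (simp add: lookup_map_coeffs poly_const_simps pullback_const)
    then show ?thesis
      by (simp add: translate_var M.hom_add map_coeffs_const pullback_var)
  qed
  finally show "translate L (pullback scale bs bs T (poly_var i)) =
      Poly_Mapping.map (pullback scale bs bs T) (translate L (poly_var i))" .
qed

end

text \<open>
  The projection \<^const>\<open>restrict_vars\<close> detects membership and is a ring homomorphism, so only variables
  have to be considered.
\<close>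

lemma translate_coeff_carrier:
  assumes f: "f \<in> poly_carrier n"
  shows "mlookup (translate L f) m \<in> poly_carrier n"
proof -
  interpret M: comm_ring_hom "Poly_Mapping.map (restrict_vars n) :: 'a poly_alg poly_alg \<Rightarrow> 'a poly_alg poly_alg"
    by (rule map_coeffs_hom[OF restrict_vars_hom])
  have [simp]: "restrict_vars n (0 :: 'a poly_alg) = 0" by (simp add: restrict_vars_id)
  have "Poly_Mapping.map (restrict_vars n) (translate L f) = translate L f"
  proof (rule comm_ring_hom_eq_on_poly_carrier[where h = "\<lambda>f. Poly_Mapping.map (restrict_vars n) (translate L f)"
        and h' = "translate L", OF _ translate_hom _ _ f])
    show "comm_ring_hom (\<lambda>f. Poly_Mapping.map (restrict_vars n) (translate L f))"
      by (rule comm_ring_hom_comp[OF map_coeffs_hom[OF restrict_vars_hom] translate_hom])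
    show "Poly_Mapping.map (restrict_vars n) (translate L (poly_const a)) = translate L (poly_const a)" for a
      by (simp add: translate_const map_coeffs_const restrict_vars_id)
    have "Poly_Mapping.map (restrict_vars n) (Poly_Mapping.map poly_const (L i)) = Poly_Mapping.map poly_const (L i)" for i
      by (intro poly_mapping_eqI) (simp add: lookup_map_coeffs poly_const_simps restrict_vars_id)
    then show "Poly_Mapping.map (restrict_vars n) (translate L (poly_var i)) = translate L (poly_var i)" if "i < n" for i
      using that by (simp add: translate_var M.hom_add map_coeffs_const restrict_vars_id poly_carrier_var)
  qed
  then have "mlookup (translate L f) m = restrict_vars n (mlookup (translate L f) m)"
    by (metis lookup_map_coeffs \<open>restrict_vars n 0 = 0\<close>)
  then show ?thesis using restrict_vars_carrier by metis
qed

section \<open>Invariants\<close>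

definition invariants ::
  "('k::field \<Rightarrow> 'v::ab_group_add \<Rightarrow> 'v) \<Rightarrow> 'v list \<Rightarrow> ('g \<Rightarrow> 'v \<Rightarrow> 'v) \<Rightarrow> 'g set \<Rightarrow> 'k poly_alg set" where
  "invariants scale bs \<rho> H = {f \<in> poly_carrier (length bs). \<forall>g\<in>H. pullback scale bs bs (\<rho> g) f = f}"

lemma carrier_invariant_ring:
  assumes "group G"
  shows "carrier (invariant_ring scale bs G \<rho>) = invariants scale bs \<rho> (carrier G)"
proof -
  interpret group G by fact
  have "(\<forall>g\<in>carrier G. Q (inv\<^bsub>G\<^esub> g)) \<longleftrightarrow> (\<forall>g\<in>carrier G. Q g)" for Q
    by (metis inv_closed inv_inv)
  from this[of "\<lambda>g. pullback scale bs bs (\<rho> g) f = f" for f]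
  show ?thesis by (simp add: invariant_ring_def invariants_def)
qed

lemma
  shows invariants_const: "poly_const a \<in> invariants scale bs \<rho> H"
    and invariants_add: "f \<in> invariants scale bs \<rho> H \<Longrightarrow> g \<in> invariants scale bs \<rho> H \<Longrightarrow> f + g \<in> invariants scale bs \<rho> H"
    and invariants_mult: "f \<in> invariants scale bs \<rho> H \<Longrightarrow> g \<in> invariants scale bs \<rho> H \<Longrightarrow> f * g \<in> invariants scale bs \<rho> H"
    and invariants_trunc: "f \<in> invariants scale bs \<rho> H \<Longrightarrow> trunc d f \<in> invariants scale bs \<rho> H"
proof -
  show "poly_const a \<in> invariants scale bs \<rho> H" by (simp add: invariants_def pullback_const)
  show "f \<in> invariants scale bs \<rho> H \<Longrightarrow> g \<in> invariants scale bs \<rho> H \<Longrightarrow> f + g \<in> invariants scale bs \<rho> H"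
    by (auto simp: invariants_def poly_carrier_add
        pullback_add)
  show "f \<in> invariants scale bs \<rho> H \<Longrightarrow> g \<in> invariants scale bs \<rho> H \<Longrightarrow> f * g \<in> invariants scale bs \<rho> H"
    by (auto simp: invariants_def pullback_mult poly_carrier_mult)
  assume f: "f \<in> invariants scale bs \<rho> H"
  have "trunc d f \<in> poly_carrier (length bs)"
    using f keys_trunc unfolding invariants_def poly_carrier_def by blast
  then show "trunc d f \<in> invariants scale bs \<rho> H"
    using f by (auto simp: invariants_def simp flip: trunc_pullback)
qed

text \<open>
  Translation by a vector that \<open>H\<close> fixes commutes with the action of \<open>H\<close>. Hence the invariants of \<open>H\<close>
  are stable under translation by the span of \<open>cs\<close>.
\<close>

lemma (in vector_space) regular_on_invariants_of_fixed:
  assumes bs: "basis_list scale UNIV bs"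
    and lin: "\<And>g. g \<in> H \<Longrightarrow> Vector_Spaces.linear scale scale (\<rho> g)"
    and cs: "set cs \<subseteq> fixed_space \<rho> H"
    and xs: "set xs \<subseteq> invariants scale bs \<rho> H" "\<And>x. x \<in> set xs \<Longrightarrow> homogeneous_pos x"
    and reg: "regular_on (poly_carrier (length cs)) (map (pullback scale bs cs id) xs)"
  shows "regular_on (invariants scale bs \<rho> H) xs"
proof (rule regular_on_translation_stable[where L = "\<lambda>i. linear_form cs (coord scale bs i)" and r = "length cs"])
  let ?L = "\<lambda>i. linear_form cs (coord scale bs i)"
  show "?L i \<in> poly_carrier (length cs)" for i
    by (simp add: linear_form_eq_lin_form lin_form_carrier)
  show "mlookup (?L i) 0 = 0" for i
  proof -
    interpret comm_ring_hom "\<lambda>f :: 'a poly_alg. mlookup f 0" by (rule constant_term_hom)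
    show ?thesis by (simp add: linear_form_def hom_sum hom_mult constant_term_var)
  qed
  show "mlookup (translate ?L f) m \<in> invariants scale bs \<rho> H" if f: "f \<in> invariants scale bs \<rho> H" for f m
    unfolding invariants_def
  proof (intro CollectI conjI ballI)
    show "mlookup (translate ?L f) m \<in> poly_carrier (length bs)"
      using f by (intro translate_coeff_carrier) (simp add: invariants_def)
    fix g assume g: "g \<in> H"
    have "pullback scale bs bs (\<rho> g) (mlookup (translate ?L f) m) =
        mlookup (Poly_Mapping.map (pullback scale bs bs (\<rho> g)) (translate ?L f)) m"
      using pullback_const[of scale bs bs "\<rho> g" 0] by (simp add: lookup_map_coeffs poly_const_simps)
    also have "\<dots> = mlookup (translate ?L (pullback scale bs bs (\<rho> g) f)) m"
      using cs g by (subst translate_pullback[OF bs lin[OF g]]) (auto simp: fixed_space_def)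
    also have "\<dots> = mlookup (translate ?L f) m" using f g by (simp add: invariants_def)
    finally show "pullback scale bs bs (\<rho> g) (mlookup (translate ?L f) m) = mlookup (translate ?L f) m" .
  qed
  show "regular_on (poly_carrier (length cs)) (map (poly_subst ?L) xs)"
    using reg by (simp add: pullback_def o_def)
qed (use xs in \<open>auto intro: invariants_const invariants_add invariants_mult invariants_trunc\<close>)

section \<open>Transfer\<close>

lemma linear_of_GL: "\<rho> \<in> hom G (GL scale) \<Longrightarrow> g \<in> carrier G \<Longrightarrow> Vector_Spaces.linear scale scale (\<rho> g)"
  and bij_of_GL: "\<rho> \<in> hom G (GL scale) \<Longrightarrow> g \<in> carrier G \<Longrightarrow> bij (\<rho> g)"
  and mult_of_GL: "\<rho> \<in> hom G (GL scale) \<Longrightarrow> g \<in> carrier G \<Longrightarrow> h \<in> carrier G \<Longrightarrow> \<rho> (g \<otimes>\<^bsub>G\<^esub> h) = \<rho> g \<circ> \<rho> h"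
  by (auto simp: hom_def GL_def)

lemma rcosets_translate:
  fixes G (structure)
  assumes "group G" "subgroup P G" "k \<in> carrier G"
  shows "bij_betw (\<lambda>X. X #> k) (rcosets P) (rcosets P)"
proof -
  interpret group G by fact
  interpret P: subgroup P G by fact
  have closed: "X #> h \<in> rcosets P" if "X \<in> rcosets P" "h \<in> carrier G" for X h
    using that by (auto simp: RCOSETS_def coset_mult_assoc P.subset)
  have undo: "(X #> h) #> h' = X" if "X \<in> rcosets P" "h \<in> carrier G" "h' \<in> carrier G" "h \<otimes> h' = \<one>" for X h h'
    using that by (auto simp: RCOSETS_def coset_mult_assoc P.subset m_assoc)
  show ?thesis
    by (rule bij_betwI[where g = "\<lambda>X. X #> inv k"]) (use assms(3) in \<open>simp_all add: closed undo\<close>)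
qed

text \<open>
  The sum over the translates of a \<open>P\<close>-invariant, one for each coset of \<open>P\<close>, is \<open>G\<close>-invariant and linear
  over the \<open>G\<close>-invariants. Divided by the index of \<open>P\<close>, it is a projection onto the \<open>G\<close>-invariants, and
  it maps a combination with \<open>P\<close>-invariant coefficients to one with \<open>G\<close>-invariant coefficients. The
  cosets are right cosets because pullback reverses the order of composition.
\<close>

lemma (in vector_space) regular_on_transfer:
  fixes G (structure)
  assumes bs: "basis_list scale UNIV bs" and G: "group G" and P: "subgroup P G"
    and rep: "\<rho> \<in> hom G (GL scale)" and index: "of_nat (card (rcosets P)) \<noteq> (0 :: 'a)"
    and xs: "set xs \<subseteq> invariants scale bs \<rho> (carrier G)"
    and reg: "regular_on (invariants scale bs \<rho> P) xs"
  shows "regular_on (invariants scale bs \<rho> (carrier G)) xs"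
proof -
  interpret group G by fact
  interpret P: subgroup P G by fact
  let ?act = "\<lambda>g. pullback scale bs bs (\<rho> g)"
  note act_comp = pullback_compose[OF bs linear_of_GL[OF rep]]
  have act_mult: "?act (g \<otimes> h) f = ?act h (?act g f)" if "g \<in> carrier G" "h \<in> carrier G" for g h f
    using that by (simp add: mult_of_GL[OF rep] act_comp)
  define rep_of where "rep_of X = (SOME g. g \<in> X)" for X :: "'c set"
  have act_coset: "?act g f = ?act g' f"
    if f: "f \<in> invariants scale bs \<rho> P" and X: "X \<in> rcosets P" and g: "g \<in> X" "g' \<in> X" for f X g g'
  proof -
    obtain a where a: "a \<in> carrier G" "X = P #> a" using X by (auto simp: RCOSETS_def)
    have "?act g f = ?act a f" if "g \<in> X" for g
    proof -
      have "\<exists>h\<in>P. g = h \<otimes> a" using that a by (auto simp: r_coset_def)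
      then obtain h where "h \<in> P" "g = h \<otimes> a" by blast
      then show ?thesis
        using act_mult[of h a f] a f P.subset by (auto simp: invariants_def)
    qed
    then show ?thesis using g by simp
  qed
  have coset_nonempty: "rep_of X \<in> X" "X \<subseteq> carrier G" if "X \<in> rcosets P" for X
  proof -
    have "\<exists>a\<in>carrier G. X = P #> a" using that by (auto simp: RCOSETS_def)
    then obtain a where a: "a \<in> carrier G" "X = P #> a" by blast
    then have "a \<in> X" using rcos_self[OF _ P] by simp
    then show "rep_of X \<in> X" unfolding rep_of_def by (rule someI)
    show "X \<subseteq> carrier G" using a P.subset by (auto simp: r_coset_def)
  qed
  define tr where "tr f = (\<Sum>X\<in>rcosets P. ?act (rep_of X) f)" for f
  have tr_invariant: "tr f \<in> invariants scale bs \<rho> (carrier G)" if f: "f \<in> invariants scale bs \<rho> P" for f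
    unfolding invariants_def
  proof (intro CollectI conjI ballI)
    show "tr f \<in> poly_carrier (length bs)"
      unfolding tr_def by (intro poly_carrier_sum pullback_carrier)
    fix k assume k: "k \<in> carrier G"
    have "?act k (tr f) = (\<Sum>X\<in>rcosets P. ?act (rep_of X \<otimes> k) f)"
      unfolding tr_def pullback_sum
      by (intro sum.cong refl act_mult[symmetric] k) (use coset_nonempty in auto)
    also have "\<dots> = (\<Sum>X\<in>rcosets P. ?act (rep_of (X #> k)) f)"
    proof (intro sum.cong refl act_coset[OF f])
      fix X assume X: "X \<in> rcosets P"
      show Xk: "X #> k \<in> rcosets P"
        using bij_betwE[OF rcosets_translate[OF G P k]] X by blast
      show "rep_of X \<otimes> k \<in> X #> k" using coset_nonempty[OF X] by (auto simp: r_coset_def)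
      show "rep_of (X #> k) \<in> X #> k" using coset_nonempty[OF Xk] by simp
    qed
    also have "\<dots> = tr f"
      unfolding tr_def by (rule sum.reindex_bij_betw[OF rcosets_translate[OF G P k]])
    finally show "?act k (tr f) = tr f" .
  qed
  have tr_mult: "tr (x * f) = x * tr f" if "x \<in> invariants scale bs \<rho> (carrier G)" for x f
    unfolding tr_def sum_distrib_left
    by (intro sum.cong refl) (use that coset_nonempty in \<open>auto simp: invariants_def pullback_mult\<close>)
  have tr_sum: "tr (sum f A) = (\<Sum>a\<in>A. tr (f a))" for f :: "nat \<Rightarrow> _" and A
    unfolding tr_def pullback_sum by (rule sum.swap)
  let ?N = "of_nat (card (rcosets P)) :: 'a"
  have tr_self: "tr f = poly_const ?N * f" if "f \<in> invariants scale bs \<rho> (carrier G)" for f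
  proof -
    have "tr f = (\<Sum>X\<in>rcosets P. f)"
      unfolding tr_def
      by (intro sum.cong refl) (use that coset_nonempty in \<open>auto simp: invariants_def\<close>)
    moreover have "poly_const (of_nat n :: 'a) = of_nat n" for n
      by (simp add: poly_const_def)
    ultimately show ?thesis by simp
  qed
  have sub: "invariants scale bs \<rho> (carrier G) \<subseteq> invariants scale bs \<rho> P"
    using P.subset by (auto simp: invariants_def)
  show ?thesis
    unfolding regular_on_def
  proof (intro allI ballI impI)
    fix i u b
    assume i: "i < length xs" and u: "u \<in> invariants scale bs \<rho> (carrier G)"
      and b: "\<forall>j<i. b j \<in> invariants scale bs \<rho> (carrier G)" and eq: "xs ! i * u = (\<Sum>j<i. xs ! j * b j)"
    obtain a where a: "\<And>j. j < i \<Longrightarrow> a j \<in> invariants scale bs \<rho> P" "u = (\<Sum>j<i. xs ! j * a j)"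
      using regular_onD[OF reg i _ _ eq] u b sub by blast
    have "xs ! j \<in> invariants scale bs \<rho> (carrier G)" if "j < i" for j
      using that i xs by auto
    then have "poly_const ?N * u = (\<Sum>j<i. xs ! j * tr (a j))"
      using a(2) tr_self[OF u] by (simp add: tr_sum tr_mult)
    then have "poly_const (1 / ?N) * (poly_const ?N * u) = (\<Sum>j<i. xs ! j * (poly_const (1 / ?N) * tr (a j)))"
      by (simp add: sum_distrib_left mult_ac)
    then have "u = (\<Sum>j<i. xs ! j * (poly_const (1 / ?N) * tr (a j)))"
      using index by (simp add: poly_const_simps flip: mult.assoc poly_const_simps(4))
    then show "\<exists>a. (\<forall>j<i. a j \<in> invariants scale bs \<rho> (carrier G)) \<and> u = (\<Sum>j<i. xs ! j * a j)"
      using a(1) tr_invariant invariants_mult invariants_const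
      by (intro exI[of _ "\<lambda>j. poly_const (1 / ?N) * tr (a j)"]) blast
  qed
qed

lemma sylow_index:
  fixes G :: "('g, 'z) monoid_scheme"
  assumes G: "group G" "finite (carrier G)" and P: "sylow_subgroup CARD('p::prime_card) P G"
  shows "of_nat (card (rcosets\<^bsub>G\<^esub> P)) \<noteq> (0 :: 'p mod_ring)"
proof
  interpret group G by fact
  let ?p = "CARD('p)"
  have prime: "prime ?p" by (rule prime_card)
  assume "of_nat (card (rcosets\<^bsub>G\<^esub> P)) = (0 :: 'p mod_ring)"
  then have "?p dvd card (rcosets\<^bsub>G\<^esub> P)" by (rule of_nat_0_mod_ring_dvd)
  moreover have "card P = ?p ^ multiplicity ?p (Coset.order G)" "subgroup P G"
    using P by (auto simp: sylow_subgroup_def)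
  moreover have "card (rcosets\<^bsub>G\<^esub> P) * card P = Coset.order G"
    by (rule lagrange[OF \<open>subgroup P G\<close>])
  ultimately have dvd: "?p ^ Suc (multiplicity ?p (Coset.order G)) dvd Coset.order G"
    by (metis mult_dvd_mono dvd_refl power_Suc)
  have "Coset.order G \<noteq> 0" using order_gt_0_iff_finite G(2) by simp
  then have "Suc (multiplicity ?p (Coset.order G)) \<le> multiplicity ?p (Coset.order G)"
    using prime_gt_1_nat[OF prime] dvd by (intro multiplicity_geI) auto
  then show False by simp
qed

section \<open>Dickson invariants of a representation\<close>

context vector_space
begin

lemma extend_functional:
  assumes cs: "basis_list scale W cs"
  obtains l where "linear_functional scale l" "\<And>j. j < length cs \<Longrightarrow> l (cs ! j) = a j"
proof -
  interpret vector_space_pair scale "(*) :: 'a \<Rightarrow> 'a \<Rightarrow> 'a"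
    by unfold_locales (auto simp: algebra_simps)
  have ind: "independent (set cs)" "distinct cs" using cs by (auto simp: basis_list_def)
  obtain l where l: "Vector_Spaces.linear scale (*) l" "\<forall>x\<in>set cs. l x = a (the_inv_into {..<length cs} ((!) cs) x)"
    using linear_independent_extend[OF ind(1), of "\<lambda>x. a (the_inv_into {..<length cs} ((!) cs) x)"] by blast
  have "inj_on ((!) cs) {..<length cs}" using ind(2) by (simp add: inj_on_nth)
  then have "l (cs ! j) = a j" if "j < length cs" for j
    using l(2) that by (simp add: the_inv_into_f_f)
  moreover have "linear_functional scale l"
    using l(1) by (auto simp: linear_functional_def Vector_Spaces.linear_def module_hom_def module_hom_axioms_def)
  ultimately show ?thesis using that by blast
qed

lemma pullback_lin_forms_restrict:
  assumes bs: "basis_list scale UNIV bs" and cs: "basis_list scale W cs"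
  shows "pullback scale bs cs id ` lin_forms {..<length bs} = lin_forms {..<length cs}"
proof (intro equalityI subsetI)
  fix x assume "x \<in> pullback scale bs cs id ` lin_forms {..<length bs}"
  then obtain a where a: "x = pullback scale bs cs id (lin_form {..<length bs} a)"
    by (auto simp: lin_forms_def)
  obtain l where "linear_functional scale l" "lin_form {..<length bs} a = linear_form bs l"
    by (rule lin_form_functional[OF bs])
  then show "x \<in> lin_forms {..<length cs}"
    by (simp add: a pullback_linear_form[OF bs]) (simp add: linear_form_eq_lin_form lin_forms_def)
next
  fix x :: "'a poly_alg" assume "x \<in> lin_forms {..<length cs}"
  then obtain a where a: "x = lin_form {..<length cs} a" by (auto simp: lin_forms_def)
  obtain l where l: "linear_functional scale l" "\<And>j. j < length cs \<Longrightarrow> l (cs ! j) = a j"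
    by (rule extend_functional[OF cs, of a]) blast
  have "x = pullback scale bs cs id (linear_form bs l)"
    by (simp add: pullback_linear_form[OF bs l(1)]) (simp add: a linear_form_eq_lin_form lin_form_def l(2))
  then show "x \<in> pullback scale bs cs id ` lin_forms {..<length bs}"
    by (auto simp: linear_form_eq_lin_form lin_forms_def)
qed

lemma pullback_lin_forms_bij:
  assumes bs: "basis_list scale UNIV bs" and T: "Vector_Spaces.linear scale scale T" "bij T"
  shows "pullback scale bs bs T ` lin_forms {..<length bs} = lin_forms {..<length bs}"
proof (intro equalityI subsetI)
  fix x assume "x \<in> pullback scale bs bs T ` lin_forms {..<length bs}"
  then obtain a where a: "x = pullback scale bs bs T (lin_form {..<length bs} a)"
    by (auto simp: lin_forms_def)
  obtain l where "linear_functional scale l" "lin_form {..<length bs} a = linear_form bs l"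
    by (rule lin_form_functional[OF bs])
  then show "x \<in> lin_forms {..<length bs}"
    by (simp add: a pullback_linear_form[OF bs]) (simp add: linear_form_eq_lin_form lin_forms_def)
next
  have T_add: "T (v + w) = T v + T w" and T_scale: "T (scale c v) = scale c (T v)" for v w c
    using T(1) by (auto simp: Vector_Spaces.linear_def module_hom_def module_hom_axioms_def)
  have inv_add: "inv_into UNIV T (v + w) = inv_into UNIV T v + inv_into UNIV T w" for v w
    using T(2) by (intro inv_f_eq) (auto simp: T_add bij_def surj_f_inv_f)
  have inv_scale: "inv_into UNIV T (scale c v) = scale c (inv_into UNIV T v)" for c v
    using T(2) by (intro inv_f_eq) (auto simp: T_scale bij_def surj_f_inv_f)
  fix x :: "'a poly_alg" assume "x \<in> lin_forms {..<length bs}"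
  then obtain a where a: "x = lin_form {..<length bs} a" by (auto simp: lin_forms_def)
  obtain l where l: "linear_functional scale l" "lin_form {..<length bs} a = linear_form bs l"
    by (rule lin_form_functional[OF bs])
  have l': "linear_functional scale (l \<circ> inv_into UNIV T)"
    using l(1) by (simp add: linear_functional_def inv_add inv_scale)
  have "x = pullback scale bs bs T (linear_form bs (l \<circ> inv_into UNIV T))"
    using T(2) by (simp add: pullback_linear_form[OF bs l'] comp_assoc a l(2) bij_def)
  then show "x \<in> pullback scale bs bs T ` lin_forms {..<length bs}"
    by (auto simp: linear_form_eq_lin_form lin_forms_def)
qed

end

text \<open>
  A surjection of the finite set \<open>L\<close> onto itself permutes the factors.
\<close>

lemma coeff_dickson_poly_stable:
  fixes L :: "'k::comm_ring_1 poly_alg set"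
  assumes s: "comm_ring_hom s" "s ` L = L" and L: "finite L" "0 \<in> L"
    "\<And>x y. x \<in> L \<Longrightarrow> y \<in> L \<Longrightarrow> x + y \<in> L" "\<And>x y. x \<in> L \<Longrightarrow> y \<in> L \<Longrightarrow> x - y \<in> L"
  shows "s (coeff (dickson_poly L q) e) = coeff (dickson_poly L q) e"
proof -
  interpret comm_ring_hom s by fact
  have "card L = card L * card {x \<in> L. s x = 0}"
    using prod_over_fibres(2)[OF L(1,3,4) hom_add] s(2) by simp
  moreover have "card L \<noteq> 0" using L by auto
  ultimately have "card {x \<in> L. s x = 0} = 1" by simp
  then show ?thesis using coeff_dickson_poly_image[OF s(1) L(1,3,4), of q e] s(2) by simp
qed

text \<open>
  The coefficients of the product of all \<open>X - l\<close>, for the linear forms \<open>l\<close> on \<open>V\<close>, are invariant since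
  every linear automorphism permutes the forms. Each form on \<open>W\<close> is the restriction of \<open>q\<close> forms on \<open>V\<close>.
  Hence the coefficients at \<open>X\<close> to the powers \<open>q p\<^sup>i\<close> restrict to the Dickson sequence of \<open>W\<close> with
  exponent \<open>q\<close>.
\<close>

lemma dickson_invariants:
  fixes scale :: "'k::{finite, field} \<Rightarrow> 'v::ab_group_add \<Rightarrow> 'v" and \<rho> :: "'g \<Rightarrow> 'v \<Rightarrow> 'v"
  assumes V: "vector_space scale"
    and bs: "basis_list scale UNIV bs" and cs: "basis_list scale W cs"
    and rep: "\<And>g. g \<in> H \<Longrightarrow> Vector_Spaces.linear scale scale (\<rho> g)" "\<And>g. g \<in> H \<Longrightarrow> bij (\<rho> g)"
  obtains xs where "length xs = length cs" "set xs \<subseteq> invariants scale bs \<rho> H"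
    "\<And>x. x \<in> set xs \<Longrightarrow> homogeneous_pos x"
    "regular_on (poly_carrier (length cs)) (map (pullback scale bs cs id) xs)"
proof -
  interpret vector_space scale by fact
  let ?L = "\<lambda>n. lin_forms {..<n} :: 'k poly_alg set"
  let ?n = "length bs" and ?r = "length cs" and ?p = "CARD('k)"
  let ?res = "pullback scale bs cs id"
  note fin = finite_lin_forms[OF finite_lessThan, where 'k = 'k]
  interpret res: comm_ring_hom ?res by (rule pullback_hom)
  define q where "q = card {l \<in> ?L ?n. ?res l = 0}"
  define x where "x i = coeff (dickson_poly (?L ?n) 1) (q * ?p ^ i)" for i
  note image = pullback_lin_forms_restrict[OF bs cs]
  have card: "?p ^ ?n = ?p ^ ?r * q"
    using prod_over_fibres(2)[OF fin[of ?n] lin_forms_add lin_forms_diff res.hom_add]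
    unfolding image by (simp only: q_def[symmetric] card_lin_forms[OF finite_lessThan] card_lessThan)
  then have q: "q > 0" by (cases q) auto
  have res_x: "?res (x i) = coeff (dickson_poly (?L ?r) q) (q * ?p ^ i)" for i
    using coeff_dickson_poly_image[where s = ?res and L = "?L ?n" and q = 1,
        OF pullback_hom fin lin_forms_add lin_forms_diff]
    unfolding image x_def q_def by simp
  have stable: "s (x i) = x i" if "comm_ring_hom s" "s ` ?L ?n = ?L ?n" for s i
    unfolding x_def
    by (rule coeff_dickson_poly_stable[OF that fin zero_in_lin_forms lin_forms_add lin_forms_diff])
  have "restrict_vars ?n l = l" if "l \<in> ?L ?n" for l
    using that by (auto simp: lin_forms_def intro: restrict_vars_id lin_form_carrier)
  then have "restrict_vars ?n ` ?L ?n = ?L ?n" by force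
  then have x_carrier: "x i \<in> poly_carrier ?n" for i
    using stable[OF restrict_vars_hom] restrict_vars_carrier by metis
  have x_hom: "homogeneous_pos (x i)" if "i < ?r" for i
  proof -
    have "card {0, 1 :: 'k} \<le> ?p" by (rule card_mono) auto
    then have "q * ?p ^ i < q * ?p ^ ?r"
      using q that by (auto intro: power_strict_increasing)
    then have pos: "0 < 2 * (card (?L ?n) - q * ?p ^ i)"
      by (simp add: card_lin_forms card mult.commute)
    have "homogeneous (2 * (card (?L ?n) - q * ?p ^ i)) (x i)"
    proof -
      have "homogeneous 2 l" if "l \<in> ?L ?n" for l
        using that by (auto simp: lin_forms_def homogeneous_lin_form)
      then show ?thesis
        unfolding x_def using homogeneous_coeff_dickson_poly[OF fin[of ?n]] by blast
    qed
    then show ?thesis unfolding homogeneous_pos_def using pos by blast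
  qed
  show ?thesis
  proof (rule that[of "map x [0..<?r]"])
    show "set (map x [0..<?r]) \<subseteq> invariants scale bs \<rho> H"
    proof -
      have "pullback scale bs bs (\<rho> g) (x i) = x i" if "g \<in> H" for g i
        by (rule stable[OF pullback_hom pullback_lin_forms_bij[OF bs rep(1)[OF that] rep(2)[OF that]]])
      then show ?thesis using x_carrier by (auto simp: invariants_def)
    qed
    have "map ?res (map x [0..<?r]) = dickson_seq TYPE('k) {..<?r} q"
      by (simp add: dickson_seq_def res_x)
    then have "regular_on UNIV (map ?res (map x [0..<?r]))"
      using regular_dickson_seq[of "{..<?r}" q, where 'k = 'k] by (simp add: regular_on_UNIV)
    then show "regular_on (poly_carrier ?r) (map ?res (map x [0..<?r]))"
      by (rule regular_on_retract[OF restrict_vars_hom restrict_vars_id restrict_vars_carrier, rotated 2])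
        (auto simp: pullback_carrier)
  qed (use x_hom in auto)
qed

section \<open>The bar differential and the cup product\<close>

text \<open>
  The differential without the condition that the letters lie in \<open>C\<close>. It is local enough for induction
  on lists.
\<close>

definition bar_diff :: "('v::ab_group_add list \<Rightarrow> 'a::comm_ring_1) \<Rightarrow> 'v list \<Rightarrow> 'a" where
  "bar_diff h l = (if l = [] then 0 else \<Sum>i\<le>length l. (- 1) ^ i * h (face i l))"

lemma differential_eq: "differential C h l = (if l \<in> lists C then bar_diff h l else 0)"
  by (simp add: differential_def bar_diff_def)

lemma face_Suc_Cons:
  assumes "i \<noteq> 0" "i \<le> length l"
  shows "face (Suc i) (a # l) = a # face i l"
proof -
  obtain k where i: "i = Suc k" using assms(1) not0_implies_Suc by blast
  have "l \<noteq> []" using assms by auto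
  then show ?thesis by (simp add: face_def i)
qed

lemma bar_diff_Nil [simp]: "bar_diff h [] = 0"
  by (simp add: bar_diff_def)

text \<open>
  Apart from the first two faces of \<open>a # l\<close>, all are of the form \<open>a # face i l\<close> with \<open>i \<noteq> 0\<close>. The last
  term in the parentheses makes up for the face of \<open>l\<close> with \<open>i = 0\<close>. All formulas below that involve
  the differential are proved by induction along this recursion.
\<close>

lemma bar_diff_Cons:
  "bar_diff h (a # l) =
     (if l = [] then 0 else h l - h ((a + hd l) # tl l) + h (a # tl l)) - bar_diff (\<lambda>w. h (a # w)) l"
proof (cases l)
  case Nil
  then show ?thesis by (simp add: bar_diff_def face_def)
next
  case (Cons b m)
  have f0: "face 0 (a # l) = l" "face 1 (a # l) = (a + b) # m" by (simp_all add: face_def Cons)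
  have "bar_diff h (a # l) = h l - (\<Sum>i\<le>length l. (- 1) ^ i * h (face (Suc i) (a # l)))"
    by (simp add: bar_diff_def sum.atMost_Suc_shift f0 sum_negf del: sum.atMost_Suc)
  also have "(\<Sum>i\<le>length l. (- 1) ^ i * h (face (Suc i) (a # l))) =
      h ((a + b) # m) + (\<Sum>i\<in>{..length l} - {0}. (- 1) ^ i * h (face (Suc i) (a # l)))"
    by (subst sum.remove[of _ 0]) (use f0 in auto)
  also have "(\<Sum>i\<in>{..length l} - {0}. (- 1) ^ i * h (face (Suc i) (a # l))) =
      (\<Sum>i\<in>{..length l} - {0}. (- 1) ^ i * h (a # face i l))"
    by (intro sum.cong refl) (auto simp: face_Suc_Cons)
  also have "\<dots> = bar_diff (\<lambda>w. h (a # w)) l - h (a # m)"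
  proof -
    have "face 0 l = m" by (simp add: face_def Cons)
    then show ?thesis
      using sum.remove[of "{..length l}" 0 "\<lambda>i. (- 1) ^ i * h (a # face i l)"]
      by (simp add: bar_diff_def Cons del: sum.atMost_Suc)
  qed
  finally show ?thesis by (simp add: Cons)
qed

lemma bar_diff_Cons_Cons:
  "bar_diff h (a # b # l) = h (b # l) - h ((a + b) # l) + h (a # l) - bar_diff (\<lambda>w. h (a # w)) (b # l)"
  by (subst bar_diff_Cons) simp

lemma bar_diff_single [simp]: "bar_diff h [a] = 0"
  by (simp add: bar_diff_Cons)

lemma bar_diff_add: "bar_diff (\<lambda>w. h w + h' w) l = bar_diff h l + bar_diff h' l"
  and bar_diff_diff: "bar_diff (\<lambda>w. h w - h' w) l = bar_diff h l - bar_diff h' l"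
  and bar_diff_scale: "bar_diff (\<lambda>w. c * h w) l = c * bar_diff h l"
  and bar_diff_uminus: "bar_diff (\<lambda>w. - h w) l = - bar_diff h l"
  and bar_diff_zero: "bar_diff (\<lambda>_. 0) l = 0"
  by (simp_all add: bar_diff_def distrib_left right_diff_distrib sum.distrib sum_subtractf
      sum_distrib_left sum_negf mult.left_commute)

lemma bar_diff_sum: "bar_diff (\<lambda>w. \<Sum>i\<in>A. h i w) l = (\<Sum>i\<in>A. bar_diff (h i) l)"
  by (induction A rule: infinite_finite_induct) (simp_all add: bar_diff_zero bar_diff_add)

lemma bar_diff_bar_diff:
  fixes h :: "'v::ab_group_add list \<Rightarrow> 'a::comm_ring_1"
  shows "bar_diff (bar_diff h) l = 0"
proof (induction l arbitrary: h)
  case (Cons a l)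
  show ?case
  proof (cases l)
    case (Cons b m)
    define M where "M x h w = (if w = [] then 0 else h w - h ((x + hd w) # tl w) + h (x # tl w))"
      for x :: 'v and h :: "'v list \<Rightarrow> 'a" and w
    have rec: "bar_diff h (x # w) = M x h w - bar_diff (\<lambda>w. h (x # w)) w" for x h w
      unfolding M_def by (rule bar_diff_Cons)
    have "bar_diff (\<lambda>w. bar_diff h (a # w)) l = bar_diff (M a h) l"
      by (simp add: rec bar_diff_diff Cons.IH)
    also have "\<dots> = M b (M a h) m - (bar_diff (\<lambda>w. h (b # w)) m - bar_diff (\<lambda>w. h ((a + b) # w)) m + bar_diff (\<lambda>w. h (a # w)) m)"
      by (simp add: Cons rec) (simp add: M_def bar_diff_add bar_diff_diff)
    finally have "bar_diff (bar_diff h) (a # l) = M b h m - M (a + b) h m + M a h m - M b (M a h) m"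
      by (subst rec) (simp add: Cons, simp add: M_def Cons rec[unfolded M_def])
    also have "\<dots> = 0" by (cases m) (simp_all add: M_def add.assoc)
    finally show ?thesis .
  qed simp
qed simp

lemma cup_Nil [simp]: "cup c d [] = c [] * d []"
  by (simp add: cup_def)

lemma cup_Cons: "cup c d (a # l) = c [] * d (a # l) + cup (\<lambda>w. c (a # w)) d l"
  by (simp add: cup_def sum.atMost_Suc_shift del: sum.atMost_Suc)

lemma cup_add_left: "cup (\<lambda>w. c w + c' w) d l = cup c d l + cup c' d l"
  and cup_add_right: "cup c (\<lambda>w. d w + d' w) l = cup c d l + cup c d' l"
  and cup_diff_left: "cup (\<lambda>w. c w - c' w) d l = cup c d l - cup c' d l"
  and cup_uminus_left: "cup (\<lambda>w. - c w) d l = - cup c d l"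
  and cup_scale_left: "cup (\<lambda>w. k * c w) d l = k * cup c d l"
  and cup_zero_left: "cup (\<lambda>_. 0) d l = 0"
  and cup_zero_right: "cup c (\<lambda>_. 0) l = 0"
  by (simp_all add: cup_def algebra_simps sum.distrib sum_subtractf sum_distrib_left sum_negf)

lemma cup_assoc: "cup (cup c d) e l = cup c (cup d e) l"
proof (induction l arbitrary: c d)
  case (Cons a l)
  show ?case
    by (simp add: cup_Cons cup_add_left cup_scale_left Cons.IH algebra_simps)
qed (simp add: mult.assoc)

lemma cup_const_left: "cup (const_cochain k) d l = k * d l"
  by (cases l) (simp_all add: cup_Cons const_cochain_def cup_zero_left)

lemma cup_const_right: "cup c (const_cochain k) l = c l * k"
  by (induction l arbitrary: c) (simp_all add: cup_Cons const_cochain_def)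

text \<open>
  The sign of the Leibniz rule. It is an operator because cochains here may have components in
  several degrees.
\<close>

definition alternate :: "('v list \<Rightarrow> 'a::comm_ring_1) \<Rightarrow> 'v list \<Rightarrow> 'a" where
  "alternate c l = (- 1) ^ length l * c l"

lemma alternate_Cons: "alternate c (a # l) = - alternate (\<lambda>w. c (a # w)) l"
  by (simp add: alternate_def)

lemma alternate_Nil [simp]: "alternate c [] = c []"
  by (simp add: alternate_def)

lemma bar_diff_cup: "bar_diff (cup c d) l = cup (bar_diff c) d l + cup (alternate c) (bar_diff d) l"
proof (induction l arbitrary: c)
  case (Cons a l)
  show ?case
  proof (cases l)
    case Nil
    then show ?thesis by (simp add: cup_Cons)
  next
    case (Cons b m)
    have "bar_diff (\<lambda>w. cup c d (a # w)) l =
        c [] * bar_diff (\<lambda>w. d (a # w)) l + (cup (bar_diff (\<lambda>w. c (a # w))) d l + cup (alternate (\<lambda>w. c (a # w))) (bar_diff d) l)"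
      by (simp add: cup_Cons bar_diff_add bar_diff_scale Cons.IH)
    then show ?thesis
      by (simp add: Cons bar_diff_Cons_Cons cup_Cons alternate_Cons cup_uminus_left
          cup_add_left cup_diff_left algebra_simps)
  qed
qed simp

lemma bar_diff_alternate: "bar_diff (alternate c) l = - alternate (bar_diff c) l"
proof (cases "l = []")
  case False
  have "length (face i l) = length l - 1" if "i \<le> length l" for i
    using that False by (auto simp: face_def)
  then show ?thesis
    using False by (cases l)
      (simp_all add: bar_diff_def alternate_def sum_distrib_left mult.left_commute sum_negf del: sum.atMost_Suc)
qed simp

section \<open>The cohomology ring\<close>

locale additive_subgroup_set =
  fixes C :: "'v::ab_group_add set"
  assumes C_zero: "0 \<in> C" and C_add: "a \<in> C \<Longrightarrow> b \<in> C \<Longrightarrow> a + b \<in> C"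
begin

lemma face_lists: "l \<in> lists C \<Longrightarrow> i \<le> length l \<Longrightarrow> face i l \<in> lists C"
proof -
  assume l: "l \<in> lists C" and i: "i \<le> length l"
  then have "set l \<subseteq> C" by auto
  moreover have "l ! (i - 1) + l ! i \<in> C" if "i \<noteq> 0" "i \<noteq> length l"
    using that i \<open>set l \<subseteq> C\<close> by (intro C_add) (auto intro: nth_mem)
  ultimately show ?thesis
    unfolding face_def lists_eq_set
    by (auto dest: list.set_sel(2) in_set_butlastD in_set_takeD in_set_dropD)
       (metis list.set_sel(2) list.sel(2) subsetD empty_iff list.set(1))
qed

lemma bar_diff_cong:
  assumes "\<And>w. w \<in> lists C \<Longrightarrow> h w = h' w" "l \<in> lists C"
  shows "bar_diff h l = bar_diff h' l"
  unfolding bar_diff_def using assms face_lists by (auto intro!: sum.cong)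

lemma differential_differential: "differential C (differential C h) = (\<lambda>_. 0)"
proof
  fix l
  show "differential C (differential C h) l = 0"
  proof (cases "l \<in> lists C")
    case True
    then have "bar_diff (differential C h) l = bar_diff (bar_diff h) l"
      by (intro bar_diff_cong) (simp_all add: differential_eq)
    then show ?thesis using True by (simp add: differential_eq bar_diff_bar_diff)
  qed (simp add: differential_eq)
qed

lemma cochainsI: "(\<And>l. l \<notin> lists C \<Longrightarrow> c l = 0) \<Longrightarrow> (\<And>l. N \<le> length l \<Longrightarrow> c l = 0) \<Longrightarrow> c \<in> cochains C"
  unfolding cochains_def by (auto simp: not_less intro!: exI[of _ N]) (meson not_le)+

lemma cochainsD: "c \<in> cochains C \<Longrightarrow> l \<notin> lists C \<Longrightarrow> c l = 0"
  by (auto simp: cochains_def)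

lemma cochains_bound: "c \<in> cochains C \<Longrightarrow> \<exists>N. \<forall>l. N \<le> length l \<longrightarrow> c l = 0"
  unfolding cochains_def by (auto simp: not_le) (meson not_le)

lemma differential_cochain:
  assumes "c \<in> cochains C" shows "differential C c \<in> cochains C"
proof -
  obtain N where N: "\<And>l. N \<le> length l \<Longrightarrow> c l = 0" using cochains_bound[OF assms] by blast
  show ?thesis
  proof (rule cochainsI[of _ "Suc N"])
    fix l :: "'v list" assume l: "Suc N \<le> length l"
    have "c (face i l) = 0" if "i \<le> length l" for i
      using l that by (intro N) (auto simp: face_def)
    then show "differential C c l = 0" by (auto simp: differential_def intro!: sum.neutral)
  qed (simp add: differential_eq)
qed

lemma cup_outside: "(\<And>l. l \<notin> lists C \<Longrightarrow> c l = 0) \<Longrightarrow> (\<And>l. l \<notin> lists C \<Longrightarrow> d l = 0) \<Longrightarrow> l \<notin> lists C \<Longrightarrow> cup c d l = 0"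
proof -
  assume c: "\<And>l. l \<notin> lists C \<Longrightarrow> c l = 0" and d: "\<And>l. l \<notin> lists C \<Longrightarrow> d l = 0" and l: "l \<notin> lists C"
  have "take i l \<notin> lists C \<or> drop i l \<notin> lists C" for i
    using l append_in_lists_conv[of "take i l" "drop i l"] by simp
  then show ?thesis unfolding cup_def using c d by (metis (no_types, lifting) mult_not_zero sum.neutral)
qed

lemma cup_cochain:
  assumes c: "c \<in> cochains C" and d: "d \<in> cochains C" shows "cup c d \<in> cochains C"
proof -
  obtain N M where N: "\<And>l. N \<le> length l \<Longrightarrow> c l = 0" and M: "\<And>l. M \<le> length l \<Longrightarrow> d l = 0"
    using cochains_bound[OF c] cochains_bound[OF d] by blast
  show ?thesis
  proof (rule cochainsI[of _ "N + M"])
    fix l :: "'v list" assume "N + M \<le> length l"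
    then have "N \<le> length (take i l) \<or> M \<le> length (drop i l)" if "i \<le> length l" for i
      using that by auto
    then have "c (take i l) * d (drop i l) = 0" if "i \<le> length l" for i
      using that N M by force
    then show "cup c d l = 0" unfolding cup_def by (intro sum.neutral) auto
  qed (use cup_outside cochainsD c d in blast)
qed

lemma alternate_cochain: "c \<in> cochains C \<Longrightarrow> alternate c \<in> cochains C"
proof -
  assume c: "c \<in> cochains C"
  obtain N where "\<And>l. N \<le> length l \<Longrightarrow> c l = 0" using cochains_bound[OF c] by blast
  then show ?thesis using cochainsD[OF c] by (intro cochainsI[of _ N]) (simp_all add: alternate_def)
qed

lemma add_cochain: "c \<in> cochains C \<Longrightarrow> d \<in> cochains C \<Longrightarrow> (\<lambda>l. c l + d l) \<in> cochains C"
proof -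
  assume c: "c \<in> cochains C" and d: "d \<in> cochains C"
  obtain N M where "\<And>l. N \<le> length l \<Longrightarrow> c l = 0" "\<And>l. M \<le> length l \<Longrightarrow> d l = 0"
    using cochains_bound[OF c] cochains_bound[OF d] by blast
  then show ?thesis using cochainsD[OF c] cochainsD[OF d] by (intro cochainsI[of _ "max N M"]) auto
qed

lemma scale_cochain: "h \<in> cochains C \<Longrightarrow> (\<lambda>l. k * h l) \<in> cochains C"
proof -
  assume h: "h \<in> cochains C"
  obtain N where "\<And>l. N \<le> length l \<Longrightarrow> h l = 0" using cochains_bound[OF h] by blast
  then show ?thesis using cochainsD[OF h] by (intro cochainsI[of _ N]) simp_all
qed

lemma zero_cochain: "(\<lambda>_. 0) \<in> cochains C"
  by (auto simp: cochains_def)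

lemma uminus_cochain: "c \<in> cochains C \<Longrightarrow> (\<lambda>l. - c l) \<in> cochains C"
  unfolding cochains_def by auto

lemma const_cochain: "const_cochain a \<in> cochains C"
  by (rule cochainsI[of _ 1]) (auto simp: const_cochain_def)

lemma differential_add: "differential C (\<lambda>l. c l + d l) l = differential C c l + differential C d l"
  and differential_uminus: "differential C (\<lambda>l. - c l) l = - differential C c l"
  by (simp_all add: differential_eq bar_diff_add bar_diff_uminus)

lemma differential_const: "differential C (const_cochain a) l = 0"
proof -
  have "bar_diff (const_cochain a) l = 0" for l :: "'v list"
  proof (cases l)
    case (Cons x m)
    then show ?thesis
      by (cases m) (simp_all add: bar_diff_Cons_Cons const_cochain_def bar_diff_zero)
  qed simp
  then show ?thesis by (simp add: differential_eq)
qed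

lemma cup_differential_eq:
  "l \<in> lists C \<Longrightarrow> cup (differential C c) d l = cup (bar_diff c) d l"
  "l \<in> lists C \<Longrightarrow> cup c (differential C d) l = cup c (bar_diff d) l"
proof -
  have "take i l \<in> lists C" "drop i l \<in> lists C" if "l \<in> lists C" for i
    using that append_in_lists_conv[of "take i l" "drop i l"] by simp_all
  then show "l \<in> lists C \<Longrightarrow> cup (differential C c) d l = cup (bar_diff c) d l"
    "l \<in> lists C \<Longrightarrow> cup c (differential C d) l = cup c (bar_diff d) l"
    unfolding cup_def by (simp_all add: differential_eq)
qed

lemma differential_cup:
  assumes "c \<in> cochains C" "d \<in> cochains C"
  shows "differential C (cup c d) l = cup (differential C c) d l + cup (alternate c) (differential C d) l"
proof (cases "l \<in> lists C")
  case True
  then show ?thesis by (simp add: differential_eq[of C "cup c d"] bar_diff_cup cup_differential_eq)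
next
  case False
  have "cup (differential C c) d l = 0" "cup (alternate c) (differential C d) l = 0"
    by (rule cup_outside[OF cochainsD cochainsD False];
        use assms differential_cochain alternate_cochain in blast)+
  then show ?thesis using False by (simp add: differential_eq[of C "cup c d"])
qed

lemma differential_alternate: "differential C (alternate c) l = - alternate (differential C c) l"
  by (simp add: differential_eq bar_diff_alternate) (simp add: alternate_def differential_eq)

abbreviation "Z \<equiv> cocycle_ring C"

lemma cocycle_ring_simps:
  "monoid.mult Z = cup" "one Z = const_cochain 1" "zero Z = (\<lambda>_. 0)" "add Z = (\<lambda>c d l. c l + d l)"
  "c \<in> carrier Z \<longleftrightarrow> c \<in> cochains C \<and> (\<forall>l. differential C c l = 0)"
  by (auto simp: cocycle_ring_def)

lemma cup_cocycle: "c \<in> carrier Z \<Longrightarrow> d \<in> carrier Z \<Longrightarrow> cup c d \<in> carrier Z"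
proof -
  assume c: "c \<in> carrier Z" and d: "d \<in> carrier Z"
  have "differential C c = (\<lambda>_. 0)" "differential C d = (\<lambda>_. 0)"
    using c d by (auto simp: cocycle_ring_simps)
  then show ?thesis
    using c d by (simp add: cocycle_ring_simps cup_cochain differential_cup cup_zero_left cup_zero_right)
qed

lemma const_cocycle: "const_cochain a \<in> carrier Z"
  by (simp add: cocycle_ring_simps const_cochain differential_const)

lemma ring_cocycles: "ring (Z :: ('v list \<Rightarrow> 'a::comm_ring_1) ring)"
proof (rule ringI)
  show "abelian_group (Z :: ('v list \<Rightarrow> 'a) ring)"
  proof (rule abelian_groupI)
    show "\<exists>d\<in>carrier Z. d \<oplus>\<^bsub>Z\<^esub> c = \<zero>\<^bsub>Z\<^esub>" if "c \<in> carrier Z" for c :: "'v list \<Rightarrow> 'a"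
      using that by (intro bexI[of _ "\<lambda>l. - c l"])
        (auto simp: cocycle_ring_simps uminus_cochain differential_uminus)
    show "\<zero>\<^bsub>Z\<^esub> \<in> carrier Z"
      by (auto simp: cocycle_ring_simps differential_eq bar_diff_zero cochains_def)
  qed (auto simp: cocycle_ring_simps add_cochain differential_add algebra_simps)
  show "Group.monoid (Z :: ('v list \<Rightarrow> 'a) ring)"
    by (rule monoidI)
      (use cup_cocycle const_cocycle in \<open>simp_all add: cocycle_ring_simps(1,2)\<close>,
        auto simp: fun_eq_iff cup_assoc cup_const_left cup_const_right)
qed (auto simp: cocycle_ring_simps(1-4) cup_add_left cup_add_right fun_eq_iff)

lemma coboundary_cocycle: "h \<in> coboundaries C \<Longrightarrow> h \<in> carrier Z"
  unfolding coboundaries_def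
  by (auto simp: cocycle_ring_simps differential_cochain differential_differential)

text \<open>
  By the Leibniz rule, \<open>c \<union> d b = d (c' \<union> b)\<close> and \<open>d b \<union> c = d (b \<union> c)\<close> for a cocycle \<open>c\<close>, where \<open>c'\<close> is \<open>c\<close> with
  alternating signs.
\<close>

lemma ideal_coboundaries: "ideal (coboundaries C :: ('v list \<Rightarrow> 'a::comm_ring_1) set) Z"
proof (rule idealI[OF ring_cocycles])
  interpret ring "Z :: ('v list \<Rightarrow> 'a) ring" by (rule ring_cocycles)
  show "subgroup (coboundaries C :: ('v list \<Rightarrow> 'a) set) (add_monoid Z)"
  proof (rule group.subgroupI[OF a_group])
    show "(coboundaries C :: ('v list \<Rightarrow> 'a) set) \<subseteq> carrier (add_monoid Z)" using coboundary_cocycle by auto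
    have "(\<lambda>_. 0) \<in> (cochains C :: ('v list \<Rightarrow> 'a) set)" by (auto simp: cochains_def)
    then show "(coboundaries C :: ('v list \<Rightarrow> 'a) set) \<noteq> {}" unfolding coboundaries_def by blast
    show "inv\<^bsub>add_monoid Z\<^esub> h \<in> coboundaries C" if h: "h \<in> coboundaries C" for h :: "'v list \<Rightarrow> 'a"
    proof -
      obtain c where c: "c \<in> cochains C" "h = differential C c"
        using h by (auto simp: coboundaries_def)
      have "(\<lambda>l. - h l) = differential C (\<lambda>l. - c l)" by (simp add: fun_eq_iff c differential_uminus)
      then have m: "(\<lambda>l. - h l) \<in> coboundaries C" using uminus_cochain[OF c(1)] by (auto simp: coboundaries_def)
      moreover have "inv\<^bsub>add_monoid Z\<^esub> h = (\<lambda>l. - h l)"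
        using coboundary_cocycle[OF m] coboundary_cocycle[OF h]
        by (intro group.inv_equality[OF a_group]) (simp_all add: cocycle_ring_simps(3,4) fun_eq_iff)
      ultimately show ?thesis by simp
    qed
    show "g \<otimes>\<^bsub>add_monoid Z\<^esub> h \<in> coboundaries C" if gh: "g \<in> coboundaries C" "h \<in> coboundaries C" for g h :: "'v list \<Rightarrow> 'a"
    proof -
      obtain c d where c: "c \<in> cochains C" "g = differential C c" and d: "d \<in> cochains C" "h = differential C d"
        using gh by (auto simp: coboundaries_def)
      have "(\<lambda>l. g l + h l) = differential C (\<lambda>l. c l + d l)" by (simp add: fun_eq_iff c d differential_add)
      then show ?thesis using add_cochain[OF c(1) d(1)] by (auto simp: coboundaries_def cocycle_ring_simps(4))
    qed
  qed
  fix h c :: "'v list \<Rightarrow> 'a"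
  assume h: "h \<in> coboundaries C" and c: "c \<in> carrier Z"
  obtain b where b: "b \<in> cochains C" "h = differential C b" using h by (auto simp: coboundaries_def)
  have c': "c \<in> cochains C" "differential C c = (\<lambda>_. 0)" using c by (auto simp: cocycle_ring_simps)
  have alt0: "differential C (alternate c) = (\<lambda>_. 0)"
    by (simp add: fun_eq_iff differential_alternate c'(2)) (simp add: alternate_def)
  have alt2: "alternate (alternate c) = c"
    by (simp add: fun_eq_iff alternate_def flip: power_add mult.assoc)
  have "cup c h = differential C (cup (alternate c) b)"
    by (rule ext)
      (simp add: differential_cup[OF alternate_cochain[OF c'(1)] b(1)] alt0 alt2 b(2) cup_zero_left)
  then show "c \<otimes>\<^bsub>Z\<^esub> h \<in> coboundaries C"
    using cup_cochain[OF alternate_cochain[OF c'(1)] b(1)] by (auto simp: coboundaries_def cocycle_ring_simps(1))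
  have "cup h c = differential C (cup b c)"
    by (simp add: fun_eq_iff differential_cup c' b cup_zero_right)
  then show "h \<otimes>\<^bsub>Z\<^esub> c \<in> coboundaries C"
    using cup_cochain[OF b(1) c'(1)] by (auto simp: coboundaries_def cocycle_ring_simps(1))
qed

abbreviation "H \<equiv> cohomology C"
abbreviation "cls \<equiv> cohomology_class C"

lemma ring_cohomology: "ring H"
  unfolding cohomology_def by (rule ideal.quotient_is_ring[OF ideal_coboundaries])

lemma cls_hom: "cls \<in> Ring.ring_hom Z H"
  using ideal.rcos_ring_hom[OF ideal_coboundaries] unfolding cohomology_def cohomology_class_def[abs_def] .

lemma cls_carrier: "c \<in> carrier Z \<Longrightarrow> cls c \<in> carrier H"
  by (rule ring_hom_closed[OF cls_hom])

lemma cls_cup: "c \<in> carrier Z \<Longrightarrow> d \<in> carrier Z \<Longrightarrow> cls c \<otimes>\<^bsub>H\<^esub> cls d = cls (cup c d)"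
  using ring_hom_mult[OF cls_hom, of c d] by (simp add: cocycle_ring_simps(1))

lemma cls_add: "c \<in> carrier Z \<Longrightarrow> d \<in> carrier Z \<Longrightarrow> cls c \<oplus>\<^bsub>H\<^esub> cls d = cls (\<lambda>l. c l + d l)"
  using ring_hom_add[OF cls_hom, of c d] by (simp add: cocycle_ring_simps(4))

lemma cls_one: "\<one>\<^bsub>H :: ('v list \<Rightarrow> 'a::comm_ring_1) set ring\<^esub> = cls (const_cochain 1)"
  using ring_hom_one[OF cls_hom[where 'a = 'a]] by (simp add: cocycle_ring_simps(2))

lemma cls_eqI:
  assumes "c \<in> carrier Z" "d \<in> carrier Z" "b \<in> cochains C" "\<And>l. c l - d l = differential C b l"
  shows "cls c = cls d"
proof -
  interpret ideal "coboundaries C" Z by (rule ideal_coboundaries)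
  have "c = differential C b \<oplus>\<^bsub>Z\<^esub> d"
    by (simp add: cocycle_ring_simps(4) fun_eq_iff flip: assms(4))
  then have "c \<in> coboundaries C +>\<^bsub>Z\<^esub> d"
    using assms(3) by (auto simp: a_r_coset_def' coboundaries_def)
  then show ?thesis
    unfolding cohomology_class_def by (rule a_repr_independence[OF _ assms(2) a_subgroup, symmetric])
qed

lemma cohomologyE:
  assumes "X \<in> carrier H"
  obtains c where "c \<in> carrier Z" "X = cls c"
  using assms unfolding cohomology_def cohomology_class_def FactRing_def A_RCOSETS_def'
  by auto

lemma cls_zero: "\<zero>\<^bsub>H :: ('v list \<Rightarrow> 'a::comm_ring_1) set ring\<^esub> = cls (\<lambda>_. 0)"
proof -
  interpret ring_hom_ring "Z :: ('v list \<Rightarrow> 'a) ring" H cls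
    by (rule ring_hom_ringI2[OF ring_cocycles ring_cohomology cls_hom])
  show ?thesis using hom_zero by (simp add: cocycle_ring_simps(3))
qed

lemma cls_memberE:
  assumes "x \<in> cls c"
  obtains b where "b \<in> cochains C" "\<And>l. x l = differential C b l + c l"
  using assms unfolding cohomology_class_def a_r_coset_def' coboundaries_def
  by (auto simp: cocycle_ring_simps(4))

lemma cls_self: "c \<in> carrier Z \<Longrightarrow> c \<in> cls c"
proof -
  assume "c \<in> carrier Z"
  interpret ideal "coboundaries C" Z by (rule ideal_coboundaries)
  show ?thesis unfolding cohomology_class_def using a_rcos_self \<open>c \<in> carrier Z\<close> by blast
qed

end

section \<open>Bockstein classes\<close>

definition degree_two :: "('v list \<Rightarrow> 'a::zero) \<Rightarrow> bool" where
  "degree_two z \<longleftrightarrow> (\<forall>l. length l \<noteq> 2 \<longrightarrow> z l = 0)"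

lemma cup_degree_two:
  assumes "degree_two z"
  shows "cup z h [] = 0" "cup z h [a] = 0" "cup z h (a # b # m) = z [a, b] * h m"
proof -
  have z: "z [] = 0" "z [x] = 0" for x
    using assms by (simp_all add: degree_two_def)
  have ab: "(\<lambda>w. z (a # b # w)) = const_cochain (z [a, b])"
    using assms by (auto simp: fun_eq_iff degree_two_def const_cochain_def)
  show "cup z h [] = 0" "cup z h [a] = 0" "cup z h (a # b # m) = z [a, b] * h m"
    by (simp_all add: cup_Cons z ab cup_const_left)
qed

context additive_subgroup_set
begin

text \<open>
  The difference of the two products is the coboundary of Steenrod's product \<open>z \<union>\<^sub>1 y\<close>, the
  cochain \<open>w\<close> of the proof.
\<close>

lemma cls_cup_commute:
  fixes z y :: "'v list \<Rightarrow> 'a::comm_ring_1"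
  assumes z: "z \<in> carrier Z" "degree_two z" and y: "y \<in> carrier Z" "degree_two y"
  shows "cls z \<otimes>\<^bsub>H\<^esub> cls y = cls y \<otimes>\<^bsub>H\<^esub> cls z"
proof -
  define w where "w l = (if l \<in> lists C \<and> length l = 3 then
      z [l ! 0 + l ! 1, l ! 2] * y [l ! 0, l ! 1] - z [l ! 0, l ! 1 + l ! 2] * y [l ! 1, l ! 2] else 0)" for l
  have coc: "u [b, c] - u [a + b, c] + u [a, b + c] - u [a, b] = 0"
    if "u \<in> carrier Z" "a \<in> C" "b \<in> C" "c \<in> C" for u :: "'v list \<Rightarrow> 'a" and a b c
  proof -
    have "bar_diff u [a, b, c] = 0"
      using that by (auto simp: cocycle_ring_simps differential_eq dest: spec[of _ "[a, b, c]"])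
    then show ?thesis by (simp add: bar_diff_Cons_Cons bar_diff_Cons algebra_simps)
  qed
  have "cup y z l - cup z y l = differential C w l" for l
  proof (cases "l \<in> lists C \<and> length l = 4")
    case True
    then obtain a b c d where l: "l = [a, b, c, d]" and C: "a \<in> C" "b \<in> C" "c \<in> C" "d \<in> C"
      by (auto simp: length_Suc_conv numeral_eq_Suc)
    have "differential C w l = w [b, c, d] - w [a + b, c, d] + w [a, b + c, d] - w [a, b, c + d] + w [a, b, c]"
      using C by (simp add: differential_eq l bar_diff_Cons_Cons bar_diff_Cons algebra_simps)
    also have "\<dots> = (z [b + c, d] * y [b, c] - z [b, c + d] * y [c, d])
        - (z [a + b + c, d] * y [a + b, c] - z [a + b, c + d] * y [c, d])
        + (z [a + b + c, d] * y [a, b + c] - z [a, b + c + d] * y [b + c, d])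
        - (z [a + b, c + d] * y [a, b] - z [a, b + c + d] * y [b, c + d])
        + (z [a + b, c] * y [a, b] - z [a, b + c] * y [b, c])"
      using C by (simp add: w_def C_add add.assoc)
    also have "\<dots> = y [a, b] * z [c, d] - z [a, b] * y [c, d]"
    proof -
      have 1: "y [a + b, c] = y [b, c] + y [a, b + c] - y [a, b]"
        using coc[OF y(1) C(1,2,3)] by (simp add: algebra_simps)
      have 2: "y [b + c, d] = y [c, d] + y [b, c + d] - y [b, c]"
        using coc[OF y(1) C(2,3,4)] by (simp add: algebra_simps)
      have 3: "z [b + c, d] = z [a + b + c, d] - z [a, b + c + d] + z [a, b + c]"
        using coc[OF z(1), of a "b + c" d] C C_add by (simp add: algebra_simps)
      have 4: "z [b, c + d] = z [a + b, c + d] - z [a, b + c + d] + z [a, b]"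
        using coc[OF z(1), of a b "c + d"] C C_add by (simp add: algebra_simps)
      have 5: "z [c, d] = z [a + b + c, d] - z [a + b, c + d] + z [a + b, c]"
        using coc[OF z(1), of "a + b" c d] C C_add by (simp add: algebra_simps)
      show ?thesis unfolding 1 2 3 4 5 by (simp add: algebra_simps)
    qed
    also have "\<dots> = cup y z l - cup z y l"
      by (simp add: l cup_degree_two z y)
    finally show ?thesis by simp
  next
    case False
    have "bar_diff w l = 0" if "length l \<noteq> 4"
    proof -
      have "w (face i l) = 0" if "i \<le> length l" "l \<noteq> []" for i
        using that \<open>length l \<noteq> 4\<close> by (auto simp: w_def face_def split: if_splits)
      then show ?thesis by (auto simp: bar_diff_def intro!: sum.neutral)
    qed
    then have "differential C w l = 0" using False by (auto simp: differential_eq)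
    moreover have "cup u v l = 0" if "u \<in> carrier Z" "v \<in> carrier Z" "degree_two u" "degree_two v" for u v :: "'v list \<Rightarrow> 'a"
    proof (cases "l \<in> lists C")
      case True
      then have "length l \<noteq> 4" using False by simp
      then have "v (drop 2 l) = 0" using that(4) by (simp add: degree_two_def)
      then show ?thesis
        using cup_degree_two[OF that(3), of v] by (cases l rule: remdups_adj.cases) (auto simp: numeral_2_eq_2)
    next
      case False
      then show ?thesis using that by (intro cup_outside) (auto simp: cocycle_ring_simps dest: cochainsD)
    qed
    ultimately show ?thesis using z y by simp
  qed
  moreover have "w \<in> cochains C" by (rule cochainsI[of _ 4]) (auto simp: w_def)
  ultimately have "cls (cup y z) = cls (cup z y)"
    using z y cup_cocycle by (intro cls_eqI) auto
  then show ?thesis using z y by (simp add: cls_cup)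
qed

lemma cls_eqD:
  assumes "cls c = cls d" "c \<in> carrier Z" "d \<in> carrier Z"
  obtains b where "b \<in> cochains C" "\<And>l. c l - d l = differential C b l"
proof -
  have "c \<in> cls d" using cls_self[OF assms(2)] assms(1) by simp
  then obtain b where b: "b \<in> cochains C" and bl: "\<And>l. c l = differential C b l + d l"
    by (rule cls_memberE) blast
  show ?thesis by (rule that[OF b]) (simp add: bl)
qed

lemma zero_cocycle: "(\<lambda>_. 0) \<in> carrier Z"
  by (auto simp: cocycle_ring_simps differential_eq bar_diff_zero cochains_def)

lemma scale_cocycle: "c \<in> carrier Z \<Longrightarrow> (\<lambda>l. k * c l) \<in> carrier Z"
proof -
  assume c: "c \<in> carrier Z"
  have "(\<lambda>l. k * c l) = cup (const_cochain k) c" by (simp add: fun_eq_iff cup_const_left)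
  then show ?thesis using cup_cocycle[OF const_cocycle c] by simp
qed

lemma add_cocycle: "c \<in> carrier Z \<Longrightarrow> d \<in> carrier Z \<Longrightarrow> (\<lambda>l. c l + d l) \<in> carrier Z"
  by (simp add: cocycle_ring_simps add_cochain differential_add)

lemma sum_cocycle: "(\<And>i. i \<in> A \<Longrightarrow> c i \<in> carrier Z) \<Longrightarrow> (\<lambda>l. \<Sum>i\<in>A. c i l) \<in> carrier Z"
  by (induction A rule: infinite_finite_induct) (auto simp: zero_cocycle add_cocycle)

lemma finsum_cls:
  assumes "finite A" "\<And>i. i \<in> A \<Longrightarrow> c i \<in> carrier Z"
  shows "(\<Oplus>\<^bsub>H\<^esub>i\<in>A. cls (c i)) = cls (\<lambda>l. \<Sum>i\<in>A. c i l)"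
proof -
  interpret ring "H :: ('v list \<Rightarrow> 'b) set ring" by (rule ring_cohomology)
  show ?thesis using assms
  proof induction
    case empty
    then show ?case by (simp add: cls_zero)
  next
    case (insert x F)
    then have "(\<Oplus>\<^bsub>H\<^esub>i\<in>insert x F. cls (c i)) = cls (c x) \<oplus>\<^bsub>H\<^esub> (\<Oplus>\<^bsub>H\<^esub>i\<in>F. cls (c i))"
      by (intro finsum_insert) (auto intro: cls_carrier)
    then show ?case using insert by (simp add: cls_add sum_cocycle)
  qed
qed

end

text \<open>
  The value at \<open>[a, b]\<close> is the carry in the addition of \<open>f a\<close> and \<open>f b\<close>. Over the integers, \<open>p\<close> times this
  cochain is the coboundary of the lift of \<open>f\<close>. Hence it is a cocycle already over the integers.
\<close>

lemma bockstein_form: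
  fixes C :: "'v::ab_group_add set" and f :: "'v \<Rightarrow> 'p::prime_card mod_ring"
  assumes "additive_subgroup_set C" and f_add: "\<And>a b. a \<in> C \<Longrightarrow> b \<in> C \<Longrightarrow> f (a + b) = f a + f b"
  defines "z \<equiv> bockstein_cochain C (form_cochain C f)"
  shows "z \<in> carrier (cocycle_ring C)" "degree_two z"
    "a \<in> C \<Longrightarrow> b \<in> C \<Longrightarrow>
      z [a, b] = of_int ((to_int_mod_ring (f b) - to_int_mod_ring (f (a + b)) + to_int_mod_ring (f a)) div int CARD('p))"
proof -
  interpret additive_subgroup_set C by fact
  let ?p = "int CARD('p)"
  have p: "?p > 0" by simp
  define F where "F l = to_int_mod_ring (form_cochain C f l)" for l
  have to_int_0: "to_int_mod_ring (0 :: 'p mod_ring) = 0" by (simp add: to_int_mod_ring.rep_eq zero_mod_ring.rep_eq)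
  have F: "F [v] = (if v \<in> C then to_int_mod_ring (f v) else 0)" "F [] = 0" "F (v # w # l) = 0" for v w l
    by (simp_all add: F_def form_cochain_def to_int_0)
  define K where "K l = differential C F l div ?p" for l
  have z: "z l = of_int (K l)" for l
    by (simp add: z_def bockstein_cochain_def K_def F_def[abs_def])
  have dF: "differential C F [a, b] = to_int_mod_ring (f b) - to_int_mod_ring (f (a + b)) + to_int_mod_ring (f a)"
    if "a \<in> C" "b \<in> C" for a b
    using that by (simp add: differential_eq bar_diff_Cons_Cons F C_add)
  have dF_other: "differential C F l = 0" if "length l \<noteq> 2" for l
  proof -
    have "F (face i l) = 0" if i: "i \<le> length l" and l: "l \<noteq> []" for i
    proof -
      have "length (face i l) \<noteq> 1 \<or> length l = 1" using i l \<open>length l \<noteq> 2\<close> by (auto simp: face_def)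
      moreover have "face i l = []" if "length l = 1" using that i by (auto simp: face_def length_Suc_conv)
      ultimately show ?thesis by (cases "face i l" rule: remdups_adj.cases) (auto simp: F)
    qed
    then show ?thesis by (auto simp: differential_def intro!: sum.neutral)
  qed
  have K: "differential C F l = ?p * K l" for l
  proof (cases "l \<in> lists C \<and> length l = 2")
    case True
    then obtain a b where l: "l = [a, b]" "a \<in> C" "b \<in> C" by (auto simp: length_Suc_conv numeral_eq_Suc)
    have "to_int_mod_ring (f (a + b)) = (to_int_mod_ring (f a) + to_int_mod_ring (f b)) mod ?p"
      using l f_add by (simp add: to_int_mod_ring_add)
    then have "?p dvd differential C F l"
      unfolding l(1) dF[OF l(2,3)] by (simp add: mod_eq_dvd_iff[symmetric] algebra_simps minus_mod_eq_mult_div)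
    then show ?thesis by (simp add: K_def)
  next
    case False
    have "differential C F l = 0"
    proof (cases "l \<in> lists C")
      case True
      then show ?thesis using False dF_other by blast
    qed (simp add: differential_def)
    then show ?thesis by (simp add: K_def)
  qed
  have "?p * differential C K l = differential C (\<lambda>l. ?p * K l) l" for l
    by (simp add: differential_eq bar_diff_scale)
  also have "differential C (\<lambda>l. ?p * K l) l = 0" for l
    using differential_differential[of F] by (simp add: fun_eq_iff flip: K)
  finally have dK: "differential C K l = 0" for l using p by simp
  have "differential C z l = of_int (differential C K l)" for l
    by (simp add: differential_def z[abs_def])
  then have "differential C z l = 0" for l by (simp add: dK)
  moreover have "z \<in> cochains C"
  proof (rule cochainsI[of _ 3])
    show "z l = 0" if "l \<notin> lists C" for l using that by (simp add: z K_def differential_eq)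
    show "z l = 0" if "3 \<le> length l" for l using dF_other[of l] that by (simp add: z K_def)
  qed
  ultimately show "z \<in> carrier (cocycle_ring C)" by (simp add: cocycle_ring_simps)
  show "degree_two z" by (simp add: degree_two_def z K_def dF_other)
  show "a \<in> C \<Longrightarrow> b \<in> C \<Longrightarrow>
      z [a, b] = of_int ((to_int_mod_ring (f b) - to_int_mod_ring (f (a + b)) + to_int_mod_ring (f a)) div ?p)"
    by (simp add: z K_def dF)
qed

text \<open>
  Substitution of cocycles into a polynomial, on the level of cochains: sums and scalar multiples are
  pointwise here, and this is only multiplicative up to coboundaries.
\<close>

definition cup_power :: "('v list \<Rightarrow> 'a::comm_ring_1) \<Rightarrow> nat \<Rightarrow> 'v list \<Rightarrow> 'a" where
  "cup_power z k = (cup z ^^ k) (const_cochain 1)"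

definition cup_monom :: "(nat \<Rightarrow> 'v list \<Rightarrow> 'a::comm_ring_1) \<Rightarrow> nat list \<Rightarrow> (nat \<Rightarrow>\<^sub>0 nat) \<Rightarrow> 'v list \<Rightarrow> 'a" where
  "cup_monom z is m = foldr (\<lambda>i h. cup (cup_power (z i) (mlookup m i)) h) is (const_cochain 1)"

definition cup_poly :: "(nat \<Rightarrow> 'v list \<Rightarrow> 'a::comm_ring_1) \<Rightarrow> nat \<Rightarrow> 'a poly_alg \<Rightarrow> 'v list \<Rightarrow> 'a" where
  "cup_poly z r f l = (\<Sum>m\<in>mkeys f. mlookup f m * cup_monom z [0..<r] m l)"

lemma cup_poly_superset:
  "finite M \<Longrightarrow> mkeys f \<subseteq> M \<Longrightarrow> cup_poly z r f l = (\<Sum>m\<in>M. mlookup f m * cup_monom z [0..<r] m l)"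
  unfolding cup_poly_def by (rule sum.mono_neutral_left) (auto simp: in_keys_iff)

lemma cup_poly_add: "cup_poly z r (f + g) l = cup_poly z r f l + cup_poly z r g l"
proof -
  let ?M = "mkeys f \<union> mkeys g"
  have "mkeys (f + g) \<subseteq> ?M" by (rule keys_add)
  then show ?thesis
    by (simp add: cup_poly_superset[of ?M] lookup_add distrib_right sum.distrib)
qed

lemma cup_poly_zero: "cup_poly z r 0 l = 0"
  by (simp add: cup_poly_def)

lemma cup_poly_sum: "cup_poly z r (sum f A) l = (\<Sum>a\<in>A. cup_poly z r (f a) l)"
  by (induction A rule: infinite_finite_induct) (simp_all add: cup_poly_zero cup_poly_add)

lemma cup_poly_single: "cup_poly z r (msingle m a) l = a * cup_monom z [0..<r] m l"
  by (simp add: cup_poly_def)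

context ring
begin

lemma pow_commute:
  assumes "x \<in> carrier R" "y \<in> carrier R" "x \<otimes> y = y \<otimes> x"
  shows "x \<otimes> y [^] (k::nat) = y [^] k \<otimes> x"
proof (induction k)
  case (Suc k)
  have "x \<otimes> (y [^] k \<otimes> y) = (x \<otimes> y [^] k) \<otimes> y" using assms by (simp add: m_assoc)
  also have "\<dots> = y [^] k \<otimes> (x \<otimes> y)" using assms by (simp add: Suc m_assoc)
  also have "\<dots> = (y [^] k \<otimes> y) \<otimes> x" using assms by (simp add: m_assoc)
  finally show ?case by simp
qed (use assms in simp)

lemma foldr_pow_closed:
  "(\<And>i. i \<in> set is \<Longrightarrow> x i \<in> carrier R) \<Longrightarrow> foldr (\<lambda>i h. x i [^] (a i :: nat) \<otimes> h) is \<one> \<in> carrier R"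
  by (induction "is") auto

lemma foldr_pow_commute:
  assumes "\<And>i. i \<in> set is \<Longrightarrow> x i \<in> carrier R" "y \<in> carrier R"
    "\<And>i. i \<in> set is \<Longrightarrow> y \<otimes> x i = x i \<otimes> y"
  shows "y \<otimes> foldr (\<lambda>i h. x i [^] (a i :: nat) \<otimes> h) is \<one> = foldr (\<lambda>i h. x i [^] a i \<otimes> h) is \<one> \<otimes> y"
  using assms(1,3)
proof (induction "is")
  case (Cons i "is")
  let ?F = "foldr (\<lambda>i h. x i [^] a i \<otimes> h) is \<one>"
  have F: "?F \<in> carrier R" using Cons.prems by (intro foldr_pow_closed) auto
  have i: "x i \<in> carrier R" "y \<otimes> x i = x i \<otimes> y" using Cons.prems by auto
  have "y \<otimes> (x i [^] a i \<otimes> ?F) = (y \<otimes> x i [^] a i) \<otimes> ?F" using F i assms(2) by (simp add: m_assoc)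
  also have "\<dots> = x i [^] a i \<otimes> (y \<otimes> ?F)" using F i assms(2) by (simp add: pow_commute m_assoc)
  also have "\<dots> = (x i [^] a i \<otimes> ?F) \<otimes> y" using F i assms(2) Cons by (simp add: m_assoc)
  finally show ?case by simp
qed (use assms(2) in simp)

lemma foldr_pow_add:
  assumes "\<And>i. i \<in> set is \<Longrightarrow> x i \<in> carrier R"
    "\<And>i j. i \<in> set is \<Longrightarrow> j \<in> set is \<Longrightarrow> x i \<otimes> x j = x j \<otimes> x i"
  shows "foldr (\<lambda>i h. x i [^] (a i + b i :: nat) \<otimes> h) is \<one> =
    foldr (\<lambda>i h. x i [^] a i \<otimes> h) is \<one> \<otimes> foldr (\<lambda>i h. x i [^] b i \<otimes> h) is \<one>"
  using assms
proof (induction "is")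
  case (Cons i "is")
  let ?A = "foldr (\<lambda>i h. x i [^] a i \<otimes> h) is \<one>" and ?B = "foldr (\<lambda>i h. x i [^] b i \<otimes> h) is \<one>"
  have closed: "?A \<in> carrier R" "?B \<in> carrier R" "x i \<in> carrier R"
    using Cons.prems by (auto intro!: foldr_pow_closed)
  have "x i \<otimes> ?A = ?A \<otimes> x i" using Cons.prems by (intro foldr_pow_commute) auto
  then have comm: "x i [^] b i \<otimes> ?A = ?A \<otimes> x i [^] b i"
    using pow_commute[of ?A "x i" "b i"] closed by simp
  have "x i [^] (a i + b i) \<otimes> (?A \<otimes> ?B) = x i [^] a i \<otimes> ((x i [^] b i \<otimes> ?A) \<otimes> ?B)"
    using closed by (simp add: nat_pow_mult[symmetric] m_assoc)
  also have "\<dots> = (x i [^] a i \<otimes> ?A) \<otimes> (x i [^] b i \<otimes> ?B)"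
    using closed by (simp add: comm m_assoc)
  finally show ?case using Cons by simp
qed simp

end

context additive_subgroup_set
begin

lemma cup_power_cocycle: "z \<in> carrier Z \<Longrightarrow> cup_power z k \<in> carrier Z"
  by (induction k) (simp_all add: cup_power_def const_cocycle cup_cocycle)

lemma cls_cup_power: "z \<in> carrier Z \<Longrightarrow> cls (cup_power z k) = cls z [^]\<^bsub>H\<^esub> k"
proof (induction k)
  case 0
  then show ?case by (simp add: cup_power_def cls_one)
next
  case (Suc k)
  interpret ring "H :: ('v list \<Rightarrow> 'a) set ring" by (rule ring_cohomology)
  have "cls (cup_power z (Suc k)) = cls z \<otimes>\<^bsub>H\<^esub> cls (cup_power z k)"
    using cls_cup[OF Suc.prems cup_power_cocycle[OF Suc.prems]] by (simp add: cup_power_def)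
  then show ?case using Suc nat_pow_Suc2[OF cls_carrier[OF Suc.prems]] by simp
qed

lemma cup_monom_cocycle: "(\<And>i. i \<in> set is \<Longrightarrow> z i \<in> carrier Z) \<Longrightarrow> cup_monom z is m \<in> carrier Z"
  by (induction "is") (simp_all add: cup_monom_def const_cocycle cup_cocycle cup_power_cocycle)

lemma cls_cup_monom:
  "(\<And>i. i \<in> set is \<Longrightarrow> z i \<in> carrier Z) \<Longrightarrow>
    cls (cup_monom z is m) = foldr (\<lambda>i h. cls (z i) [^]\<^bsub>H\<^esub> mlookup m i \<otimes>\<^bsub>H\<^esub> h) is \<one>\<^bsub>H\<^esub>"
proof (induction "is")
  case Nil
  then show ?case by (simp add: cup_monom_def cls_one)
next
  case (Cons i "is")
  have "cls (cup_monom z (i # is) m) = cls (cup_power (z i) (mlookup m i)) \<otimes>\<^bsub>H\<^esub> cls (cup_monom z is m)"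
    using cls_cup[of "cup_power (z i) (mlookup m i)" "cup_monom z is m"] Cons.prems
      cup_monom_cocycle[of "is" z m]
    by (simp add: cup_power_cocycle) (simp add: cup_monom_def)
  then show ?case using Cons by (simp add: cls_cup_power)
qed

lemma cup_poly_cocycle: "(\<And>i. i < r \<Longrightarrow> z i \<in> carrier Z) \<Longrightarrow> cup_poly z r f \<in> carrier Z"
  unfolding cup_poly_def[abs_def] by (intro sum_cocycle scale_cocycle cup_monom_cocycle) auto

text \<open>
  Both sides are bilinear on cochains, so only monomials matter, and for these the classes of the \<open>z i\<close>
  have to be permuted.
\<close>

lemma cls_cup_poly_mult:
  fixes z :: "nat \<Rightarrow> 'v list \<Rightarrow> 'a::comm_ring_1"
  assumes z: "\<And>i. i < r \<Longrightarrow> z i \<in> carrier Z" "\<And>i. i < r \<Longrightarrow> degree_two (z i)"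
  shows "cls (cup_poly z r f) \<otimes>\<^bsub>H\<^esub> cls (cup_poly z r g) = cls (cup_poly z r (f * g))"
proof -
  interpret ring "H :: ('v list \<Rightarrow> 'a) set ring" by (rule ring_cohomology)
  let ?M = "cup_monom z [0..<r]"
  have M: "?M m \<in> carrier Z" for m using z by (intro cup_monom_cocycle) auto
  have "cls (?M (m + n)) = cls (cup (?M m) (?M n))" for m n
  proof -
    have fold: "cls (?M k) = foldr (\<lambda>i h. cls (z i) [^]\<^bsub>H\<^esub> mlookup k i \<otimes>\<^bsub>H\<^esub> h) [0..<r] \<one>\<^bsub>H\<^esub>" for k
      by (rule cls_cup_monom) (use z in auto)
    have "cls (?M (m + n)) = cls (?M m) \<otimes>\<^bsub>H\<^esub> cls (?M n)"
      unfolding fold lookup_add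
    proof (rule foldr_pow_add)
      show "cls (z i) \<in> carrier H" if "i \<in> set [0..<r]" for i
        using that z by (intro cls_carrier) simp
      show "cls (z i) \<otimes>\<^bsub>H\<^esub> cls (z j) = cls (z j) \<otimes>\<^bsub>H\<^esub> cls (z i)"
        if "i \<in> set [0..<r]" "j \<in> set [0..<r]" for i j
        using that z by (intro cls_cup_commute) simp_all
    qed
    then show ?thesis by (simp add: cls_cup M)
  qed
  then have "\<exists>b\<in>cochains C. \<forall>l. cup (?M m) (?M n) l - ?M (m + n) l = differential C b l" for m n
    using cls_eqD[of "cup (?M m) (?M n)" "?M (m + n)"] M cup_cocycle by metis
  then obtain b where b: "\<And>m n. b m n \<in> cochains C"
    "\<And>m n l. cup (?M m) (?M n) l - ?M (m + n) l = differential C (b m n) l"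
    by metis
  let ?b = "\<lambda>l. \<Sum>m\<in>mkeys f. \<Sum>n\<in>mkeys g. mlookup f m * mlookup g n * b m n l"
  have "f * g = (\<Sum>m\<in>mkeys f. \<Sum>n\<in>mkeys g. msingle (m + n) (mlookup f m * mlookup g n))"
    by (subst (1) poly_alg_sum_singles[of f], subst (1) poly_alg_sum_singles[of g])
      (simp add: sum_product mult_single)
  then have fg: "cup_poly z r (f * g) l = (\<Sum>m\<in>mkeys f. \<Sum>n\<in>mkeys g. mlookup f m * mlookup g n * ?M (m + n) l)" for l
    by (simp add: cup_poly_sum cup_poly_single)
  have "cup (cup_poly z r f) (cup_poly z r g) l =
      (\<Sum>m\<in>mkeys f. \<Sum>n\<in>mkeys g. mlookup f m * mlookup g n * cup (?M m) (?M n) l)" for l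
  proof -
    have "cup (cup_poly z r f) (cup_poly z r g) l =
        (\<Sum>i\<le>length l. \<Sum>m\<in>mkeys f. \<Sum>n\<in>mkeys g. mlookup f m * mlookup g n * (?M m (take i l) * ?M n (drop i l)))"
      unfolding cup_def cup_poly_def sum_product by (simp add: mult_ac)
    also have "\<dots> = (\<Sum>m\<in>mkeys f. \<Sum>i\<le>length l. \<Sum>n\<in>mkeys g. mlookup f m * mlookup g n * (?M m (take i l) * ?M n (drop i l)))"
      by (rule sum.swap)
    also have "\<dots> = (\<Sum>m\<in>mkeys f. \<Sum>n\<in>mkeys g. mlookup f m * mlookup g n * cup (?M m) (?M n) l)"
      unfolding cup_def sum_distrib_left by (intro sum.cong refl sum.swap)
    finally show ?thesis .
  qed
  then have "cup (cup_poly z r f) (cup_poly z r g) l - cup_poly z r (f * g) l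
      = (\<Sum>m\<in>mkeys f. \<Sum>n\<in>mkeys g. mlookup f m * mlookup g n * differential C (b m n) l)" for l
    unfolding fg by (simp add: sum_subtractf[symmetric] right_diff_distrib[symmetric] b(2))
  also have "(\<Sum>m\<in>mkeys f. \<Sum>n\<in>mkeys g. mlookup f m * mlookup g n * differential C (b m n) l) = differential C ?b l" for l
    by (simp add: differential_eq bar_diff_sum bar_diff_scale)
  finally have eq: "cup (cup_poly z r f) (cup_poly z r g) l - cup_poly z r (f * g) l = differential C ?b l" for l .
  have sum: "(\<lambda>l. \<Sum>i\<in>A. c i l) \<in> cochains C" if "\<And>i. c i \<in> cochains C"
    for A :: "(nat \<Rightarrow>\<^sub>0 nat) set" and c :: "_ \<Rightarrow> 'v list \<Rightarrow> 'a"
    using that by (induction A rule: infinite_finite_induct) (simp_all add: zero_cochain add_cochain)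
  have "?b \<in> cochains C" by (intro sum scale_cochain b(1))
  then have "cls (cup (cup_poly z r f) (cup_poly z r g)) = cls (cup_poly z r (f * g))"
    using eq z by (intro cls_eqI cup_cocycle cup_poly_cocycle) auto
  then show ?thesis using z by (simp add: cls_cup cup_poly_cocycle)
qed

lemma cls_const_mult:
  "c \<in> carrier Z \<Longrightarrow> cls (const_cochain k) \<otimes>\<^bsub>H\<^esub> cls c = cls (\<lambda>l. k * c l)"
proof -
  assume c: "c \<in> carrier Z"
  have "cup (const_cochain k) c = (\<lambda>l. k * c l)" by (simp add: fun_eq_iff cup_const_left)
  then show ?thesis using cls_cup[OF const_cocycle c] by simp
qed

end

lemma bockstein_map_eq:
  fixes scale :: "'p::prime_card mod_ring \<Rightarrow> 'v::ab_group_add \<Rightarrow> 'v" and cs :: "'v list"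
  assumes "additive_subgroup_set C"
  defines "z \<equiv> \<lambda>i. bockstein_cochain C (form_cochain C (coord scale cs i))"
  assumes z: "\<And>i. i < length cs \<Longrightarrow> z i \<in> carrier (cocycle_ring C)"
  shows "bockstein_map scale C cs f = cohomology_class C (cup_poly z (length cs) f)"
proof -
  interpret additive_subgroup_set C by fact
  have gen: "bockstein_gen scale C cs i = cls (z i)" for i by (simp add: bockstein_gen_def z_def)
  have M: "cup_monom z [0..<length cs] m \<in> carrier Z" for m
    using z by (intro cup_monom_cocycle) auto
  have "bockstein_map scale C cs f =
      (\<Oplus>\<^bsub>H\<^esub>m\<in>mkeys f. cls (const_cochain (mlookup f m)) \<otimes>\<^bsub>H\<^esub> cls (cup_monom z [0..<length cs] m))"
  proof -
    have "cls (cup_monom z [0..<length cs] m) =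
        foldr (\<lambda>i h. cls (z i) [^]\<^bsub>H\<^esub> mlookup m i \<otimes>\<^bsub>H\<^esub> h) [0..<length cs] \<one>\<^bsub>H\<^esub>" for m
      by (rule cls_cup_monom) (use z in auto)
    then show ?thesis unfolding bockstein_map_def gen by simp
  qed
  also have "\<dots> = (\<Oplus>\<^bsub>H\<^esub>m\<in>mkeys f. cls (\<lambda>l. mlookup f m * cup_monom z [0..<length cs] m l))"
    by (simp add: cls_const_mult M)
  also have "\<dots> = cls (cup_poly z (length cs) f)"
    unfolding cup_poly_def[abs_def] by (intro finsum_cls finite_keys scale_cocycle M)
  finally show ?thesis .
qed

section \<open>Shuffles\<close>

text \<open>
  The value of \<open>h\<close> on the shuffle product of two words in the bar construction.
\<close>

fun shuffle :: "('v list \<Rightarrow> 'a::comm_ring_1) \<Rightarrow> 'v list \<Rightarrow> 'v list \<Rightarrow> 'a" where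
  "shuffle h [] v = h v"
| "shuffle h (a # u) [] = h (a # u)"
| "shuffle h (a # u) (b # v) =
     shuffle (\<lambda>w. h (a # w)) u (b # v) + (- 1) ^ Suc (length u) * shuffle (\<lambda>w. h (b # w)) (a # u) v"

lemma shuffle_Nil_right [simp]: "shuffle h u [] = h u"
  by (cases u) simp_all

lemma shuffle_Nil_left: "shuffle h [] = h"
  by (rule ext) simp

lemma shuffle_add: "shuffle (\<lambda>w. h w + h' w) u v = shuffle h u v + shuffle h' u v"
proof (induction h u v arbitrary: h' rule: shuffle.induct)
  case (3 h a u b v)
  show ?case unfolding shuffle.simps 3 by (simp add: algebra_simps)
qed simp_all

lemma shuffle_scale: "shuffle (\<lambda>w. k * h w) u v = k * shuffle h u v"
proof (induction h u v rule: shuffle.induct)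
  case (3 h a u b v)
  show ?case unfolding shuffle.simps 3 by (simp add: algebra_simps)
qed simp_all

lemma shuffle_diff: "shuffle (\<lambda>w. h w - h' w) u v = shuffle h u v - shuffle h' u v"
  using shuffle_add[of h "\<lambda>w. - 1 * h' w" u v] shuffle_scale[of "- 1" h' u v] by simp

lemma shuffle_zero: "shuffle (\<lambda>_. 0) u v = 0"
  using shuffle_scale[of 0 "\<lambda>_. 0"] by simp

lemma shuffle_cong:
  "set u \<subseteq> S \<Longrightarrow> set v \<subseteq> S \<Longrightarrow>
   (\<And>w. set w \<subseteq> S \<Longrightarrow> length w = length u + length v \<Longrightarrow> h w = h' w) \<Longrightarrow> shuffle h u v = shuffle h' u v"
  by (induction h u v arbitrary: h' rule: shuffle.induct) auto

lemma bar_diff_signed: "bar_diff (\<lambda>x. (- 1) ^ length x * G x) l = - ((- 1) ^ length l * bar_diff G l)"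
  using bar_diff_alternate[of G l] by (simp add: alternate_def[abs_def])

text \<open>
  The dual of the fact that the shuffle product satisfies the Leibniz rule. Where a letter \<open>a\<close> of \<open>u\<close>
  and a letter \<open>b\<close> of \<open>v\<close> are merged, the shuffles with \<open>a b\<close> and with \<open>b a\<close> give the same word
  with opposite signs, since \<open>a + b = b + a\<close>.
\<close>

lemma shuffle_bar_diff:
  fixes h :: "'v::ab_group_add list \<Rightarrow> 'a::comm_ring_1"
  shows "shuffle (bar_diff h) u v =
    bar_diff (\<lambda>x. shuffle h x v) u + (- 1) ^ length u * bar_diff (\<lambda>y. shuffle h u y) v"
proof (induction "length u + length v" arbitrary: h u v rule: less_induct)
  case less
  show ?case
  proof (cases u)
    case Nil
    then show ?thesis by (simp add: shuffle_Nil_left)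
  next
    case u: (Cons a u')
    show ?thesis
    proof (cases v)
      case Nil
      then show ?thesis by simp
    next
      case v: (Cons b v')
      define \<epsilon> :: 'a where "\<epsilon> = (- 1) ^ length u'"
      have \<epsilon>: "\<epsilon> * \<epsilon> = 1" by (simp add: \<epsilon>_def flip: power_add)
      define M where "M x h w = (if w = [] then 0 else h w - h ((x + hd w) # tl w) + h (x # tl w))"
        for x and h :: "'v list \<Rightarrow> 'a" and w
      have rec: "bar_diff h (x # w) = M x h w - bar_diff (\<lambda>w. h (x # w)) w" for x w and h :: "'v list \<Rightarrow> 'a"
        unfolding M_def by (rule bar_diff_Cons)
      let ?ha = "\<lambda>w. h (a # w)" and ?hb = "\<lambda>w. h (b # w)"
      have IHa: "shuffle (bar_diff ?ha) u' v =
          bar_diff (\<lambda>x. shuffle ?ha x v) u' + \<epsilon> * bar_diff (\<lambda>y. shuffle ?ha u' y) v"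
        unfolding \<epsilon>_def by (rule less) (simp add: u v)
      have IHb: "shuffle (bar_diff ?hb) u v' =
          bar_diff (\<lambda>x. shuffle ?hb x v') u - \<epsilon> * bar_diff (\<lambda>y. shuffle ?hb u y) v'"
        using less[of u v' ?hb] by (simp add: u v \<epsilon>_def)
      have lhs: "shuffle (bar_diff h) u v =
          shuffle (M a h) u' v - shuffle (bar_diff ?ha) u' v - \<epsilon> * (shuffle (M b h) u v' - shuffle (bar_diff ?hb) u v')"
        by (simp add: u v rec shuffle_diff \<epsilon>_def)
      have r1: "bar_diff (\<lambda>x. shuffle h x v) u = M a (\<lambda>x. shuffle h x v) u' -
          (bar_diff (\<lambda>x. shuffle ?ha x v) u' + \<epsilon> * bar_diff (\<lambda>x. shuffle ?hb (a # x) v') u')"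
        by (simp add: u rec v bar_diff_diff bar_diff_signed \<epsilon>_def)
      have r2: "bar_diff (\<lambda>y. shuffle h u y) v = M b (\<lambda>y. shuffle h u y) v' -
          (bar_diff (\<lambda>y. shuffle ?ha u' (b # y)) v' - \<epsilon> * bar_diff (\<lambda>y. shuffle ?hb u y) v')"
        by (simp add: v rec u bar_diff_diff bar_diff_scale \<epsilon>_def)
      have r3: "bar_diff (\<lambda>x. shuffle ?hb x v') u = M a (\<lambda>x. shuffle ?hb x v') u' - bar_diff (\<lambda>x. shuffle ?hb (a # x) v') u'"
        by (simp add: u rec)
      have r4: "bar_diff (\<lambda>y. shuffle ?ha u' y) v = M b (\<lambda>y. shuffle ?ha u' y) v' - bar_diff (\<lambda>y. shuffle ?ha u' (b # y)) v'"
        by (simp add: v rec)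
      have M: "shuffle (M a h) u' v - \<epsilon> * shuffle (M b h) u v' =
          M a (\<lambda>x. shuffle h x v) u' - \<epsilon> * M b (\<lambda>y. shuffle h u y) v'
          + \<epsilon> * M b (\<lambda>y. shuffle ?ha u' y) v' - \<epsilon> * M a (\<lambda>x. shuffle ?hb x v') u'"
        using \<epsilon> by (cases u'; cases v')
          (simp_all add: u v M_def \<epsilon>_def shuffle_add shuffle_diff algebra_simps)
      have "shuffle (bar_diff h) u v = bar_diff (\<lambda>x. shuffle h x v) u - \<epsilon> * bar_diff (\<lambda>y. shuffle h u y) v"
        unfolding lhs IHa IHb r1 r2 r3 r4 using M \<epsilon> by (simp add: algebra_simps)
      then show ?thesis by (simp add: u \<epsilon>_def)
    qed
  qed
qed

definition vanishes_on :: "('v list \<Rightarrow> 'a::zero) \<Rightarrow> 'v set \<Rightarrow> bool" where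
  "vanishes_on z S \<longleftrightarrow> (\<forall>a\<in>S. \<forall>b. z [a, b] = 0 \<and> z [b, a] = 0)"

section \<open>Slant products with the even cycles of a cyclic subgroup\<close>

context
  fixes scale :: "'p::prime_card mod_ring \<Rightarrow> 'v::ab_group_add \<Rightarrow> 'v"
  assumes vs: "vector_space scale"
begin

interpretation vector_space scale by (rule vs)

text \<open>
  The value of \<open>F\<close> on the sum of all words \<open>[k\<^sub>1 s, s, k\<^sub>2 s, s, \<dots>, k\<^sub>n s, s]\<close>, a cycle that generates the homology
  in degree \<open>2 n\<close> of the cyclic group generated by \<open>s\<close>.
\<close>

primrec cyc_eval :: "nat \<Rightarrow> 'v \<Rightarrow> ('v list \<Rightarrow> 'p mod_ring) \<Rightarrow> 'p mod_ring" where
  "cyc_eval 0 s F = F []"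
| "cyc_eval (Suc n) s F = (\<Sum>k\<in>UNIV. cyc_eval n s (\<lambda>w. F (scale k s # s # w)))"

lemma cyc_eval_add: "cyc_eval n s (\<lambda>w. F w + G w) = cyc_eval n s F + cyc_eval n s G"
  and cyc_eval_diff: "cyc_eval n s (\<lambda>w. F w - G w) = cyc_eval n s F - cyc_eval n s G"
  and cyc_eval_scale: "cyc_eval n s (\<lambda>w. c * F w) = c * cyc_eval n s F"
  by (induction n arbitrary: F G) (simp_all add: sum.distrib sum_subtractf sum_distrib_left)

lemma cyc_eval_zero: "cyc_eval n s (\<lambda>_. 0) = 0"
  using cyc_eval_scale[of n s 0 "\<lambda>_. 0"] by simp

lemma cyc_eval_sum: "cyc_eval n s (\<lambda>w. \<Sum>i\<in>A. F i w) = (\<Sum>i\<in>A. cyc_eval n s (F i))"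
  by (induction A rule: infinite_finite_induct) (simp_all add: cyc_eval_zero cyc_eval_add)

definition multiples :: "'v \<Rightarrow> 'v set" where "multiples s = range (\<lambda>k. scale k s)"

lemma self_in_multiples: "s \<in> multiples s"
  unfolding multiples_def by (rule range_eqI[of _ _ 1]) simp

lemma scale_in_multiples: "scale k s \<in> multiples s"
  unfolding multiples_def by (rule rangeI)

lemma cyc_eval_cong:
  "(\<And>w. set w \<subseteq> multiples s \<Longrightarrow> length w = 2 * n \<Longrightarrow> F w = G w) \<Longrightarrow> cyc_eval n s F = cyc_eval n s G"
proof (induction n arbitrary: F G)
  case (Suc n)
  have "cyc_eval n s (\<lambda>w. F (scale k s # s # w)) = cyc_eval n s (\<lambda>w. G (scale k s # s # w))" for k
  proof (rule Suc.IH)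
    fix w assume "set w \<subseteq> multiples s" "length w = 2 * n"
    then show "F (scale k s # s # w) = G (scale k s # s # w)"
      by (intro Suc.prems) (simp_all add: self_in_multiples scale_in_multiples)
  qed
  then show ?case by simp
qed simp

lemma sum_shift: "(\<Sum>k\<in>UNIV. g (s + scale k s)) = (\<Sum>k\<in>UNIV. g (scale k s))"
proof -
  have "(\<Sum>k\<in>UNIV. g (s + scale k s)) = (\<Sum>k\<in>UNIV. g (scale (1 + k) s))"
    by (simp add: scale_left_distrib)
  also have "\<dots> = (\<Sum>k\<in>UNIV. g (scale k s))"
    by (rule sum.reindex_bij_betw[of "(+) 1" UNIV UNIV "\<lambda>k. g (scale k s)"])
      (rule bij_betwI[where g = "\<lambda>k. k - 1"], auto)
  finally show ?thesis .
qed

text \<open>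
  Merging \<open>k s\<close> with a neighbour \<open>s\<close> only reindexes the sum over \<open>k\<close>. Hence the merges on the two sides
  of an entry \<open>s\<close> cancel, where the deletion of the last letter counts as the second merge of that
  letter. Deletion of the first letter leaves words that occur \<open>p\<close> times.
\<close>

lemma cyc_eval_bar_diff: "cyc_eval n s (bar_diff F) = 0"
proof (induction n arbitrary: F)
  case (Suc n)
  have e: "bar_diff F (a # s # w) = F (s # w) - F ((s + a) # w) + F (a # w) - bar_diff (\<lambda>w. F (a # w)) (s # w)" for a w
    by (simp add: bar_diff_Cons_Cons add.commute)
  have shift: "(\<Sum>k\<in>UNIV. cyc_eval n s (\<lambda>w. F ((s + scale k s) # w))) = (\<Sum>k\<in>UNIV. cyc_eval n s (\<lambda>w. F (scale k s # w)))"
    by (rule sum_shift[where g = "\<lambda>a. cyc_eval n s (\<lambda>w. F (a # w))"])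
  have "cyc_eval (Suc n) s (bar_diff F) = - (\<Sum>k\<in>UNIV. cyc_eval n s (\<lambda>w. bar_diff (\<lambda>w. F (scale k s # w)) (s # w)))"
    by (simp add: e cyc_eval_add cyc_eval_diff sum.distrib sum_subtractf shift)
  also have "(\<Sum>k\<in>UNIV. cyc_eval n s (\<lambda>w. bar_diff (\<lambda>w. F (scale k s # w)) (s # w))) = 0"
  proof (cases n)
    case 0
    then show ?thesis by simp
  next
    case (Suc m)
    define G where "G a w = F (a # w)" for a w
    have e': "bar_diff (G a) (s # b # s # w) =
        G a (b # s # w) - G a ((s + b) # s # w) + G a (s # s # w) - bar_diff (\<lambda>w. G a (s # w)) (b # s # w)" for a b w
      by (simp add: bar_diff_Cons_Cons)
    have shift': "(\<Sum>j\<in>UNIV. cyc_eval m s (\<lambda>w. G a ((s + scale j s) # s # w))) = (\<Sum>j\<in>UNIV. cyc_eval m s (\<lambda>w. G a (scale j s # s # w)))" for a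
      by (rule sum_shift[where g = "\<lambda>b. cyc_eval m s (\<lambda>w. G a (b # s # w))"])
    have "cyc_eval n s (\<lambda>w. bar_diff (G a) (s # w)) = - cyc_eval n s (bar_diff (\<lambda>w. G a (s # w)))" for a
      by (simp add: Suc e' cyc_eval_add cyc_eval_diff sum.distrib sum_subtractf shift')
    then have "cyc_eval n s (\<lambda>w. bar_diff (G (scale k s)) (s # w)) = 0" for k
      by (simp add: Suc.IH)
    then show ?thesis by (simp add: G_def[abs_def])
  qed
  finally show ?case by simp
qed simp

text \<open>
  The slant product with that cycle, along the addition map from \<open>C\<close> times the cyclic group to \<open>C\<close>.
\<close>

definition slant :: "nat \<Rightarrow> 'v \<Rightarrow> ('v list \<Rightarrow> 'p mod_ring) \<Rightarrow> 'v list \<Rightarrow> 'p mod_ring" where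
  "slant n s h l = cyc_eval n s (\<lambda>w. shuffle h w l)"

lemma cyc_eval_bar_diff_swap: "cyc_eval n s (\<lambda>w. bar_diff (Q w) l) = bar_diff (\<lambda>y. cyc_eval n s (\<lambda>w. Q w y)) l"
proof (cases "l = []")
  case False
  then show ?thesis by (simp only: bar_diff_def if_False cyc_eval_sum cyc_eval_scale)
qed (simp add: cyc_eval_zero)

lemma slant_bar_diff: "slant n s (bar_diff h) = bar_diff (slant n s h)"
proof
  fix l
  have "slant n s (bar_diff h) l =
      cyc_eval n s (\<lambda>w. bar_diff (\<lambda>x. shuffle h x l) w + (- 1) ^ length w * bar_diff (\<lambda>y. shuffle h w y) l)"
    by (simp add: slant_def shuffle_bar_diff)
  also have "\<dots> = cyc_eval n s (\<lambda>w. (- 1) ^ length w * bar_diff (\<lambda>y. shuffle h w y) l)"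
    by (simp add: cyc_eval_add cyc_eval_bar_diff)
  also have "\<dots> = cyc_eval n s (\<lambda>w. bar_diff (\<lambda>y. shuffle h w y) l)"
    by (rule cyc_eval_cong) simp
  also have "\<dots> = bar_diff (slant n s h) l"
    unfolding cyc_eval_bar_diff_swap slant_def[abs_def] ..
  finally show "slant n s (bar_diff h) l = bar_diff (slant n s h) l" .
qed

lemma slant_add: "slant n s (\<lambda>w. h w + h' w) = (\<lambda>l. slant n s h l + slant n s h' l)"
  and slant_scale: "slant n s (\<lambda>w. c * h w) = (\<lambda>l. c * slant n s h l)"
  by (simp_all add: fun_eq_iff slant_def shuffle_add shuffle_scale cyc_eval_add cyc_eval_scale)

lemma slant_cong:
  assumes "multiples s \<subseteq> S" "set l \<subseteq> S" "\<And>w. set w \<subseteq> S \<Longrightarrow> length w = 2 * n + length l \<Longrightarrow> h w = h' w"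
  shows "slant n s h l = slant n s h' l"
  unfolding slant_def
  by (intro cyc_eval_cong shuffle_cong[where S = S]) (use assms in auto)

text \<open>
  The cochain \<open>z\<close> of degree 2 reads the first two letters of a shuffle. It vanishes on them unless both
  come from \<open>l\<close>.
\<close>

lemma shuffle_cup_right:
  assumes z: "degree_two z" "vanishes_on z S" and w: "set w \<subseteq> S"
  shows "shuffle (cup z h) w l = cup z (shuffle h w) l"
proof (cases w)
  case Nil
  then show ?thesis by (simp add: shuffle_Nil_left)
next
  case (Cons c w')
  have c: "z [c, b] = 0" "z [b, c] = 0" for b using z(2) w Cons by (auto simp: vanishes_on_def)
  note cup = cup_degree_two[OF z(1)]
  have 0: "(\<lambda>x. cup z h (c # x)) = (\<lambda>_. 0)"
  proof
    fix x show "cup z h (c # x) = 0" by (cases x) (simp_all add: cup c)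
  qed
  show ?thesis
  proof (cases l rule: remdups_adj.cases)
    case 1
    then show ?thesis using fun_cong[OF 0, of w'] Cons by (simp add: cup del: cup_Nil)
  next
    case (2 a)
    then show ?thesis using Cons by (simp add: 0 shuffle_zero cup c del: cup_Nil)
  next
    case (3 a b m)
    have "shuffle (\<lambda>x. cup z h (a # x)) (c # w') (b # m) = (- 1) ^ Suc (length w') * (z [a, b] * shuffle h (c # w') m)"
      by (simp add: cup c shuffle_zero shuffle_scale)
    then show ?thesis using Cons 3 by (simp add: 0 shuffle_zero cup flip: power_add)
  qed
qed

lemma shuffle_cup_left:
  assumes z: "degree_two z" "vanishes_on z S" and l: "set l \<subseteq> S"
  shows "shuffle (cup z h) (c # d # w) l = z [c, d] * shuffle h w l"
proof (cases l)
  case Nil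
  then show ?thesis by (simp add: cup_degree_two[OF z(1)])
next
  case (Cons a l')
  have a: "z [a, b] = 0" "z [b, a] = 0" for b using z(2) l Cons by (auto simp: vanishes_on_def)
  note cup = cup_degree_two[OF z(1)]
  have 0: "(\<lambda>x. cup z h (a # x)) = (\<lambda>_. 0)"
  proof
    fix x show "cup z h (a # x) = 0" by (cases x) (simp_all add: cup a)
  qed
  show ?thesis by (simp add: Cons 0 shuffle_zero shuffle_scale cup a)
qed

lemma slant_cup_right:
  assumes "degree_two z" "vanishes_on z (multiples s)"
  shows "slant n s (cup z h) = cup z (slant n s h)"
proof
  fix l
  have "slant n s (cup z h) l = cyc_eval n s (\<lambda>w. cup z (shuffle h w) l)"
    unfolding slant_def by (rule cyc_eval_cong) (rule shuffle_cup_right[OF assms])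
  also have "\<dots> = cup z (slant n s h) l"
    by (cases l rule: remdups_adj.cases) (simp_all add: cup_degree_two[OF assms(1)] cyc_eval_zero cyc_eval_scale slant_def)
  finally show "slant n s (cup z h) l = cup z (slant n s h) l" .
qed

text \<open>
  If \<open>z\<close> ignores the letters of \<open>l\<close>, it has to read the first two letters \<open>[k s, s]\<close> of the cycle. What
  remains is the cycle of degree \<open>2 (n - 1)\<close>.
\<close>

lemma slant_cup_left:
  assumes z: "degree_two z" "vanishes_on z S" and l: "set l \<subseteq> S" and norm: "(\<Sum>k\<in>UNIV. z [scale k s, s]) = 1"
  shows "slant n s (cup z h) l = (case n of 0 \<Rightarrow> 0 | Suc m \<Rightarrow> slant m s h l)"
proof (cases n)
  case 0
  have "cup z h l = 0"
    using l z(2) by (cases l rule: remdups_adj.cases) (use z(1) in \<open>auto simp: cup_degree_two[OF z(1)] vanishes_on_def degree_two_def\<close>)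
  then show ?thesis by (simp add: 0 slant_def)
next
  case (Suc m)
  then show ?thesis
    by (simp add: slant_def shuffle_cup_left[OF z l] cyc_eval_scale norm flip: sum_distrib_right)
qed

section \<open>The retraction onto polynomials\<close>

text \<open>
  The value of \<open>h\<close> on the product of the cycles of degree \<open>2 n\<close> for \<open>s\<close>, taken over the pairs \<open>(n, s)\<close>.
\<close>

primrec pairing :: "(nat \<times> 'v) list \<Rightarrow> ('v list \<Rightarrow> 'p mod_ring) \<Rightarrow> 'p mod_ring" where
  "pairing [] h = h []"
| "pairing (p # ps) h = pairing ps (slant (fst p) (snd p) h)"

lemma pairing_bar_diff: "pairing ps (bar_diff h) = 0"
  by (induction ps arbitrary: h) (simp_all add: slant_bar_diff)

lemma pairing_add: "pairing ps (\<lambda>w. h w + h' w) = pairing ps h + pairing ps h'"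
  and pairing_scale: "pairing ps (\<lambda>w. c * h w) = c * pairing ps h"
  by (induction ps arbitrary: h h') (simp_all add: slant_add slant_scale)

lemma pairing_zero: "pairing ps (\<lambda>_. 0) = 0"
  using pairing_scale[of ps 0 "\<lambda>_. 0"] by simp

definition letters :: "(nat \<times> 'v) list \<Rightarrow> 'v set" where
  "letters ps = (\<Union>p\<in>set ps. multiples (snd p))"

lemma pairing_cong:
  "(\<And>w. set w \<subseteq> letters ps \<Longrightarrow> length w = 2 * sum_list (map fst ps) \<Longrightarrow> h w = h' w) \<Longrightarrow>
    pairing ps h = pairing ps h'"
proof (induction ps arbitrary: h h')
  case (Cons p ps)
  have "slant (fst p) (snd p) h l = slant (fst p) (snd p) h' l"
    if "set l \<subseteq> letters ps" "length l = 2 * sum_list (map fst ps)" for l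
    using that by (intro slant_cong[where S = "letters (p # ps)"] Cons.prems) (auto simp: letters_def)
  then have "pairing ps (slant (fst p) (snd p) h) = pairing ps (slant (fst p) (snd p) h')"
    by (rule Cons.IH)
  then show ?case by simp
qed simp

text \<open>
  Capping with \<open>z\<close> lowers the exponent of the cycle for \<open>s\<close> by one, if \<open>z\<close> ignores the other letters.
\<close>

lemma pairing_cup:
  assumes z: "degree_two z" "vanishes_on z (letters ps)" "vanishes_on z (letters qs)"
    and norm: "(\<Sum>k\<in>UNIV. z [scale k s, s]) = 1"
  shows "pairing (ps @ (n, s) # qs) (cup z h) = (case n of 0 \<Rightarrow> 0 | Suc m \<Rightarrow> pairing (ps @ (m, s) # qs) h)"
  using z(2)
proof (induction ps arbitrary: h)
  case Nil
  have "pairing qs (slant n s (cup z h)) = pairing qs (\<lambda>l. case n of 0 \<Rightarrow> 0 | Suc m \<Rightarrow> slant m s h l)"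
    by (rule pairing_cong) (rule slant_cup_left[OF z(1,3) _ norm])
  then show ?case by (simp add: pairing_zero split: nat.split)
next
  case (Cons p ps)
  then have "vanishes_on z (multiples (snd p))" "vanishes_on z (letters ps)"
    by (auto simp: vanishes_on_def letters_def)
  then show ?case using Cons.IH by (simp add: slant_cup_right[OF z(1)] split: nat.split)
qed

definition pairing_list :: "'v list \<Rightarrow> (nat \<Rightarrow>\<^sub>0 nat) \<Rightarrow> (nat \<times> 'v) list" where
  "pairing_list cs m = map (\<lambda>i. (mlookup m i, cs ! i)) [0..<length cs]"

text \<open>
  The products of cycles, indexed by monomials \<open>m\<close>, are dual to the monomials in the Bockstein classes.
  So these are the coefficients of the polynomial part of \<open>h\<close>.
\<close>

definition retract_coeff :: "'v list \<Rightarrow> ('v list \<Rightarrow> 'p mod_ring) \<Rightarrow> (nat \<Rightarrow>\<^sub>0 nat) \<Rightarrow> 'p mod_ring" where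
  "retract_coeff cs h m = (if mkeys m \<subseteq> {..<length cs} then pairing (pairing_list cs m) h else 0)"

definition retract :: "'v list \<Rightarrow> ('v list \<Rightarrow> 'p mod_ring) \<Rightarrow> 'p mod_ring poly_alg" where
  "retract cs h = Abs_poly_mapping (retract_coeff cs h)"

lemma sum_pairing_list:
  "mkeys m \<subseteq> {..<length cs} \<Longrightarrow> sum_list (map fst (pairing_list cs m)) = (\<Sum>i\<in>mkeys m. mlookup m i)"
proof -
  assume m: "mkeys m \<subseteq> {..<length cs}"
  have "sum_list (map fst (pairing_list cs m)) = (\<Sum>i\<in>{..<length cs}. mlookup m i)"
    by (simp add: pairing_list_def o_def interv_sum_list_conv_sum_set_nat atLeast0LessThan)
  also have "\<dots> = (\<Sum>i\<in>mkeys m. mlookup m i)"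
    by (rule sum.mono_neutral_right) (use m in \<open>auto simp: in_keys_iff\<close>)
  finally show ?thesis .
qed

lemma finite_bounded_monomials: "finite {m. mkeys m \<subseteq> {..<r} \<and> (\<Sum>i\<in>mkeys m. mlookup m i) < N}"
  for r N :: nat
proof -
  let ?M = "{m. mkeys m \<subseteq> {..<r} \<and> (\<Sum>i\<in>mkeys m. mlookup m i) < N}"
  have "(\<lambda>m. restrict (mlookup m) {..<r}) ` ?M \<subseteq> {..<r} \<rightarrow>\<^sub>E {..<N}"
  proof
    fix g assume "g \<in> (\<lambda>m. restrict (mlookup m) {..<r}) ` ?M"
    then obtain m where m: "g = restrict (mlookup m) {..<r}" "m \<in> ?M" by blast
    have "mlookup m i < N" for i
    proof (cases "i \<in> mkeys m")
      case True
      then have "mlookup m i \<le> (\<Sum>i\<in>mkeys m. mlookup m i)" by (intro member_le_sum) auto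
      then show ?thesis using m by auto
    next
      case False
      then show ?thesis using m by (auto simp: in_keys_iff)
    qed
    then show "g \<in> {..<r} \<rightarrow>\<^sub>E {..<N}" using m by auto
  qed
  then have "finite ((\<lambda>m. restrict (mlookup m) {..<r}) ` ?M)"
    by (rule finite_subset) (auto intro: finite_PiE)
  moreover have "inj_on (\<lambda>m. restrict (mlookup m) {..<r}) ?M"
  proof (rule inj_onI)
    fix m m' assume m: "m \<in> ?M" "m' \<in> ?M" "restrict (mlookup m) {..<r} = restrict (mlookup m') {..<r}"
    show "m = m'"
    proof (rule poly_mapping_eqI)
      fix i show "mlookup m i = mlookup m' i"
      proof (cases "i < r")
        case True
        then show ?thesis using fun_cong[OF m(3), of i] by simp
      next
        case False
        then have "i \<notin> mkeys m" "i \<notin> mkeys m'" using m by auto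
        then show ?thesis by (simp add: in_keys_iff)
      qed
    qed
  qed
  ultimately show ?thesis by (rule finite_imageD)
qed

lemma lookup_retract:
  assumes "\<And>l. N \<le> length l \<Longrightarrow> h l = 0"
  shows "mlookup (retract cs h) m = retract_coeff cs h m"
proof -
  have "pairing (pairing_list cs m) h = 0" if "mkeys m \<subseteq> {..<length cs}" "N \<le> (\<Sum>i\<in>mkeys m. mlookup m i)" for m
  proof -
    have "pairing (pairing_list cs m) h = pairing (pairing_list cs m) (\<lambda>_. 0)"
      by (rule pairing_cong) (use that assms in \<open>simp add: sum_pairing_list\<close>)
    then show ?thesis by (simp add: pairing_zero)
  qed
  then have "{m. retract_coeff cs h m \<noteq> 0} \<subseteq> {m. mkeys m \<subseteq> {..<length cs} \<and> (\<Sum>i\<in>mkeys m. mlookup m i) < N}"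
    by (auto simp: retract_coeff_def not_less[symmetric])
  then have "finite {m. retract_coeff cs h m \<noteq> 0}" by (rule finite_subset) (rule finite_bounded_monomials)
  then show ?thesis by (simp add: retract_def)
qed

end

lemma lookup_var_mult:
  "mlookup (poly_var i * g) m = (if 0 < mlookup m i then mlookup g (m - msingle i 1) else 0)"
  for g :: "'k::comm_ring_1 poly_alg"
proof -
  have "poly_var i * g = (\<Sum>k\<in>mkeys g. msingle (msingle i 1 + k) (mlookup g k))"
    by (subst (1) poly_alg_sum_singles[of g]) (simp add: poly_var_def sum_distrib_left mult_single)
  then have eq: "mlookup (poly_var i * g) m = (\<Sum>k\<in>mkeys g. if msingle i 1 + k = m then mlookup g k else 0)"
    by (simp add: lookup_sum lookup_single when_def)
  show ?thesis
  proof (cases "0 < mlookup m i")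
    case True
    have "msingle i 1 + k = m \<longleftrightarrow> k = m - msingle i 1" for k
    proof
      assume "k = m - msingle i 1"
      then show "msingle i 1 + k = m"
        using True by (intro poly_mapping_eqI) (auto simp: lookup_add lookup_minus lookup_single when_def)
    qed auto
    then show ?thesis using True by (simp add: eq in_keys_iff)
  next
    case False
    have "msingle i 1 + k \<noteq> m" for k
    proof
      assume "msingle i 1 + k = m"
      then have "mlookup m i = 1 + mlookup k i" by (auto simp: lookup_add)
      then show False using False by simp
    qed
    then show ?thesis using False by (simp add: eq)
  qed
qed

section \<open>Polynomials as a direct summand of the cohomology\<close>

lemma additive_subgroup_subspace:
  assumes "vector_space scale" "Modules.module.subspace scale C"
  shows "additive_subgroup_set C"
proof -
  interpret vector_space scale by fact
  show ?thesis using assms(2) by unfold_locales (auto intro: subspace_0 subspace_add)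
qed

lemma to_int_mod_ring_range:
  fixes a :: "'p::prime_card mod_ring"
  shows "0 \<le> to_int_mod_ring a" "to_int_mod_ring a < int CARD('p)"
  using range_to_int_mod_ring[where 'a = 'p] by auto

lemma to_int_mod_ring_0: "to_int_mod_ring (0 :: 'p::prime_card mod_ring) = 0"
  by (simp add: to_int_mod_ring.rep_eq zero_mod_ring.rep_eq)

lemma to_int_mod_ring_1: "to_int_mod_ring (1 :: 'p::prime_card mod_ring) = 1"
  by (simp add: to_int_mod_ring.rep_eq one_mod_ring.rep_eq)

text \<open>
  A carry only occurs for \<open>k = p - 1\<close>.
\<close>

lemma sum_carries:
  "(\<Sum>k\<in>(UNIV :: 'p::prime_card mod_ring set). of_int ((1 - to_int_mod_ring (k + 1) + to_int_mod_ring k) div int CARD('p))) =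
    (1 :: 'p mod_ring)"
proof -
  let ?p = "int CARD('p)"
  have p: "?p > 1" using prime_gt_1_nat[OF prime_card[where 'a = 'p]] by simp
  define k0 :: "'p mod_ring" where "k0 = of_int_mod_ring (?p - 1)"
  have k0: "to_int_mod_ring k0 = ?p - 1" unfolding k0_def using p by simp
  have "of_int ((1 - to_int_mod_ring (k + 1) + to_int_mod_ring k) div ?p) =
      (if k = k0 then 1 else 0 :: 'p mod_ring)" for k
  proof (cases "k = k0")
    case True
    then show ?thesis using p by (simp add: to_int_mod_ring_add k0 to_int_mod_ring_1)
  next
    case False
    have "k = k0" if "to_int_mod_ring k = ?p - 1"
      unfolding k0_def that[symmetric] by simp
    then have "to_int_mod_ring k \<noteq> ?p - 1" using False by blast
    then have "to_int_mod_ring (k + 1) = to_int_mod_ring k + 1"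
      using to_int_mod_ring_range[of k] by (simp add: to_int_mod_ring_add to_int_mod_ring_1)
    then show ?thesis using False p by simp
  qed
  then show ?thesis by simp
qed

lemma finsum_module_via: "finsum (module_via h S) = finsum S"
  by (simp add: finsum_def finprod_def module_via_def fun_eq_iff)

locale bockstein_setting =
  fixes scale :: "'p::prime_card mod_ring \<Rightarrow> 'v::ab_group_add \<Rightarrow> 'v" and C :: "'v set" and cs :: "'v list"
  assumes vs: "vector_space scale" and C: "Modules.module.subspace scale C" and cs: "basis_list scale C cs"
begin

sublocale additive_subgroup_set C
  using additive_subgroup_subspace[OF vs C] .

sublocale vector_space scale by (rule vs)

definition bock :: "nat \<Rightarrow> 'v list \<Rightarrow> 'p mod_ring" where
  "bock i = bockstein_cochain C (form_cochain C (coord scale cs i))"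

lemma cs_C: "i < length cs \<Longrightarrow> cs ! i \<in> C"
  using cs span_superset[of "set cs"] by (auto simp: basis_list_def)

lemma bock_cocycle: "bock i \<in> carrier Z"
  and bock_degree: "degree_two (bock i)"
  and bock_value: "a \<in> C \<Longrightarrow> b \<in> C \<Longrightarrow> bock i [a, b] = of_int ((to_int_mod_ring (coord scale cs i b)
      - to_int_mod_ring (coord scale cs i (a + b)) + to_int_mod_ring (coord scale cs i a)) div int CARD('p))"
proof -
  have sub: "additive_subgroup_set C" by unfold_locales
  note b = bockstein_form[OF sub, of "coord scale cs i", OF coord_add[OF cs], folded bock_def]
  show "bock i \<in> carrier Z" "degree_two (bock i)" using b(1,2) by auto
  show "a \<in> C \<Longrightarrow> b \<in> C \<Longrightarrow> bock i [a, b] = of_int ((to_int_mod_ring (coord scale cs i b)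
      - to_int_mod_ring (coord scale cs i (a + b)) + to_int_mod_ring (coord scale cs i a)) div int CARD('p))"
    using b(3) by auto
qed

lemma bock_cochain: "bock i \<in> cochains C"
  using bock_cocycle by (simp add: cocycle_ring_simps)

lemma bock_vanishes:
  assumes S: "S \<subseteq> C" "\<And>a. a \<in> S \<Longrightarrow> coord scale cs i a = 0"
  shows "vanishes_on (bock i) S"
  unfolding vanishes_on_def
proof (intro ballI allI)
  fix a b assume a: "a \<in> S"
  show "bock i [a, b] = 0 \<and> bock i [b, a] = 0"
  proof (cases "b \<in> C")
    case True
    then show ?thesis using a S by (auto simp: bock_value coord_add[OF cs] to_int_mod_ring_0 subset_eq)
  next
    case False
    then show ?thesis using cochainsD[OF bock_cochain] by simp
  qed
qed

lemma bock_norm: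
  assumes "i < length cs"
  shows "(\<Sum>k\<in>UNIV. bock i [scale k (cs ! i), cs ! i]) = 1"
proof -
  have i: "coord scale cs i (cs ! i) = 1" "cs ! i \<in> C"
    using assms by (simp_all add: coord_basis[OF cs] cs_C)
  have "scale k (cs ! i) \<in> C" for k using i(2) C by (simp add: subspace_scale)
  then have "bock i [scale k (cs ! i), cs ! i] =
      of_int ((1 - to_int_mod_ring (k + 1) + to_int_mod_ring k) div int CARD('p))" for k
    using i by (simp add: bock_value coord_add[OF cs] coord_scale[OF cs] to_int_mod_ring_1)
  then show ?thesis by (simp add: sum_carries)
qed

abbreviation "\<Phi> \<equiv> retract scale cs"

lemma lookup_\<Phi>: "h \<in> cochains C \<Longrightarrow> mlookup (\<Phi> h) m = retract_coeff scale cs h m"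
  using cochains_bound[of h] lookup_retract[OF vs] by metis

lemma letters_C:
  assumes "\<And>n s. (n, s) \<in> set ps \<Longrightarrow> s \<in> C"
  shows "letters scale ps \<subseteq> C"
  using assms C by (fastforce simp: letters_def[OF vs] multiples_def[OF vs] intro: subspace_scale)

lemma \<Phi>_carrier: "h \<in> cochains C \<Longrightarrow> \<Phi> h \<in> poly_carrier (length cs)"
proof -
  assume h: "h \<in> cochains C"
  have "mkeys m \<subseteq> {..<length cs}" if "m \<in> mkeys (\<Phi> h)" for m
    using that h by (simp add: in_keys_iff[of m] lookup_\<Phi> retract_coeff_def[OF vs] split: if_splits)
  then show ?thesis by (simp add: poly_carrier_def)
qed

lemma \<Phi>_add: "h \<in> cochains C \<Longrightarrow> h' \<in> cochains C \<Longrightarrow> \<Phi> (\<lambda>l. h l + h' l) = \<Phi> h + \<Phi> h'"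
  by (rule poly_mapping_eqI)
    (simp add: lookup_\<Phi> lookup_add add_cochain retract_coeff_def[OF vs] pairing_add[OF vs])

lemma \<Phi>_scale: "h \<in> cochains C \<Longrightarrow> \<Phi> (\<lambda>l. k * h l) = poly_const k * \<Phi> h"
  by (rule poly_mapping_eqI)
    (simp add: lookup_\<Phi> lookup_poly_const_mult scale_cochain retract_coeff_def[OF vs] pairing_scale[OF vs])

lemma \<Phi>_sum:
  assumes "\<And>i. i \<in> A \<Longrightarrow> h i \<in> cochains C" "finite A"
  shows "(\<lambda>l. \<Sum>i\<in>A. h i l) \<in> cochains C \<and> \<Phi> (\<lambda>l. \<Sum>i\<in>A. h i l) = (\<Sum>i\<in>A. \<Phi> (h i))"
  using assms(2,1)
proof (induction A)
  case empty
  then show ?case using \<Phi>_scale[OF zero_cochain, of 0] by (simp add: zero_cochain poly_const_simps)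
next
  case (insert x A)
  then show ?case by (simp add: add_cochain \<Phi>_add)
qed

lemma \<Phi>_differential:
  assumes "h \<in> cochains C"
  shows "\<Phi> (differential C h) = 0"
proof (rule poly_mapping_eqI)
  fix m
  have "pairing scale (pairing_list cs m) (differential C h) = pairing scale (pairing_list cs m) (bar_diff h)"
  proof (rule pairing_cong[OF vs])
    fix w assume "set w \<subseteq> letters scale (pairing_list cs m)"
    then have "w \<in> lists C"
      using letters_C[of "pairing_list cs m"] cs_C by (fastforce simp: pairing_list_def[OF vs])
    then show "differential C h w = bar_diff h w" by (simp add: differential_eq)
  qed
  then show "mlookup (\<Phi> (differential C h)) m = mlookup 0 m"
    using assms by (simp add: lookup_\<Phi> differential_cochain retract_coeff_def[OF vs] pairing_bar_diff[OF vs])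
qed

lemma \<Phi>_cup_bock:
  assumes h: "h \<in> cochains C" and i: "i < length cs"
  shows "\<Phi> (cup (bock i) h) = poly_var i * \<Phi> h"
proof (rule poly_mapping_eqI)
  fix m
  let ?r = "length cs"
  have upt: "[0..<?r] = [0..<i] @ i # [Suc i..<?r]"
    using upt_add_eq_append[of 0 i "?r - i"] upt_conv_Cons[OF i] i by simp
  define ps where "ps m = map (\<lambda>j. (mlookup m j, cs ! j)) [0..<i]" for m :: "nat \<Rightarrow>\<^sub>0 nat"
  define qs where "qs m = map (\<lambda>j. (mlookup m j, cs ! j)) [Suc i..<?r]" for m :: "nat \<Rightarrow>\<^sub>0 nat"
  have pl: "pairing_list cs m = ps m @ (mlookup m i, cs ! i) # qs m" for m
    by (simp add: pairing_list_def[OF vs] upt ps_def qs_def)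
  have van: "vanishes_on (bock i) (letters scale xs)"
    if xs: "set xs \<subseteq> (\<lambda>j. (mlookup m j, cs ! j)) ` ({..<?r} - {i})" for xs and m :: "nat \<Rightarrow>\<^sub>0 nat"
  proof (rule bock_vanishes)
    show "letters scale xs \<subseteq> C" by (rule letters_C) (use that cs_C in auto)
    fix a assume "a \<in> letters scale xs"
    then obtain k j where "a = scale k (cs ! j)" "j < ?r" "j \<noteq> i"
      using xs by (force simp: letters_def[OF vs] multiples_def[OF vs])
    then show "coord scale cs i a = 0"
      using i by (simp add: coord_scale[OF cs cs_C] coord_basis[OF cs])
  qed
  have van': "vanishes_on (bock i) (letters scale (ps m))" "vanishes_on (bock i) (letters scale (qs m))" for m
    using i by (auto intro!: van[of _ m] simp: ps_def qs_def)
  show "mlookup (\<Phi> (cup (bock i) h)) m = mlookup (poly_var i * \<Phi> h) m"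
  proof (cases "mkeys m \<subseteq> {..<?r}")
    case True
    have lhs: "mlookup (\<Phi> (cup (bock i) h)) m =
        (case mlookup m i of 0 \<Rightarrow> 0 | Suc k \<Rightarrow> pairing scale (ps m @ (k, cs ! i) # qs m) h)"
      using True h bock_cochain
      by (simp add: lookup_\<Phi> cup_cochain retract_coeff_def[OF vs] pl pairing_cup[OF vs bock_degree van' bock_norm[OF i]])
    show ?thesis
    proof (cases "mlookup m i")
      case 0
      then show ?thesis by (simp add: lhs lookup_var_mult)
    next
      case (Suc k)
      let ?m = "m - msingle i 1"
      have lk: "mlookup ?m j = (if j = i then k else mlookup m j)" for j
        using Suc by (simp add: lookup_minus lookup_single when_def)
      have "mkeys ?m \<subseteq> {..<?r}" using True lk i by (auto simp: in_keys_iff subset_eq split: if_splits)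
      moreover have "pairing_list cs ?m = ps m @ (k, cs ! i) # qs m"
        unfolding pl by (simp add: lk[unfolded One_nat_def] ps_def qs_def)
      ultimately show ?thesis
        using Suc h by (simp add: lhs lookup_var_mult lookup_\<Phi> retract_coeff_def[OF vs])
    qed
  next
    case False
    then obtain j where j: "j \<in> mkeys m" "\<not> j < ?r" by auto
    then have "j \<in> mkeys (m - msingle i 1)"
      using i by (auto simp: in_keys_iff lookup_minus lookup_single when_def)
    then have "\<not> mkeys (m - msingle i 1) \<subseteq> {..<?r}" using j by auto
    then show ?thesis
      using False h bock_cochain by (simp add: lookup_var_mult lookup_\<Phi> cup_cochain retract_coeff_def[OF vs])
  qed
qed

lemma cup_power_cochain: "cup_power (bock i) k \<in> cochains C"
  using cup_power_cocycle[OF bock_cocycle] by (simp add: cocycle_ring_simps)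

lemma \<Phi>_cup_power:
  "h \<in> cochains C \<Longrightarrow> i < length cs \<Longrightarrow> \<Phi> (cup (cup_power (bock i) k) h) = poly_var i ^ k * \<Phi> h"
proof (induction k)
  case 0
  have "cup (const_cochain 1) h = h" by (simp add: fun_eq_iff cup_const_left)
  then show ?case by (simp add: cup_power_def)
next
  case (Suc k)
  have "cup (cup_power (bock i) (Suc k)) h = cup (bock i) (cup (cup_power (bock i) k) h)"
    by (simp add: fun_eq_iff cup_power_def cup_assoc)
  then show ?case
    using Suc by (simp add: \<Phi>_cup_bock cup_cochain cup_power_cochain mult.assoc)
qed

lemma \<Phi>_cup_monom:
  "h \<in> cochains C \<Longrightarrow> distinct is \<Longrightarrow> set is \<subseteq> {..<length cs} \<Longrightarrow>
    \<Phi> (cup (cup_monom bock is m) h) = (\<Prod>i\<in>set is. poly_var i ^ mlookup m i) * \<Phi> h"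
proof (induction "is")
  case Nil
  have "cup (const_cochain 1) h = h" by (simp add: fun_eq_iff cup_const_left)
  then show ?case by (simp add: cup_monom_def)
next
  case (Cons i "is")
  have "cup_monom bock is m \<in> carrier Z" by (rule cup_monom_cocycle) (rule bock_cocycle)
  then have "cup (cup_monom bock is m) h \<in> cochains C"
    using Cons.prems by (intro cup_cochain) (simp_all add: cocycle_ring_simps)
  moreover have "cup (cup_monom bock (i # is) m) h = cup (cup_power (bock i) (mlookup m i)) (cup (cup_monom bock is m) h)"
    by (simp add: fun_eq_iff cup_monom_def cup_assoc)
  ultimately show ?case using Cons by (simp add: \<Phi>_cup_power mult.assoc)
qed

lemma cup_sum_left: "cup (\<lambda>l. \<Sum>i\<in>A. c i l) d l = (\<Sum>i\<in>A. cup (c i) d l)"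
  by (induction A rule: infinite_finite_induct) (simp_all add: cup_zero_left cup_add_left)

text \<open>
  The retraction is linear over the polynomials. On the variables this is the recursion
  \<open>pairing_cup\<close>.
\<close>

lemma \<Phi>_cup_poly:
  assumes f: "f \<in> poly_carrier (length cs)" and h: "h \<in> cochains C"
  shows "\<Phi> (cup (cup_poly bock (length cs) f) h) = f * \<Phi> h"
proof -
  let ?M = "cup_monom bock [0..<length cs]"
  have "?M m \<in> carrier Z" for m by (rule cup_monom_cocycle) (rule bock_cocycle)
  then have M: "cup (?M m) h \<in> cochains C" for m
    using h by (intro cup_cochain) (simp_all add: cocycle_ring_simps)
  have "cup (cup_poly bock (length cs) f) h = (\<lambda>l. \<Sum>m\<in>mkeys f. mlookup f m * cup (?M m) h l)"
    by (simp add: fun_eq_iff cup_poly_def[abs_def] cup_sum_left cup_scale_left)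
  then have "\<Phi> (cup (cup_poly bock (length cs) f) h) = (\<Sum>m\<in>mkeys f. \<Phi> (\<lambda>l. mlookup f m * cup (?M m) h l))"
    using \<Phi>_sum[of "mkeys f" "\<lambda>m l. mlookup f m * cup (?M m) h l"] M by (simp add: scale_cochain)
  also have "\<dots> = (\<Sum>m\<in>mkeys f. poly_const (mlookup f m) * monom_eval poly_var m * \<Phi> h)"
  proof (intro sum.cong refl)
    fix m assume m: "m \<in> mkeys f"
    have "(\<Prod>i\<in>set [0..<length cs]. poly_var i ^ mlookup m i) = (monom_eval poly_var m :: 'p mod_ring poly_alg)"
    proof (rule monom_eval_superset[symmetric])
      show "mkeys m \<subseteq> set [0..<length cs]"
        using m f unfolding poly_carrier_def atLeast_upt by blast
    qed simp
    then show "\<Phi> (\<lambda>l. mlookup f m * cup (?M m) h l) = poly_const (mlookup f m) * monom_eval poly_var m * \<Phi> h"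
      using h by (simp add: \<Phi>_scale[OF M] \<Phi>_cup_monom mult.assoc atLeast0LessThan)
  qed
  also have "\<dots> = f * \<Phi> h"
    by (simp flip: sum_distrib_right poly_alg_expand)
  finally show ?thesis .
qed

lemma \<Phi>_one: "\<Phi> (const_cochain 1) = 1"
proof (rule poly_mapping_eqI)
  fix m
  show "mlookup (\<Phi> (const_cochain 1)) m = mlookup 1 m"
  proof (cases "m = 0")
    case True
    have "slant scale 0 s (const_cochain 1) = const_cochain 1" for s
      by (simp add: fun_eq_iff slant_def[OF vs] cyc_eval.simps[OF vs])
    then have "pairing scale (map (\<lambda>i. (0, f i)) is) (const_cochain 1) = 1" for f and "is" :: "nat list"
      by (induction "is") (simp_all add: pairing.simps[OF vs] const_cochain_def)
    then show ?thesis
      using True by (simp add: lookup_\<Phi> const_cochain retract_coeff_def[OF vs] pairing_list_def[OF vs])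
  next
    case False
    then obtain i where i: "i \<in> mkeys m" by fastforce
    then have "0 < (\<Sum>i\<in>mkeys m. mlookup m i)"
      by (intro sum_pos2[of _ i]) (auto simp: in_keys_iff)
    then have "pairing scale (pairing_list cs m) (const_cochain 1) = pairing scale (pairing_list cs m) (\<lambda>_. 0)"
      if "mkeys m \<subseteq> {..<length cs}"
      using that by (intro pairing_cong[OF vs]) (auto simp: sum_pairing_list[OF vs] const_cochain_def)
    then show ?thesis
      using False by (simp add: lookup_\<Phi> const_cochain retract_coeff_def[OF vs] pairing_zero[OF vs] lookup_one when_def)
  qed
qed

lemma \<Phi>_cup_poly_self: "f \<in> poly_carrier (length cs) \<Longrightarrow> \<Phi> (cup_poly bock (length cs) f) = f"
proof -
  assume f: "f \<in> poly_carrier (length cs)"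
  have "cup (cup_poly bock (length cs) f) (const_cochain 1) = cup_poly bock (length cs) f"
    by (simp add: fun_eq_iff cup_const_right)
  then show ?thesis using \<Phi>_cup_poly[OF f const_cochain[of 1]] by (simp add: \<Phi>_one)
qed

abbreviation "\<beta> \<equiv> bockstein_map scale C cs"

lemma \<beta>_eq: "\<beta> f = cls (cup_poly bock (length cs) f)"
proof -
  have "additive_subgroup_set C" by unfold_locales
  from bockstein_map_eq[OF this, of cs scale, folded bock_def, OF bock_cocycle] show ?thesis .
qed

lemma \<beta>_carrier: "\<beta> f \<in> carrier H"
  unfolding \<beta>_eq by (intro cls_carrier cup_poly_cocycle bock_cocycle)

lemma \<beta>_mult: "\<beta> f \<otimes>\<^bsub>H\<^esub> \<beta> g = \<beta> (f * g)"
  unfolding \<beta>_eq by (intro cls_cup_poly_mult bock_cocycle bock_degree)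

lemma \<beta>_sum: "finite A \<Longrightarrow> (\<Oplus>\<^bsub>H\<^esub>i\<in>A. \<beta> (f i)) = \<beta> (\<Sum>i\<in>A. f i)"
  unfolding \<beta>_eq
  by (subst finsum_cls) (auto intro: cup_poly_cocycle bock_cocycle simp: cup_poly_sum[abs_def])

text \<open>
  A relation between polynomials becomes a relation between cohomology classes, because the Bockstein
  map is a ring homomorphism. There regularity applies, and the retraction \<open>\<Phi>\<close>, which kills coboundaries
  and is linear over the polynomials, brings the resulting combination back.
\<close>

lemma regular_on_of_cohomology:
  assumes reg: "regular_sequence (module_via (\<lambda>x. \<beta> (\<sigma> x)) H) xs"
    and \<sigma>: "\<And>x. \<sigma> x \<in> poly_carrier (length cs)"
  shows "regular_on (poly_carrier (length cs)) (map \<sigma> xs)"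
  unfolding regular_on_def
proof (intro allI ballI impI)
  let ?M = "module_via (\<lambda>x. \<beta> (\<sigma> x)) H"
  fix i u b
  assume i: "i < length (map \<sigma> xs)" and u: "u \<in> poly_carrier (length cs)"
    and b: "\<forall>j<i. b j \<in> poly_carrier (length cs)"
    and eq: "map \<sigma> xs ! i * u = (\<Sum>j<i. map \<sigma> xs ! j * b j)"
  have i': "i < length xs" using i by simp
  have sub: "seq_submodule ?M (take i xs) = {(\<Oplus>\<^bsub>H\<^esub>j\<in>{..<i}. \<beta> (\<sigma> (xs ! j)) \<otimes>\<^bsub>H\<^esub> w j) | w. w \<in> {..<i} \<rightarrow> carrier H}"
  proof -
    interpret ring H by (rule ring_cohomology)
    have "(\<Oplus>\<^bsub>?M\<^esub>j\<in>{..<length (take i xs)}. (take i xs ! j) \<odot>\<^bsub>?M\<^esub> w j) =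
        (\<Oplus>\<^bsub>H\<^esub>j\<in>{..<i}. \<beta> (\<sigma> (xs ! j)) \<otimes>\<^bsub>H\<^esub> w j)" if "w \<in> {..<i} \<rightarrow> carrier H" for w
      unfolding finsum_module_via using i' that \<beta>_carrier
      by (intro finsum_cong') (auto simp: module_via_def)
    then show ?thesis
      using i' unfolding seq_submodule_def by (auto simp: module_via_def min_def)
  qed
  have "\<beta> (\<sigma> (xs ! i)) \<otimes>\<^bsub>H\<^esub> \<beta> u = \<beta> (\<Sum>j<i. \<sigma> (xs ! j) * b j)"
    using eq i' by (simp add: \<beta>_mult)
  also have "\<dots> = (\<Oplus>\<^bsub>H\<^esub>j\<in>{..<i}. \<beta> (\<sigma> (xs ! j)) \<otimes>\<^bsub>H\<^esub> \<beta> (b j))"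
    by (simp add: \<beta>_sum \<beta>_mult)
  finally have "(xs ! i) \<odot>\<^bsub>?M\<^esub> \<beta> u \<in> seq_submodule ?M (take i xs)"
    unfolding sub using \<beta>_carrier by (auto simp: module_via_def intro!: exI[of _ "\<lambda>j. \<beta> (b j)"])
  then have "\<beta> u \<in> seq_submodule ?M (take i xs)"
    using reg i' \<beta>_carrier unfolding regular_sequence_def by (simp add: module_via_def)
  then obtain w where w: "w \<in> {..<i} \<rightarrow> carrier H" "\<beta> u = (\<Oplus>\<^bsub>H\<^esub>j\<in>{..<i}. \<beta> (\<sigma> (xs ! j)) \<otimes>\<^bsub>H\<^esub> w j)"
    unfolding sub by blast
  have "\<exists>c\<in>carrier Z. w j = cls c" if "j < i" for j
    using cohomologyE[of "w j"] w(1) that by blast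
  then obtain c where c: "\<And>j. j < i \<Longrightarrow> c j \<in> carrier Z" "\<And>j. j < i \<Longrightarrow> w j = cls (c j)"
    by metis
  let ?P = "\<lambda>f. cup_poly bock (length cs) f"
  have P: "?P f \<in> carrier Z" for f by (intro cup_poly_cocycle bock_cocycle)
  have cup: "cup (?P (\<sigma> (xs ! j))) (c j) \<in> carrier Z" if "j < i" for j
    using cup_cocycle[OF P c(1)[OF that]] .
  have "(\<Oplus>\<^bsub>H\<^esub>j\<in>{..<i}. \<beta> (\<sigma> (xs ! j)) \<otimes>\<^bsub>H\<^esub> w j) = (\<Oplus>\<^bsub>H\<^esub>j\<in>{..<i}. cls (cup (?P (\<sigma> (xs ! j))) (c j)))"
  proof -
    interpret ring H by (rule ring_cohomology)
    show ?thesis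
      by (intro finsum_cong') (auto simp: \<beta>_eq c cls_cup[OF P c(1)] intro: cls_carrier cup)
  qed
  also have "\<dots> = cls (\<lambda>l. \<Sum>j<i. cup (?P (\<sigma> (xs ! j))) (c j) l)"
    by (intro finsum_cls) (auto intro: cup)
  finally have "cls (?P u) = cls (\<lambda>l. \<Sum>j<i. cup (?P (\<sigma> (xs ! j))) (c j) l)"
    using w(2) by (simp add: \<beta>_eq)
  then obtain e where e: "e \<in> cochains C"
    and diff: "\<And>l. ?P u l - (\<Sum>j<i. cup (?P (\<sigma> (xs ! j))) (c j) l) = differential C e l"
    by (rule cls_eqD[OF _ P sum_cocycle]) (auto intro: cup)
  have cc: "c j \<in> cochains C" "cup (?P (\<sigma> (xs ! j))) (c j) \<in> cochains C" if "j < i" for j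
    using c(1)[OF that] cup[OF that] by (simp_all add: cocycle_ring_simps)
  note sum = \<Phi>_sum[of "{..<i}" "\<lambda>j. cup (?P (\<sigma> (xs ! j))) (c j)"]
  have "?P u = (\<lambda>l. (\<Sum>j<i. cup (?P (\<sigma> (xs ! j))) (c j) l) + differential C e l)"
    by (simp add: fun_eq_iff flip: diff)
  then have "\<Phi> (?P u) = \<Phi> (\<lambda>l. (\<Sum>j<i. cup (?P (\<sigma> (xs ! j))) (c j) l) + differential C e l)"
    by simp
  also have "\<dots> = (\<Sum>j<i. \<Phi> (cup (?P (\<sigma> (xs ! j))) (c j)))"
    using sum cc e by (simp add: \<Phi>_add differential_cochain \<Phi>_differential)
  finally have "u = (\<Sum>j<i. \<sigma> (xs ! j) * \<Phi> (c j))"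
    using cc \<sigma> u by (simp add: \<Phi>_cup_poly_self \<Phi>_cup_poly)
  then show "\<exists>a. (\<forall>j<i. a j \<in> poly_carrier (length cs)) \<and> u = (\<Sum>j<i. map \<sigma> xs ! j * a j)"
    using i' cc \<Phi>_carrier by (intro exI[of _ "\<lambda>j. \<Phi> (c j)"]) auto
qed

end

section \<open>Regular sequences in rings of invariants\<close>

lemma invariant_ring_simps:
  "monoid.mult (invariant_ring scale bs G \<rho>) = (*)" "add (invariant_ring scale bs G \<rho>) = (+)"
  "zero (invariant_ring scale bs G \<rho>) = 0"
  by (simp_all add: invariant_ring_def)

lemma regular_sequence_invariant_ring:
  assumes G: "group G" and reg: "regular_on (invariants scale bs \<rho> (carrier G)) xs"
    and xs: "set xs \<subseteq> invariants scale bs \<rho> (carrier G)"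
  shows "regular_sequence (module_via id (invariant_ring scale bs G \<rho>)) xs"
proof -
  let ?R = "invariant_ring scale bs G \<rho>" and ?S = "invariants scale bs \<rho> (carrier G)"
  let ?M = "module_via id ?R"
  have carrier: "carrier ?R = ?S" by (rule carrier_invariant_ring[OF G])
  have zero: "0 \<in> ?S" using invariants_const[of 0] by (simp add: poly_const_simps)
  interpret abelian_monoid ?R
    by (rule abelian_monoidI) (auto simp: carrier invariant_ring_simps zero invariants_add)
  have finsum: "finsum ?R f A = sum f A" if "finite A" "f \<in> A \<rightarrow> ?S" for f :: "nat \<Rightarrow> _" and A
    using that by induction (auto simp: finsum_insert carrier invariant_ring_simps)
  have sub: "seq_submodule ?M (take i xs) = {(\<Sum>j<i. xs ! j * w j) | w. w \<in> {..<i} \<rightarrow> ?S}" if i: "i < length xs" for i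
  proof -
    have eq: "(\<Oplus>\<^bsub>?M\<^esub>j\<in>{..<i}. (take i xs ! j) \<odot>\<^bsub>?M\<^esub> w j) = (\<Sum>j<i. xs ! j * w j)"
      if w: "w \<in> {..<i} \<rightarrow> ?S" for w
    proof -
      have "(\<Oplus>\<^bsub>?M\<^esub>j\<in>{..<i}. (take i xs ! j) \<odot>\<^bsub>?M\<^esub> w j) = finsum ?R (\<lambda>j. take i xs ! j * w j) {..<i}"
        unfolding finsum_module_via by (simp add: module_via_def invariant_ring_simps)
      also have "\<dots> = (\<Sum>j<i. take i xs ! j * w j)"
        using i xs w by (intro finsum) (auto intro!: invariants_mult)
      also have "\<dots> = (\<Sum>j<i. xs ! j * w j)" by (intro sum.cong) auto
      finally show ?thesis .
    qed
    have "carrier ?M = ?S" by (simp add: module_via_def carrier)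
    moreover have "length (take i xs) = i" using i by simp
    ultimately show ?thesis
      unfolding seq_submodule_def by (intro Collect_cong ex_cong1 iffI; elim conjE; simp only: eq simp_thms)
  qed
  show ?thesis
    unfolding regular_sequence_def
  proof (intro allI impI ballI)
    fix i u assume i: "i < length xs" and "u \<in> carrier ?M"
      and "(xs ! i) \<odot>\<^bsub>?M\<^esub> u \<in> seq_submodule ?M (take i xs)"
    then obtain b where u: "u \<in> ?S" and b: "b \<in> {..<i} \<rightarrow> ?S" "xs ! i * u = (\<Sum>j<i. xs ! j * b j)"
      unfolding sub[OF i] by (auto simp: module_via_def carrier invariant_ring_simps)
    have "\<And>j. j < i \<Longrightarrow> b j \<in> ?S" using b(1) by auto
    then obtain a where a: "\<And>j. j < i \<Longrightarrow> a j \<in> ?S" "u = (\<Sum>j<i. xs ! j * a j)"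
      using regular_onD[OF reg i u _ b(2)] by blast
    then have "a \<in> {..<i} \<rightarrow> ?S" by simp
    then show "u \<in> seq_submodule ?M (take i xs)"
      unfolding sub[OF i] using a(2) by blast
  qed
qed

text \<open>
  Regularity of the restrictions gives regularity on the \<open>P\<close>-invariants by translation, and then on the
  \<open>G\<close>-invariants by transfer, since a Sylow subgroup has index prime to \<open>p\<close>.
\<close>

lemma regular_on_invariants:
  fixes scale :: "'p::prime_card mod_ring \<Rightarrow> 'v::ab_group_add \<Rightarrow> 'v" and bs :: "'v list"
  assumes V: "vector_space scale" "basis_list scale UNIV bs"
    and G: "group G" "finite (carrier G)" and rep: "\<rho> \<in> hom G (GL scale)"
    and P: "sylow_subgroup CARD('p) P G" and cs: "set cs \<subseteq> fixed_space \<rho> P"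
    and xs: "set xs \<subseteq> invariants scale bs \<rho> (carrier G)" "\<And>x. x \<in> set xs \<Longrightarrow> homogeneous_pos x"
    and reg: "regular_on (poly_carrier (length cs)) (map (pullback scale bs cs id) xs)"
  shows "regular_on (invariants scale bs \<rho> (carrier G)) xs"
proof -
  interpret vector_space scale by fact
  have sub: "subgroup P G" using P by (simp add: sylow_subgroup_def)
  then have PG: "P \<subseteq> carrier G" by (rule subgroup.subset)
  have "set xs \<subseteq> invariants scale bs \<rho> P"
    using xs(1) PG by (auto simp: invariants_def)
  then have "regular_on (invariants scale bs \<rho> P) xs"
    using PG linear_of_GL[OF rep] by (intro regular_on_invariants_of_fixed[OF V(2) _ cs _ xs(2) reg]) auto
  then show ?thesis
    by (rule regular_on_transfer[OF V(2) G(1) sub rep sylow_index[OF G P] xs(1)])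
qed

theorem theorem4p21:
  fixes scale :: "'p::prime_card mod_ring \<Rightarrow> 'v::ab_group_add \<Rightarrow> 'v"
    and bs cs :: "'v list" and n0 :: nat
    and G :: "('g, 'z) monoid_scheme" and \<rho> :: "'g \<Rightarrow> 'v \<Rightarrow> 'v"
    and P :: "'g set" and C :: "'v set"
  assumes V: "vector_space scale" "basis_list scale UNIV bs" "length bs = n0"
    and G: "group G" "finite (carrier G)" "CARD('p) dvd Coset.order G"
    and rep: "\<rho> \<in> hom G (GL scale)" "inj_on \<rho> (carrier G)"
    and P: "sylow_subgroup CARD('p) P G"
    and C: "Modules.module.subspace scale C" "C \<subseteq> fixed_space \<rho> P" "basis_list scale C cs"
  shows "(\<forall>xs. set xs \<subseteq> carrier (invariant_ring scale bs G \<rho>) \<and> (\<forall>x\<in>set xs. homogeneous_pos x)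
            \<and> regular_sequence (module_via (restriction scale bs C cs) (cohomology C)) xs
          \<longrightarrow> regular_sequence (module_via id (invariant_ring scale bs G \<rho>)) xs)
       \<and> enat (vector_space.dim scale (fixed_space \<rho> P)) \<le> depth (invariant_ring scale bs G \<rho>)"
proof (intro conjI allI impI)
  interpret vector_space scale by (rule V(1))
  note C_fixed = C(2)
  interpret bockstein_setting scale C cs by unfold_locales (rule C)+
  note carrier = carrier_invariant_ring[OF G(1), of scale bs \<rho>]
  note invariants_regular = regular_on_invariants[OF V(1,2) G(1,2) rep(1) P]
  have "set cs \<subseteq> C" using cs_C by (auto simp: in_set_conv_nth)
  then have cs_fixed: "set cs \<subseteq> fixed_space \<rho> P" using C_fixed by (rule subset_trans)
  {
    fix xs
    assume "set xs \<subseteq> carrier (invariant_ring scale bs G \<rho>) \<and> (\<forall>x\<in>set xs. homogeneous_pos x)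
      \<and> regular_sequence (module_via (restriction scale bs C cs) (cohomology C)) xs"
    then have xs: "set xs \<subseteq> invariants scale bs \<rho> (carrier G)" "\<And>x. x \<in> set xs \<Longrightarrow> homogeneous_pos x"
      and reg: "regular_sequence (module_via (\<lambda>x. \<beta> (pullback scale bs cs id x)) (cohomology C)) xs"
      by (auto simp: carrier restriction_def[abs_def])
    have "regular_on (poly_carrier (length cs)) (map (pullback scale bs cs id) xs)"
      by (rule regular_on_of_cohomology[OF reg]) (rule pullback_carrier)
    then show "regular_sequence (module_via id (invariant_ring scale bs G \<rho>)) xs"
      by (intro regular_sequence_invariant_ring[OF G(1) invariants_regular[OF cs_fixed xs] xs(1)])
  }
  \<comment> \<open>The bound for the depth comes from the case of the whole fixed space, without cohomology.\<close>
  have PG: "P \<subseteq> carrier G" using P by (auto simp: sylow_subgroup_def dest: subgroup.subset)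
  have \<rho>_add: "\<rho> g (v + w) = \<rho> g v + \<rho> g w" and \<rho>_scale: "\<rho> g (scale a v) = scale a (\<rho> g v)"
    if "g \<in> P" for g v w a
    using that PG linear_of_GL[OF rep(1), of g]
    by (auto simp: Vector_Spaces.linear_def module_hom_def module_hom_axioms_def)
  have "\<rho> g 0 = 0" if "g \<in> P" for g
    using \<rho>_scale[OF that, of 0 0] by simp
  then have "subspace (fixed_space \<rho> P)"
    by (intro subspaceI) (simp_all add: fixed_space_def \<rho>_add \<rho>_scale)
  obtain B where B: "B \<subseteq> fixed_space \<rho> P" "independent B" "fixed_space \<rho> P \<subseteq> span B"
    by (rule maximal_independent_subset)
  then have span_B: "span B = fixed_space \<rho> P"
    using span_minimal \<open>subspace (fixed_space \<rho> P)\<close> by blast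
  have "finite B"
    using independent_span_bound[of "set bs" B] B(2) V(2) by (auto simp: basis_list_def)
  then obtain ds where ds: "set ds = B" "distinct ds" using finite_distinct_list by blast
  have dim: "vector_space.dim scale (fixed_space \<rho> P) = length ds"
  proof -
    have "span B = span (fixed_space \<rho> P)" by (simp only: span_B[symmetric] span_span)
    then show ?thesis using dim_eq_card B(2) distinct_card[OF ds(2)] ds(1) by simp
  qed
  have ds_basis: "basis_list scale (fixed_space \<rho> P) ds"
    using ds B(2) span_B by (simp add: basis_list_def)
  obtain xs where xs: "length xs = length ds" "set xs \<subseteq> invariants scale bs \<rho> (carrier G)"
    "\<And>x. x \<in> set xs \<Longrightarrow> homogeneous_pos x"
    "regular_on (poly_carrier (length ds)) (map (pullback scale bs ds id) xs)"
    by (rule dickson_invariants[OF V(1,2) ds_basis, of "carrier G" \<rho>])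
      (auto intro: linear_of_GL[OF rep(1)] bij_of_GL[OF rep(1)])
  have "set ds \<subseteq> fixed_space \<rho> P" using ds B by simp
  then have "regular_sequence (module_via id (invariant_ring scale bs G \<rho>)) xs"
    using xs by (intro regular_sequence_invariant_ring[OF G(1)] invariants_regular) auto
  then show "enat (vector_space.dim scale (fixed_space \<rho> P)) \<le> depth (invariant_ring scale bs G \<rho>)"
    unfolding depth_def dim using xs by (intro Sup_upper) (auto simp: carrier intro!: exI[of _ xs])
qed

end
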